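(* Let $L$ be a simple countable linear order with Hausdorff rank $r(L)=\alpha$ (a countable ordinal). Then $L$ has a $\Pi_{2\alpha+1}$ Scott sentence.
   Context: Infinitary formulas of $L_{\omega_1\omega}$: a formula is $\Sigma_0$ iff it is $\Pi_0$ iff it is finitary and quantifier-free. For a countable ordinal $\alpha>0$, a $\Sigma_\alpha$ formula has the form $\bigvee_{i\in\omega}\exists\bar x\,\varphi_i(\bar x)$ with each $\varphi_i$ a $\Pi_\beta$ formula for some $\beta<\alpha$; a $\Pi_\alpha$ formula has the form $\bigwedge_{i\in\omega}\forall \bar x\,\varphi_i(\bar x)$ with each $\varphi_i$ a $\Sigma_\beta$ formula for some $\beta<\alpha$. A Scott sentence of a countable structure $\mathcal A$ is an $L_{\omega_1\omega}$ sentence that holds in a countable structure iff that structure is isomorphic to $\mathcal A$. Hausdorff rank: $HR_0$ is the class of finite linear orders (including the empty order). For countable $\alpha>0$, $HR_\alpha$ is the least class of linear orders containing all orders $\sum_{i\in\zeta}L_i$ (where $\zeta$ is the order type of the integers) with each $L_i\in\bigcup_{\beta<\alpha}HR_\beta$, and closed under finite sums. $r(L)$ is the least $\alpha$ with $L\in HR_\alpha$. Simple: a linear order $L$ of Hausdorff rank $\alpha$ is simple if $L=\sum_{i\in\omega}L_i+\sum_{j\in\omega^*}L_j$ (each $L_i,L_j$ a linear order) with $\lim_{i\to\omega}(r(L_i)+1)=\alpha$ or $\lim_{j\to\omega^*}(r(L_j)+1)=\alpha$.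
   Formalization: In the definition of simple, all summands L_i and L_j on both sides are additionally required to have Hausdorff rank below α; as printed, ω+ω = ω+1+1+… would be simple of rank 1, yet it has no Π_3 Scott sentence. *)

theory Defs
  imports Complex_Main "HOL-Library.Countable_Set" "HOL-Library.Disjoint_Sets"
begin

section \<open>Countable ordinals\<close>

text \<open>
  The countable ordinals are the elements of the first uncountable cardinal, the library's
  cardinal successor of \<open>natLeq\<close>; \<open>countable_strict_lower_set\<close>, \<open>uncountable_UNIV_cord\<close> and
  \<open>countable_set_bounded\<close> below show that this is the well-order of type \<open>\<omega>\<^sub>1\<close>.
\<close>

typedef cord = "Field (cardSuc natLeq)"
  morphisms cord_elem Abs_cord
proof -
  have "infinite (Field (cardSuc natLeq))"
    using cardSuc_finite[OF natLeq_Card_order] by (simp add: Field_natLeq)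
  then show ?thesis
    by (metis ex_in_conv finite.emptyI)
qed


instantiation cord :: linorder
begin

definition less_eq_cord :: "cord \<Rightarrow> cord \<Rightarrow> bool" where
  "a \<le> b \<longleftrightarrow> (cord_elem a, cord_elem b) \<in> cardSuc natLeq"

definition less_cord :: "cord \<Rightarrow> cord \<Rightarrow> bool" where
  "a < b \<longleftrightarrow> a \<le> b \<and> \<not> b \<le> (a :: cord)"

lemma Well_order_cardSuc_natLeq: "Well_order (cardSuc natLeq)"
  using cardSuc_Card_order[OF natLeq_Card_order] card_order_on_well_order_on by blast

instance
proof
  have "Linear_order (cardSuc natLeq)"
    using Well_order_cardSuc_natLeq by (simp add: well_order_on_def)
  then have ord: "refl_on (Field (cardSuc natLeq)) (cardSuc natLeq)" "trans (cardSuc natLeq)"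
    "antisym (cardSuc natLeq)" "total_on (Field (cardSuc natLeq)) (cardSuc natLeq)"
    unfolding linear_order_on_def partial_order_on_def preorder_on_def by blast+
  fix a b c :: cord
  show "(a < b) = (a \<le> b \<and> \<not> b \<le> a)"
    by (rule less_cord_def)
  show "a \<le> a"
    unfolding less_eq_cord_def using refl_onD[OF ord(1) cord_elem] .
  show "a \<le> c" if "a \<le> b" "b \<le> c"
    using that unfolding less_eq_cord_def by (rule transD[OF ord(2)])
  show "a = b" if "a \<le> b" "b \<le> a"
    using antisymD[OF ord(3)] that unfolding less_eq_cord_def cord_elem_inject[symmetric] by blast
  show "a \<le> b \<or> b \<le> a"
    using refl_onD[OF ord(1) cord_elem] ord(4) cord_elem[of a] cord_elem[of b]
    unfolding less_eq_cord_def total_on_def by metis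
qed

end

lemma less_cord_iff: "a < b \<longleftrightarrow> (cord_elem a, cord_elem b) \<in> cardSuc natLeq - Id"
  unfolding less_le by (auto simp: less_eq_cord_def cord_elem_inject)

instance cord :: wellorder
proof
  fix P :: "cord \<Rightarrow> bool" and a :: cord
  assume step: "\<And>x. (\<And>y. y < x \<Longrightarrow> P y) \<Longrightarrow> P x"
  have "wf (cardSuc natLeq - Id)"
    using Well_order_cardSuc_natLeq by (simp add: well_order_on_def)
  then have "wf (inv_image (cardSuc natLeq - Id) cord_elem)"
    by (rule wf_inv_image)
  then show "P a"
    by (induction a rule: wf_induct_rule) (rule step, simp add: less_cord_iff in_inv_image)
qed

lemma countable_iff_ordLeq_natLeq:
  includes cardinal_syntax
  shows "countable A \<longleftrightarrow> |A| \<le>o natLeq"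
proof -
  have "countable A \<longleftrightarrow> |A| \<le>o |UNIV :: nat set|"
    unfolding countable_def by (simp add: card_of_ordLeq[symmetric])
  also have "\<dots> \<longleftrightarrow> |A| \<le>o natLeq"
    using card_of_nat ordIso_symmetric ordLeq_ordIso_trans by blast
  finally show ?thesis .
qed

lemma countable_strict_lower_set:
  includes cardinal_syntax
  shows "countable {..<a :: cord}"
proof -
  have "|underS (cardSuc natLeq) (cord_elem a)| <o cardSuc natLeq"
    by (rule card_of_underS[OF cardSuc_Card_order[OF natLeq_Card_order] cord_elem])
  then have "\<not> cardSuc natLeq \<le>o |underS (cardSuc natLeq) (cord_elem a)|"
    using not_ordLess_ordLeq by blast
  then have "\<not> natLeq <o |underS (cardSuc natLeq) (cord_elem a)|"
    by (simp add: cardSuc_ordLess_ordLeq[OF natLeq_Card_order card_of_Card_order])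
  then have "|underS (cardSuc natLeq) (cord_elem a)| \<le>o natLeq"
    by (simp add: not_ordLess_iff_ordLeq card_of_Well_order natLeq_Well_order)
  then have "countable (underS (cardSuc natLeq) (cord_elem a))"
    by (simp add: countable_iff_ordLeq_natLeq)
  moreover have "cord_elem ` {..<a} \<subseteq> underS (cardSuc natLeq) (cord_elem a)"
    by (auto simp: less_cord_iff underS_def)
  ultimately have "countable (cord_elem ` {..<a})"
    using countable_subset by blast
  then show ?thesis
    by (rule countable_image_inj_on) (auto simp: inj_on_def cord_elem_inject)
qed

lemma uncountable_UNIV_cord:
  includes cardinal_syntax
  shows "uncountable (UNIV :: cord set)"
proof
  assume "countable (UNIV :: cord set)"
  then have "countable (range cord_elem)"
    by simp
  then have "countable (Field (cardSuc natLeq))"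
    by (simp add: type_definition.Rep_range[OF type_definition_cord])
  then have "|Field (cardSuc natLeq)| \<le>o natLeq"
    by (simp add: countable_iff_ordLeq_natLeq)
  moreover have "|Field (cardSuc natLeq)| =o cardSuc natLeq"
    by (rule card_of_Field_ordIso[OF cardSuc_Card_order[OF natLeq_Card_order]])
  ultimately have "cardSuc natLeq \<le>o natLeq"
    using ordIso_symmetric ordIso_ordLeq_trans by blast
  then show False
    using cardSuc_greater[OF natLeq_Card_order] not_ordLess_ordLeq by blast
qed

lemma countable_set_bounded:
  assumes "countable (S :: cord set)"
  shows "\<exists>b. \<forall>a\<in>S. a < b"
proof (rule ccontr)
  assume "\<not> ?thesis"
  then have "UNIV = (\<Union>a\<in>S. {..a})"
    by (force simp: not_less)
  moreover have "countable {..a}" for a :: cord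
  proof -
    have "{..a} = insert a {..<a}"
      by auto
    then show ?thesis
      using countable_strict_lower_set by simp
  qed
  ultimately have "countable (UNIV :: cord set)"
    using assms by (metis countable_UN)
  then show False
    using uncountable_UNIV_cord by simp
qed

instantiation cord :: linorder_topology
begin

definition open_cord :: "cord set \<Rightarrow> bool" where
  "open_cord = generate_topology (range (\<lambda>a. {..<a}) \<union> range (\<lambda>a. {a<..}))"

instance
  by standard (simp add: open_cord_def)

end

instantiation cord :: "{zero, one, plus, times}"
begin

definition zero_cord :: cord where
  "0 = (LEAST a :: cord. True)"

definition one_cord :: cord where
  "1 = (LEAST a :: cord. 0 < a)"

text \<open>
  Ordinal arithmetic in the usual convention: \<open>a + b\<close> is \<open>a\<close> followed by \<open>b\<close>, and \<open>a * b\<close>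
  is \<open>a\<close> repeated \<open>b\<close> times, i.e.\ the supremum of \<open>a * d + a\<close> for \<open>d < b\<close>
  (thus \<open>2 * \<omega> = \<omega>\<close>).
\<close>

definition plus_cord :: "cord \<Rightarrow> cord \<Rightarrow> cord" where
  "a + (b :: cord) = wfrec {(x, y). x < y} (\<lambda>f b. LEAST c :: cord. a \<le> c \<and> (\<forall>d<b. f d < c)) b"

definition times_cord :: "cord \<Rightarrow> cord \<Rightarrow> cord" where
  "a * (b :: cord) = wfrec {(x, y). x < y} (\<lambda>f b. LEAST c :: cord. \<forall>d<b. f d + a \<le> c) b"

instance ..

end

lemma plus_cord_rec: "a + b = (LEAST c. a \<le> c \<and> (\<forall>d<b. a + d < (c :: cord)))"
  unfolding plus_cord_def by (subst wfrec[OF wf]) (simp add: cut_apply cong: conj_cong)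

lemma times_cord_rec: "a * b = (LEAST c. \<forall>d<b. a * d + a \<le> (c :: cord))"
  unfolding times_cord_def by (subst wfrec[OF wf]) (simp add: cut_apply)

lemma zero_le_cord [simp]: "0 \<le> (a :: cord)"
  unfolding zero_cord_def by (simp add: Least_le)

lemma plus_cord_le_iff: "a + b \<le> c \<longleftrightarrow> a \<le> c \<and> (\<forall>d<b. a + d < (c :: cord))"
proof -
  have "countable (insert a ((+) a ` {..<b}))"
    using countable_strict_lower_set by simp
  then obtain u where "\<forall>x \<in> insert a ((+) a ` {..<b}). x < u"
    using countable_set_bounded by blast
  then have "a \<le> u \<and> (\<forall>d. d < b \<longrightarrow> a + d < u)"
    by auto
  then have "a \<le> a + b \<and> (\<forall>d. d < b \<longrightarrow> a + d < a + b)"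
    unfolding plus_cord_rec[of a b] by (rule LeastI)
  moreover have "a + b \<le> c" if "a \<le> c \<and> (\<forall>d. d < b \<longrightarrow> a + d < c)"
    unfolding plus_cord_rec[of a b] using that by (rule Least_le)
  ultimately show ?thesis
    by (meson order.strict_trans2 order.trans)
qed

lemma times_cord_le_iff: "a * b \<le> c \<longleftrightarrow> (\<forall>d<b. a * d + a \<le> (c :: cord))"
proof -
  have "countable ((\<lambda>d. a * d + a) ` {..<b})"
    using countable_strict_lower_set by simp
  then obtain u where "\<forall>x \<in> (\<lambda>d. a * d + a) ` {..<b}. x < u"
    using countable_set_bounded by blast
  then have "\<forall>d. d < b \<longrightarrow> a * d + a \<le> u"
    by (simp add: le_less)
  then have "\<forall>d. d < b \<longrightarrow> a * d + a \<le> a * b"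
    unfolding times_cord_rec[of a b] by (rule LeastI)
  moreover have "a * b \<le> c" if "\<forall>d. d < b \<longrightarrow> a * d + a \<le> c"
    unfolding times_cord_rec[of a b] using that by (rule Least_le)
  ultimately show ?thesis
    by (meson order.trans)
qed

lemma less_plus_cord_iff: "c < a + b \<longleftrightarrow> c < a \<or> (\<exists>d<b. c \<le> a + (d :: cord))"
  using plus_cord_le_iff[of a b c] by (meson not_le)

instance cord :: semigroup_add
proof
  fix a b c :: cord
  show "a + b + c = a + (b + c)"
  proof (induction c rule: less_induct)
    case (less c)
    have "a + b + c \<le> e \<longleftrightarrow> a + (b + c) \<le> e" for e
    proof -
      have mono: "a + d < a + d'" if "d < d'" for d d'
        using that plus_cord_le_iff[of a d' "a + d'"] by blast
      then have mono': "a + d \<le> a + d'" if "d \<le> d'" for d d'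
        using that by (metis le_less)
      have "a + b + c \<le> e \<longleftrightarrow> a + b \<le> e \<and> (\<forall>d<c. a + (b + d) < e)"
        by (subst plus_cord_le_iff) (auto simp: less)
      also have "\<dots> \<longleftrightarrow> a \<le> e \<and> (\<forall>x<b + c. a + x < e)"
        unfolding plus_cord_le_iff[of a b] less_plus_cord_iff[of _ b c]
        by (smt (verit) mono mono' le_less_trans order_refl less_plus_cord_iff)
      also have "\<dots> \<longleftrightarrow> a + (b + c) \<le> e"
        by (rule plus_cord_le_iff[symmetric])
      finally show ?thesis .
    qed
    then show ?case
      by (meson order.antisym order_refl)
  qed
qed

instance cord :: numeral ..

lemma add_one_cord: "a + 1 \<le> b \<longleftrightarrow> a < (b :: cord)"
proof -
  have "\<exists>u :: cord. 0 < u"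
    using countable_set_bounded[of "{0}"] by auto
  then have "0 < (1 :: cord)"
    unfolding one_cord_def by (rule LeastI_ex)
  moreover have "d = 0" if "d < 1" for d :: cord
    using that not_less_Least[of d "\<lambda>a. 0 < a"] zero_le_cord[of d]
    unfolding one_cord_def by (metis le_less)
  moreover have "a + 0 = a"
    using plus_cord_le_iff[of a 0] by (meson order.antisym order_refl not_le zero_le_cord)
  ultimately show ?thesis
    unfolding plus_cord_le_iff[of a 1 b] by (metis le_less)
qed


section \<open>Infinitary formulas in the language of one binary relation\<close>

datatype fm =
    Verum
  | Eqv nat nat
  | Rel nat nat
  | Neg fm
  | And fm fm
  | Or fm fm
  | Exi nat fm
  | Uni nat fm
  | BigOr "nat \<Rightarrow> fm"
  | BigAnd "nat \<Rightarrow> fm"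

primrec fv :: "fm \<Rightarrow> nat set" where
  "fv Verum = {}"
| "fv (Eqv x y) = {x, y}"
| "fv (Rel x y) = {x, y}"
| "fv (Neg \<phi>) = fv \<phi>"
| "fv (And \<phi> \<psi>) = fv \<phi> \<union> fv \<psi>"
| "fv (Or \<phi> \<psi>) = fv \<phi> \<union> fv \<psi>"
| "fv (Exi x \<phi>) = fv \<phi> - {x}"
| "fv (Uni x \<phi>) = fv \<phi> - {x}"
| "fv (BigOr \<Phi>) = (\<Union>i. fv (\<Phi> i))"
| "fv (BigAnd \<Phi>) = (\<Union>i. fv (\<Phi> i))"

text \<open>
  Satisfaction in the structure with universe \<open>A\<close>, in which \<open>Rel\<close> is interpreted by \<open>R\<close>.
  Universes may be empty, so the assignment \<open>s\<close> is not required to take values in \<open>A\<close>.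
\<close>

primrec sat :: "'a set \<Rightarrow> 'a rel \<Rightarrow> (nat \<Rightarrow> 'a) \<Rightarrow> fm \<Rightarrow> bool" where
  "sat A R s Verum \<longleftrightarrow> True"
| "sat A R s (Eqv x y) \<longleftrightarrow> s x = s y"
| "sat A R s (Rel x y) \<longleftrightarrow> (s x, s y) \<in> R"
| "sat A R s (Neg \<phi>) \<longleftrightarrow> \<not> sat A R s \<phi>"
| "sat A R s (And \<phi> \<psi>) \<longleftrightarrow> sat A R s \<phi> \<and> sat A R s \<psi>"
| "sat A R s (Or \<phi> \<psi>) \<longleftrightarrow> sat A R s \<phi> \<or> sat A R s \<psi>"
| "sat A R s (Exi x \<phi>) \<longleftrightarrow> (\<exists>a\<in>A. sat A R (s(x := a)) \<phi>)"
| "sat A R s (Uni x \<phi>) \<longleftrightarrow> (\<forall>a\<in>A. sat A R (s(x := a)) \<phi>)"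
| "sat A R s (BigOr \<Phi>) \<longleftrightarrow> (\<exists>i. sat A R s (\<Phi> i))"
| "sat A R s (BigAnd \<Phi>) \<longleftrightarrow> (\<forall>i. sat A R s (\<Phi> i))"

inductive finitary_qf :: "fm \<Rightarrow> bool" where
  "finitary_qf Verum"
| "finitary_qf (Eqv x y)"
| "finitary_qf (Rel x y)"
| "finitary_qf \<phi> \<Longrightarrow> finitary_qf (Neg \<phi>)"
| "finitary_qf \<phi> \<Longrightarrow> finitary_qf \<psi> \<Longrightarrow> finitary_qf (And \<phi> \<psi>)"
| "finitary_qf \<phi> \<Longrightarrow> finitary_qf \<psi> \<Longrightarrow> finitary_qf (Or \<phi> \<psi>)"

definition Exs :: "nat list \<Rightarrow> fm \<Rightarrow> fm" where
  "Exs xs \<phi> = foldr Exi xs \<phi>"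

definition Unis :: "nat list \<Rightarrow> fm \<Rightarrow> fm" where
  "Unis xs \<phi> = foldr Uni xs \<phi>"

inductive Sigma_fm :: "cord \<Rightarrow> fm \<Rightarrow> bool" and Pi_fm :: "cord \<Rightarrow> fm \<Rightarrow> bool" where
  Sigma_zero: "finitary_qf \<phi> \<Longrightarrow> Sigma_fm 0 \<phi>"
| Pi_zero: "finitary_qf \<phi> \<Longrightarrow> Pi_fm 0 \<phi>"
| Sigma_pos: "0 < \<alpha> \<Longrightarrow> (\<forall>i. \<exists>\<beta><\<alpha>. Pi_fm \<beta> (\<Phi> i)) \<Longrightarrow> Sigma_fm \<alpha> (BigOr (\<lambda>i. Exs (xs i) (\<Phi> i)))"
| Pi_pos: "0 < \<alpha> \<Longrightarrow> (\<forall>i. \<exists>\<beta><\<alpha>. Sigma_fm \<beta> (\<Phi> i)) \<Longrightarrow> Pi_fm \<alpha> (BigAnd (\<lambda>i. Unis (xs i) (\<Phi> i)))"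

definition models :: "'a set \<Rightarrow> 'a rel \<Rightarrow> fm \<Rightarrow> bool" where
  "models A R \<phi> \<longleftrightarrow> (\<forall>s. sat A R s \<phi>)"

definition structure_iso :: "('a \<Rightarrow> 'b) \<Rightarrow> 'a set \<Rightarrow> 'a rel \<Rightarrow> 'b set \<Rightarrow> 'b rel \<Rightarrow> bool" where
  "structure_iso f A R B S \<longleftrightarrow>
     bij_betw f A B \<and> (\<forall>x\<in>A. \<forall>y\<in>A. (x, y) \<in> R \<longleftrightarrow> (f x, f y) \<in> S)"

definition isomorphic_structures :: "'a set \<Rightarrow> 'a rel \<Rightarrow> 'b set \<Rightarrow> 'b rel \<Rightarrow> bool" where
  "isomorphic_structures A R B S \<longleftrightarrow> (\<exists>f. structure_iso f A R B S)"

text \<open>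
  Countable structures are represented by those whose universe is a set of natural numbers;
  \<open>scott_sentence_iff\<close> below shows that this covers countable structures over every type.
\<close>

definition scott_sentence :: "'a set \<Rightarrow> 'a rel \<Rightarrow> fm \<Rightarrow> bool" where
  "scott_sentence A R \<phi> \<longleftrightarrow> fv \<phi> = {} \<and>
     (\<forall>(B :: nat set) S. S \<subseteq> B \<times> B \<longrightarrow> (models B S \<phi> \<longleftrightarrow> isomorphic_structures B S A R))"

lemma sat_cong: "(\<And>x. x \<in> fv \<phi> \<Longrightarrow> s x = t x) \<Longrightarrow> sat A R s \<phi> \<longleftrightarrow> sat A R t \<phi>"
proof (induction \<phi> arbitrary: s t)
  case (Exi x \<phi>)
  have "sat A R (s(x := a)) \<phi> \<longleftrightarrow> sat A R (t(x := a)) \<phi>" for a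
    by (rule Exi.IH) (use Exi.prems in auto)
  then show ?case by simp
next
  case (Uni x \<phi>)
  have "sat A R (s(x := a)) \<phi> \<longleftrightarrow> sat A R (t(x := a)) \<phi>" for a
    by (rule Uni.IH) (use Uni.prems in auto)
  then show ?case by simp
next
  case (And \<phi> \<psi>)
  have "sat A R s \<phi> = sat A R t \<phi>"
    by (rule And.IH(1)) (use And.prems in auto)
  moreover have "sat A R s \<psi> = sat A R t \<psi>"
    by (rule And.IH(2)) (use And.prems in auto)
  ultimately show ?case by simp
next
  case (Or \<phi> \<psi>)
  have "sat A R s \<phi> = sat A R t \<phi>"
    by (rule Or.IH(1)) (use Or.prems in auto)
  moreover have "sat A R s \<psi> = sat A R t \<psi>"
    by (rule Or.IH(2)) (use Or.prems in auto)
  ultimately show ?case by simp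
next
  case (Neg \<phi>)
  then show ?case by (metis fv.simps(4) sat.simps(4))
next
  case (BigOr \<Phi>)
  have "sat A R s (\<Phi> i) = sat A R t (\<Phi> i)" for i
    by (rule BigOr.IH) (use BigOr.prems in auto)
  then show ?case by simp
next
  case (BigAnd \<Phi>)
  have "sat A R s (\<Phi> i) = sat A R t (\<Phi> i)" for i
    by (rule BigAnd.IH) (use BigAnd.prems in auto)
  then show ?case by simp
qed auto

lemma sat_structure_iso:
  assumes "structure_iso f A R B S" "\<And>x. x \<in> fv \<phi> \<Longrightarrow> s x \<in> A"
  shows "sat A R s \<phi> \<longleftrightarrow> sat B S (f \<circ> s) \<phi>"
  using assms(2)
proof (induction \<phi> arbitrary: s)
  case (Eqv x y)
  then show ?case
    using assms(1) by (auto simp: structure_iso_def bij_betw_def inj_on_eq_iff)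
next
  case (Rel x y)
  then show ?case
    using assms(1) by (auto simp: structure_iso_def)
next
  case (Exi x \<phi>)
  have "sat A R (s(x := a)) \<phi> \<longleftrightarrow> sat B S ((f \<circ> s)(x := f a)) \<phi>" if "a \<in> A" for a
  proof -
    have "sat A R (s(x := a)) \<phi> \<longleftrightarrow> sat B S (f \<circ> s(x := a)) \<phi>"
      by (rule Exi.IH) (use Exi.prems that in auto)
    then show ?thesis
      by (simp add: fun_upd_comp)
  qed
  moreover have "B = f ` A"
    using assms(1) by (auto simp: structure_iso_def bij_betw_def)
  ultimately show ?case by (simp add: comp_def)
next
  case (Uni x \<phi>)
  have "sat A R (s(x := a)) \<phi> \<longleftrightarrow> sat B S ((f \<circ> s)(x := f a)) \<phi>" if "a \<in> A" for a
  proof -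
    have "sat A R (s(x := a)) \<phi> \<longleftrightarrow> sat B S (f \<circ> s(x := a)) \<phi>"
      by (rule Uni.IH) (use Uni.prems that in auto)
    then show ?thesis
      by (simp add: fun_upd_comp)
  qed
  moreover have "B = f ` A"
    using assms(1) by (auto simp: structure_iso_def bij_betw_def)
  ultimately show ?case by (simp add: comp_def)
next
  case (BigOr \<Phi>)
  have "sat A R s (\<Phi> i) \<longleftrightarrow> sat B S (f \<circ> s) (\<Phi> i)" for i
    by (rule BigOr.IH) (use BigOr.prems in auto)
  then show ?case by (simp add: comp_def)
next
  case (BigAnd \<Phi>)
  have "sat A R s (\<Phi> i) \<longleftrightarrow> sat B S (f \<circ> s) (\<Phi> i)" for i
    by (rule BigAnd.IH) (use BigAnd.prems in auto)
  then show ?case by (simp add: comp_def)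
qed auto

lemma models_structure_iso:
  assumes "structure_iso f A R B S" "fv \<phi> = {}"
  shows "models A R \<phi> \<longleftrightarrow> models B S \<phi>"
  unfolding models_def
  using sat_structure_iso[OF assms(1), of \<phi>] sat_cong[of \<phi>] assms(2) by blast

lemma structure_iso_inv:
  assumes "structure_iso f A R B S"
  shows "structure_iso (inv_into A f) B S A R"
  using assms unfolding structure_iso_def
  by (metis bij_betw_def bij_betw_inv_into f_inv_into_f inv_into_into)

lemma structure_iso_comp:
  assumes "structure_iso f A R B S" "structure_iso g B S C T"
  shows "structure_iso (g \<circ> f) A R C T"
  using assms unfolding structure_iso_def
  by (metis bij_betw_apply bij_betw_trans comp_apply)

lemma scott_sentence_iff:
  fixes B :: "'b set"
  assumes "scott_sentence A R \<phi>" "countable B"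
  shows "models B S \<phi> \<longleftrightarrow> isomorphic_structures B S A R"
proof -
  obtain f :: "'b \<Rightarrow> nat" where f: "inj_on f B"
    using assms(2) by (auto simp: countable_def)
  define S' where "S' = {(f x, f y) | x y. x \<in> B \<and> y \<in> B \<and> (x, y) \<in> S}"
  have iso: "structure_iso f B S (f ` B) S'"
    using f unfolding structure_iso_def S'_def bij_betw_def by (auto simp: inj_on_eq_iff)
  have "S' \<subseteq> f ` B \<times> f ` B"
    by (auto simp: S'_def)
  then have "models (f ` B) S' \<phi> \<longleftrightarrow> isomorphic_structures (f ` B) S' A R"
    using assms(1) unfolding scott_sentence_def by blast
  also have "\<dots> \<longleftrightarrow> isomorphic_structures B S A R"
    unfolding isomorphic_structures_def
    using iso structure_iso_comp structure_iso_inv by metis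
  finally show ?thesis
    using models_structure_iso[OF iso] assms(1) by (simp add: scott_sentence_def)
qed


section \<open>Linear orders, Hausdorff rank, simple orders\<close>

text \<open>
  A linear order is a reflexive relation \<open>r\<close> with \<open>Linear_order r\<close>; its universe is \<open>Field r\<close>,
  so the empty order is \<open>{}\<close>.  Ordered sums are taken internally: \<open>is_sum I M K\<close> says that \<open>K\<close>
  is the sum of the orders \<open>M i\<close>, with pairwise disjoint universes, along the index order \<open>I\<close>.
  Any order isomorphic to an abstract sum is such an internal sum, the summands being the
  images of the abstract ones.
\<close>

definition is_sum :: "'i rel \<Rightarrow> ('i \<Rightarrow> 'a rel) \<Rightarrow> 'a rel \<Rightarrow> bool" where
  "is_sum I M K \<longleftrightarrow> disjoint_family_on (\<lambda>i. Field (M i)) (Field I) \<and>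
     K = (\<Union>i\<in>Field I. M i) \<union> (\<Union>(i, j)\<in>I - Id. Field (M i) \<times> Field (M j))"

definition is_sum2 :: "'a rel \<Rightarrow> 'a rel \<Rightarrow> 'a rel \<Rightarrow> bool" where
  "is_sum2 X Y K \<longleftrightarrow> Field X \<inter> Field Y = {} \<and> K = X \<union> Y \<union> Field X \<times> Field Y"

definition zetaLeq :: "int rel" where
  "zetaLeq = {(i, j). i \<le> j}"

text \<open>
  \<open>HR \<alpha> K\<close> for a linear order \<open>K\<close>.  The classes for \<open>\<beta> < \<alpha>\<close> do not depend on the class
  for \<open>\<alpha>\<close>, so one joint inductive definition yields the level-by-level least classes.
\<close>

inductive HR :: "cord \<Rightarrow> 'a rel \<Rightarrow> bool" where
  HR_finite: "Linear_order K \<Longrightarrow> finite (Field K) \<Longrightarrow> HR 0 K"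
| HR_zeta_sum: "0 < \<alpha> \<Longrightarrow> (\<forall>i. \<exists>\<beta><\<alpha>. HR \<beta> (M i)) \<Longrightarrow> is_sum zetaLeq M K \<Longrightarrow> HR \<alpha> K"
| HR_finite_sum: "0 < \<alpha> \<Longrightarrow> (\<forall>i<n. HR \<alpha> (M i)) \<Longrightarrow> is_sum (natLeq_on n) M K \<Longrightarrow> HR \<alpha> K"

lemma Field_is_sum:
  assumes "is_sum I M K"
  shows "Field K = (\<Union>i\<in>Field I. Field (M i))"
proof -
  have K: "K = (\<Union>i\<in>Field I. M i) \<union> (\<Union>(i, j)\<in>I - Id. Field (M i) \<times> Field (M j))"
    using assms by (simp add: is_sum_def)
  show ?thesis
  proof (intro equalityI subsetI)
    fix x assume "x \<in> Field K"
    then obtain y where "(x, y) \<in> K \<or> (y, x) \<in> K"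
      by (auto simp: Field_def)
    then show "x \<in> (\<Union>i\<in>Field I. Field (M i))"
      unfolding K by (auto intro: FieldI1 FieldI2)
  next
    fix x assume "x \<in> (\<Union>i\<in>Field I. Field (M i))"
    then obtain i y where "i \<in> Field I" "(x, y) \<in> M i \<or> (y, x) \<in> M i"
      by (auto simp: Field_def)
    then have "(x, y) \<in> K \<or> (y, x) \<in> K"
      unfolding K by blast
    then show "x \<in> Field K"
      by (auto simp: Field_def)
  qed
qed

lemma Linear_order_is_sum:
  assumes I: "Linear_order I" and M: "\<And>i. i \<in> Field I \<Longrightarrow> Linear_order (M i)"
    and K: "is_sum I M K"
  shows "Linear_order K"
proof -
  have uniq: "i = j" if "i \<in> Field I" "j \<in> Field I" "x \<in> Field (M i)" "x \<in> Field (M j)" for i j x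
    using K that unfolding is_sum_def disjoint_family_on_def by blast
  have inI: "i \<in> Field I" "j \<in> Field I" if "(i, j) \<in> I" for i j
    using that by (auto simp: Field_def)
  have inM: "x \<in> Field (M i)" "y \<in> Field (M i)" if "(x, y) \<in> M i" for i x y
    using that by (auto simp: Field_def)
  have memK: "(x, y) \<in> K \<longleftrightarrow> (if i = j then (x, y) \<in> M i else (i, j) \<in> I)"
    if "i \<in> Field I" "j \<in> Field I" "x \<in> Field (M i)" "y \<in> Field (M j)" for i j x y
  proof -
    have K': "(x, y) \<in> K \<longleftrightarrow> (\<exists>k\<in>Field I. (x, y) \<in> M k) \<or>
        (\<exists>k l. (k, l) \<in> I \<and> k \<noteq> l \<and> x \<in> Field (M k) \<and> y \<in> Field (M l))"
      using K unfolding is_sum_def by auto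
    have x: "k = i" if "k \<in> Field I" "x \<in> Field (M k)" for k
      by (rule uniq[OF that(1) \<open>i \<in> Field I\<close> that(2) \<open>x \<in> Field (M i)\<close>])
    have y: "k = j" if "k \<in> Field I" "y \<in> Field (M k)" for k
      by (rule uniq[OF that(1) \<open>j \<in> Field I\<close> that(2) \<open>y \<in> Field (M j)\<close>])
    have "(\<exists>k\<in>Field I. (x, y) \<in> M k) \<longleftrightarrow> i = j \<and> (x, y) \<in> M i"
      by (metis x y inM \<open>i \<in> Field I\<close>)
    moreover have "(\<exists>k l. (k, l) \<in> I \<and> k \<noteq> l \<and> x \<in> Field (M k) \<and> y \<in> Field (M l)) \<longleftrightarrow>
        (i, j) \<in> I \<and> i \<noteq> j"
      by (metis x y inI that(3,4))
    ultimately show ?thesis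
      unfolding K' by auto
  qed
  have ordI: "trans I" "antisym I" "total_on (Field I) I"
    using I by (auto simp: linear_order_on_def partial_order_on_def preorder_on_def)
  have ordM: "refl_on (Field (M i)) (M i)" "trans (M i)" "antisym (M i)" "total_on (Field (M i)) (M i)"
    if "i \<in> Field I" for i
    using M[OF that] by (auto simp: linear_order_on_def partial_order_on_def preorder_on_def)
  have idx: "\<exists>i\<in>Field I. x \<in> Field (M i)" if "x \<in> Field K" for x
    using that Field_is_sum[OF K] by blast
  have inK: "x \<in> Field K" "y \<in> Field K" if "(x, y) \<in> K" for x y
    using that by (auto simp: Field_def)
  have "refl_on (Field K) K"
  proof (rule refl_onI)
    fix x assume "x \<in> Field K"
    then obtain i where i: "i \<in> Field I" "x \<in> Field (M i)"
      using idx by blast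
    then show "(x, x) \<in> K"
      using memK[OF i(1) i(1) i(2) i(2)] refl_onD[OF ordM(1)] by auto
  qed
  moreover have "trans K"
  proof (rule transI)
    fix x y z assume xy: "(x, y) \<in> K" and yz: "(y, z) \<in> K"
    obtain i where i: "i \<in> Field I" "x \<in> Field (M i)"
      using idx inK(1)[OF xy] by blast
    obtain j where j: "j \<in> Field I" "y \<in> Field (M j)"
      using idx inK(1)[OF yz] by blast
    obtain k where k: "k \<in> Field I" "z \<in> Field (M k)"
      using idx inK(2)[OF yz] by blast
    note xy' = xy[unfolded memK[OF i(1) j(1) i(2) j(2)]]
    note yz' = yz[unfolded memK[OF j(1) k(1) j(2) k(2)]]
    have "if i = k then (x, z) \<in> M i else (i, k) \<in> I"
    proof (cases "i = j \<or> j = k")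
      case True
      then show ?thesis
        using xy' yz' transD[OF ordM(2)[OF i(1)], of x y z] by (auto split: if_splits)
    next
      case False
      then have ij: "(i, j) \<in> I" "(j, k) \<in> I"
        using xy' yz' by auto
      then have "i \<noteq> k"
        using antisymD[OF ordI(2), of i j] False by blast
      then show ?thesis
        using transD[OF ordI(1) ij] by simp
    qed
    then show "(x, z) \<in> K"
      by (simp only: memK[OF i(1) k(1) i(2) k(2)])
  qed
  moreover have "antisym K"
  proof (rule antisymI)
    fix x y assume xy: "(x, y) \<in> K" and yx: "(y, x) \<in> K"
    obtain i where i: "i \<in> Field I" "x \<in> Field (M i)"
      using idx inK(1)[OF xy] by blast
    obtain j where j: "j \<in> Field I" "y \<in> Field (M j)"
      using idx inK(1)[OF yx] by blast
    show "x = y"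
      using xy[unfolded memK[OF i(1) j(1) i(2) j(2)]] yx[unfolded memK[OF j(1) i(1) j(2) i(2)]]
        antisymD[OF ordI(2), of i j] antisymD[OF ordM(3)[OF i(1)], of x y]
      by (auto split: if_splits)
  qed
  moreover have "total_on (Field K) K"
  proof (rule total_onI)
    fix x y assume xy: "x \<in> Field K" "y \<in> Field K" "x \<noteq> y"
    obtain i where i: "i \<in> Field I" "x \<in> Field (M i)"
      using idx xy(1) by blast
    obtain j where j: "j \<in> Field I" "y \<in> Field (M j)"
      using idx xy(2) by blast
    show "(x, y) \<in> K \<or> (y, x) \<in> K"
      unfolding memK[OF i(1) j(1) i(2) j(2)] memK[OF j(1) i(1) j(2) i(2)]
      using ordI(3) ordM(4)[OF i(1)] i j xy(3) unfolding total_on_def by auto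
  qed
  moreover have "K \<subseteq> Field K \<times> Field K"
    using inK by auto
  ultimately show ?thesis
    unfolding linear_order_on_def partial_order_on_def preorder_on_def by blast
qed

lemma HR_countable_linear_order:
  assumes "HR \<alpha> K"
  shows "Linear_order K \<and> countable (Field K)"
  using assms
proof (induction rule: HR.induct)
  case (HR_finite K)
  then show ?case by (simp add: countable_finite)
next
  case (HR_zeta_sum \<alpha> M K)
  have "Field zetaLeq = UNIV"
    by (auto simp: zetaLeq_def Field_def)
  then have Z: "Linear_order zetaLeq"
    unfolding linear_order_on_def partial_order_on_def preorder_on_def
    by (simp add: zetaLeq_def refl_on_def trans_def antisym_def total_on_def linear)
  have M: "Linear_order (M i)" "countable (Field (M i))" for i
    using HR_zeta_sum.IH by blast+
  have "Linear_order K"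
    by (rule Linear_order_is_sum[OF Z M(1) HR_zeta_sum.hyps(2)])
  moreover have "countable (Field K)"
    unfolding Field_is_sum[OF HR_zeta_sum.hyps(2)]
    by (rule countable_UN[OF countableI_type M(2)])
  ultimately show ?case ..
next
  case (HR_finite_sum \<alpha> n M K)
  have Z: "Linear_order (natLeq_on n)"
    using natLeq_on_Well_order[of n] unfolding well_order_on_def by (rule conjunct1)
  have M: "Linear_order (M i)" "countable (Field (M i))" if "i \<in> Field (natLeq_on n)" for i
    using HR_finite_sum.IH that unfolding Field_natLeq_on by blast+
  have "Linear_order K"
    by (rule Linear_order_is_sum[OF Z M(1) HR_finite_sum.hyps(2)])
  moreover have "countable (Field K)"
    unfolding Field_is_sum[OF HR_finite_sum.hyps(2)]
    by (rule countable_UN[OF countableI_type M(2)])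
  ultimately show ?case ..
qed

definition has_hausdorff_rank :: "'a rel \<Rightarrow> cord \<Rightarrow> bool" where
  "has_hausdorff_rank K \<alpha> \<longleftrightarrow> HR \<alpha> K \<and> (\<forall>\<beta><\<alpha>. \<not> HR \<beta> K)"

text \<open>
  The summands of a simple order of rank \<open>\<alpha>\<close> have rank below \<open>\<alpha>\<close>, on both sides, as for the
  sums in the definition of \<open>HR \<alpha>\<close>.  This is not implied by the limit condition, which only
  concerns a tail of one of the two sequences: without the bound, \<open>\<omega> + \<omega>\<close>
  (decomposed as \<open>\<omega>, 1, 1, 1, \<dots>\<close>) would be a simple order of rank \<open>1\<close>.
  The limit is taken in the order topology on the countable ordinals.
\<close>

definition simple_order :: "'a rel \<Rightarrow> bool" where
  "simple_order L \<longleftrightarrow> (\<exists>\<alpha> M N X Y \<rho> \<sigma>.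
     has_hausdorff_rank L \<alpha> \<and>
     is_sum natLeq M X \<and> is_sum (natLeq\<inverse>) N Y \<and> is_sum2 X Y L \<and>
     (\<forall>i. has_hausdorff_rank (M i) (\<rho> i) \<and> \<rho> i < \<alpha>) \<and>
     (\<forall>j. has_hausdorff_rank (N j) (\<sigma> j) \<and> \<sigma> j < \<alpha>) \<and>
     ((\<lambda>i. \<rho> i + 1) \<longlonglongrightarrow> \<alpha> \<or> (\<lambda>j. \<sigma> j + 1) \<longlonglongrightarrow> \<alpha>))"

end

theory Submission
  imports Defs
begin

text \<open>
  Countable orders are realized as sets of reals.  A simple order \<open>U\<close> of rank \<open>\<alpha>\<close> is only used
  through the property that every point of \<open>U\<close> cuts off, on one side, an order of rank below \<open>\<alpha>\<close>,
  and such orders have \<open>\<Pi>\<close>-sentences of level \<open>2 * \<alpha> + 1\<close> by induction on \<open>\<alpha>\<close>: an order of rank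
  \<open>\<delta> < \<alpha>\<close> is cut by finitely many points into orders of the same kind at level \<open>\<delta>\<close>, so it has a
  \<open>\<Sigma>\<close>-sentence of level \<open>2 * \<delta> + 2 \<le> 2 * \<alpha>\<close>.  Let \<open>A\<close> and \<open>B\<close> be the parts of \<open>U\<close> cutting off
  small orders to the left and to the right.  The sentence says that every point \<open>z\<close> cuts off to
  the left what some \<open>a \<in> A\<close> cuts off, or to the right what some \<open>b \<in> B\<close> cuts off, and that this
  happens for all \<open>a\<close> and \<open>b\<close>.  If \<open>A\<close> has unboundedly many condensation classes, then
  the left part of a model is isomorphic to \<open>A\<close>, because the classes are respected by all
  isomorphisms between initial segments.  Otherwise \<open>A\<close> itself has smaller rank; then
  its last class is described separately, relative to a point \<open>p\<close> of that class.
\<close>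

section \<open>Definability\<close>

text \<open>The level \<open>2 * \<alpha> + 1\<close> comes from the following count. Orders of rank
  below \<alpha> have \<Sigma> descriptions of level \<open>2 * \<alpha>\<close>, and saying that
  some point cuts off such an order keeps this level. Countable conjunctions of such statements, or
  a universal quantifier in front of a disjunction of them, lead to \<Pi> of level
  \<open>2 * \<alpha> + 1\<close>; naming finitely many cut points in front of \<Pi> descriptions of
  level \<open>2 * \<delta> + 1\<close> leads to \<open>2 * \<delta> + 2\<close>.

  The obstacle is that the types of the proper initial segments do not determine an order: in the
  reverse of \<omega> and in \<zeta> every point cuts off the reverse of \<omega> to the left. Such
  ambiguity does not arise when the classes are unbounded, since counting classes then separates
  stages that every isomorphism respects. Otherwise a last class has to be fixed; the rank has
  dropped there to some \<delta> < \<alpha>, which leaves room for an existential quantifier over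
  \<open>p\<close>.

  Sets of reals make a structure the same as its universe, a subinterval an intersection, and
  reversal a negation, so only left parts are treated.\<close>

lemma less_add_one_cord: "a < a + (1 :: cord)"
  using add_one_cord[of a "a + 1"] by simp

lemma add_two_cord: "a + 2 = a + 1 + (1 :: cord)"
  by (metis add.assoc one_add_one)

lemma double_add_two_le_cord: "d < b \<Longrightarrow> 2 * d + 2 \<le> 2 * (b :: cord)"
  using times_cord_le_iff[of 2 b "2 * b"] by simp

lemma double_mono_cord: "a \<le> b \<Longrightarrow> 2 * a \<le> 2 * (b :: cord)"
  using times_cord_le_iff[of 2 a "2 * b"] times_cord_le_iff[of 2 b "2 * b"] by simp

section \<open>Renaming of variables and merging of quantifier blocks\<close>

primrec ren :: "(nat \<Rightarrow> nat) \<Rightarrow> fm \<Rightarrow> fm" where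
  "ren f Verum = Verum"
| "ren f (Eqv x y) = Eqv (f x) (f y)"
| "ren f (Rel x y) = Rel (f x) (f y)"
| "ren f (Neg \<phi>) = Neg (ren f \<phi>)"
| "ren f (And \<phi> \<psi>) = And (ren f \<phi>) (ren f \<psi>)"
| "ren f (Or \<phi> \<psi>) = Or (ren f \<phi>) (ren f \<psi>)"
| "ren f (Exi x \<phi>) = Exi (f x) (ren f \<phi>)"
| "ren f (Uni x \<phi>) = Uni (f x) (ren f \<phi>)"
| "ren f (BigOr \<Phi>) = BigOr (\<lambda>i. ren f (\<Phi> i))"
| "ren f (BigAnd \<Phi>) = BigAnd (\<lambda>i. ren f (\<Phi> i))"

lemma fun_upd_comp_inj: "inj f \<Longrightarrow> s(f x := a) \<circ> f = (s \<circ> f)(x := a)"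
  by (auto simp: fun_eq_iff inj_eq)

lemma sat_ren: "inj f \<Longrightarrow> sat A R s (ren f \<phi>) \<longleftrightarrow> sat A R (s \<circ> f) \<phi>"
  by (induction \<phi> arbitrary: s) (simp_all add: fun_upd_comp_inj)

lemma fv_ren: "inj f \<Longrightarrow> fv (ren f \<phi>) = f ` fv \<phi>"
  by (induction \<phi>) (auto simp: inj_eq)

lemma ren_Exs: "ren f (Exs xs \<phi>) = Exs (map f xs) (ren f \<phi>)"
  by (induction xs) (simp_all add: Exs_def)

lemma ren_Unis: "ren f (Unis xs \<phi>) = Unis (map f xs) (ren f \<phi>)"
  by (induction xs) (simp_all add: Unis_def)

lemma finitary_qf_ren: "finitary_qf \<phi> \<Longrightarrow> finitary_qf (ren f \<phi>)"
  by (induction rule: finitary_qf.induct) (simp_all add: finitary_qf.intros)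

lemma Sigma_ren: "Sigma_fm \<gamma> \<phi> \<Longrightarrow> Sigma_fm \<gamma> (ren f \<phi>)"
  and Pi_ren: "Pi_fm \<gamma> \<phi> \<Longrightarrow> Pi_fm \<gamma> (ren f \<phi>)"
proof (induction rule: Sigma_fm_Pi_fm.inducts)
  case (Sigma_pos \<alpha> \<Phi> xs)
  then show ?case
    by (auto simp: ren_Exs intro!: Sigma_fm_Pi_fm.Sigma_pos)
next
  case (Pi_pos \<alpha> \<Phi> xs)
  then show ?case
    by (auto simp: ren_Unis intro!: Sigma_fm_Pi_fm.Pi_pos)
qed (auto intro: Sigma_fm_Pi_fm.intros finitary_qf_ren)

lemma fv_Exs: "fv (Exs xs \<phi>) = fv \<phi> - set xs"
  by (induction xs) (auto simp: Exs_def)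

lemma fv_Unis: "fv (Unis xs \<phi>) = fv \<phi> - set xs"
  by (induction xs) (auto simp: Unis_def)

lemma Exs_append: "Exs (xs @ ys) \<phi> = Exs xs (Exs ys \<phi>)"
  by (simp add: Exs_def)

lemma Exs_Cons: "Exs (x # xs) \<phi> = Exi x (Exs xs \<phi>)"
  by (simp add: Exs_def)

lemma Exs_Nil: "Exs [] \<phi> = \<phi>"
  by (simp add: Exs_def)

lemma sat_Exs_cong:
  "(\<And>s. sat A R s \<phi> \<longleftrightarrow> sat A R s \<psi>) \<Longrightarrow> sat A R s (Exs xs \<phi>) \<longleftrightarrow> sat A R s (Exs xs \<psi>)"
  by (induction xs arbitrary: s) (simp_all add: Exs_def)

lemma sat_Unis_not:
  "(\<And>s. sat A R s \<psi> \<longleftrightarrow> \<not> sat A R s \<phi>) \<Longrightarrow> sat A R s (Unis xs \<psi>) \<longleftrightarrow> \<not> sat A R s (Exs xs \<phi>)"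
  by (induction xs arbitrary: s) (simp_all add: Exs_def Unis_def)

lemma sat_Exs_And:
  "set xs \<inter> fv \<psi> = {} \<Longrightarrow> sat A R s (Exs xs (And \<phi> \<psi>)) \<longleftrightarrow> sat A R s (Exs xs \<phi>) \<and> sat A R s \<psi>"
proof (induction xs arbitrary: s)
  case (Cons x xs)
  have "sat A R (s(x := a)) \<psi> \<longleftrightarrow> sat A R s \<psi>" for a
    by (rule sat_cong) (use Cons.prems in auto)
  then show ?case
    using Cons by (simp add: Exs_Cons)
qed (simp add: Exs_Nil)

text \<open>The prenex step. The block \<open>ys\<close> ends up inside the scope of
  \<open>xs\<close>, so it must avoid all of \<open>fv \<phi>\<close>, including the variables bound
  by \<open>xs\<close>.\<close>

lemma sat_And_Exs_Exs:
  assumes "set xs \<inter> fv (Exs ys \<psi>) = {}" "set ys \<inter> fv \<phi> = {}"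
  shows "sat A R s (Exs (xs @ ys) (And \<phi> \<psi>)) \<longleftrightarrow> sat A R s (Exs xs \<phi>) \<and> sat A R s (Exs ys \<psi>)"
proof -
  have "sat A R s (Exs (xs @ ys) (And \<phi> \<psi>)) \<longleftrightarrow> sat A R s (Exs xs (And \<phi> (Exs ys \<psi>)))"
    unfolding Exs_append
  proof (rule sat_Exs_cong)
    fix s
    have "sat A R s (Exs ys (And \<phi> \<psi>)) \<longleftrightarrow> sat A R s (Exs ys (And \<psi> \<phi>))"
      by (rule sat_Exs_cong) auto
    then show "sat A R s (Exs ys (And \<phi> \<psi>)) \<longleftrightarrow> sat A R s (And \<phi> (Exs ys \<psi>))"
      using sat_Exs_And[OF assms(2)] by auto
  qed
  then show ?thesis
    using sat_Exs_And[OF assms(1)] by simp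
qed

text \<open>Free variables stay fixed and every other variable is shifted past a bound
  \<open>N\<close> for both the free variables and \<open>W\<close>, so the bound variables avoid
  the prescribed finite set. This prepares quantifier blocks for merging.\<close>

lemma rename_bound:
  assumes "finite (fv (Exs xs \<phi>))" "finite W"
  shows "\<exists>f. inj f \<and> set (map f xs) \<inter> W = {} \<and> f ` fv (Exs xs \<phi>) = fv (Exs xs \<phi>) \<and>
    (\<forall>A R (s :: nat \<Rightarrow> 'a). sat A R s (Exs (map f xs) (ren f \<phi>)) \<longleftrightarrow> sat A R s (Exs xs \<phi>))"
proof -
  define V where "V = fv (Exs xs \<phi>)"
  obtain N where N: "\<And>x. x \<in> V \<union> W \<Longrightarrow> x < N"
    using assms finite_nat_set_iff_bounded[of "V \<union> W"] unfolding V_def by auto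
  define f where "f x = (if x \<in> V then x else x + N)" for x
  have inj: "inj f"
  proof (rule injI)
    fix x y assume "f x = f y"
    then show "x = y"
      using N[of x] N[of y] by (auto simp: f_def split: if_splits)
  qed
  have "set (map f xs) \<inter> W = {}"
    using N by (fastforce simp: f_def V_def fv_Exs)
  moreover have "f ` V = V"
    by (auto simp: f_def)
  moreover have "sat A R s (Exs (map f xs) (ren f \<phi>)) \<longleftrightarrow> sat A R s (Exs xs \<phi>)" for A R and s :: "nat \<Rightarrow> 'a"
    unfolding ren_Exs[symmetric] sat_ren[OF inj]
    by (rule sat_cong) (simp add: f_def V_def)
  ultimately show ?thesis
    using inj unfolding V_def by blast
qed

section \<open>Closure properties of the formula hierarchy\<close>

lemma Sigma_cases_pos:
  assumes "Sigma_fm \<gamma> \<phi>" "0 < \<gamma>"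
  obtains \<Phi> xs where "\<phi> = BigOr (\<lambda>i. Exs (xs i) (\<Phi> i))" "\<And>i. \<exists>\<beta><\<gamma>. Pi_fm \<beta> (\<Phi> i)"
  using assms by (cases rule: Sigma_fm.cases) auto

lemma Pi_cases_pos:
  assumes "Pi_fm \<gamma> \<phi>" "0 < \<gamma>"
  obtains \<Phi> xs where "\<phi> = BigAnd (\<lambda>i. Unis (xs i) (\<Phi> i))" "\<And>i. \<exists>\<beta><\<gamma>. Sigma_fm \<beta> (\<Phi> i)"
  using assms by (cases rule: Pi_fm.cases) auto

lemma Sigma_zeroD: "Sigma_fm 0 \<phi> \<Longrightarrow> finitary_qf \<phi>"
  by (cases rule: Sigma_fm.cases) auto

lemma Pi_zeroD: "Pi_fm 0 \<phi> \<Longrightarrow> finitary_qf \<phi>"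
  by (cases rule: Pi_fm.cases) auto

text \<open>The hierarchy consists of syntactic shapes, and \<open>Neg\<close> of a formula at
  positive level has the wrong one. Negation is therefore pushed through connectives and quantifier
  blocks down to level \<open>0\<close>, where \<open>Neg\<close> is allowed.\<close>

lemma Sigma_negation:
  "Sigma_fm \<gamma> \<phi> \<Longrightarrow> \<exists>\<psi>. Pi_fm \<gamma> \<psi> \<and> fv \<psi> = fv \<phi> \<and> (\<forall>A R (s :: nat \<Rightarrow> 'a). sat A R s \<psi> \<longleftrightarrow> \<not> sat A R s \<phi>)"
  and Pi_negation:
  "Pi_fm \<gamma> \<phi> \<Longrightarrow> \<exists>\<psi>. Sigma_fm \<gamma> \<psi> \<and> fv \<psi> = fv \<phi> \<and> (\<forall>A R (s :: nat \<Rightarrow> 'a). sat A R s \<psi> \<longleftrightarrow> \<not> sat A R s \<phi>)"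
proof (induction rule: Sigma_fm_Pi_fm.inducts)
  case (Sigma_zero \<phi>)
  then show ?case
    by (intro exI[of _ "Neg \<phi>"]) (auto intro: Sigma_fm_Pi_fm.intros finitary_qf.intros)
next
  case (Pi_zero \<phi>)
  then show ?case
    by (intro exI[of _ "Neg \<phi>"]) (auto intro: Sigma_fm_Pi_fm.intros finitary_qf.intros)
next
  case (Sigma_pos \<alpha> \<Phi> xs)
  then have "\<exists>\<Psi>. (\<exists>\<beta><\<alpha>. Sigma_fm \<beta> \<Psi>) \<and> fv \<Psi> = fv (\<Phi> i) \<and>
      (\<forall>A R (s :: nat \<Rightarrow> 'a). sat A R s \<Psi> \<longleftrightarrow> \<not> sat A R s (\<Phi> i))" for i
    by blast
  then obtain \<Psi> where \<Psi>: "\<And>i. \<exists>\<beta><\<alpha>. Sigma_fm \<beta> (\<Psi> i)" "\<And>i. fv (\<Psi> i) = fv (\<Phi> i)"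
      "\<And>i A R (s :: nat \<Rightarrow> 'a). sat A R s (\<Psi> i) \<longleftrightarrow> \<not> sat A R s (\<Phi> i)"
    by metis
  have "sat A R s (Unis (xs i) (\<Psi> i)) \<longleftrightarrow> \<not> sat A R s (Exs (xs i) (\<Phi> i))" for A R i and s :: "nat \<Rightarrow> 'a"
    by (rule sat_Unis_not) (rule \<Psi>)
  then show ?case
    using \<Psi>(1,2) Sigma_pos(1)
    by (intro exI[of _ "BigAnd (\<lambda>i. Unis (xs i) (\<Psi> i))"])
      (auto intro!: Sigma_fm_Pi_fm.Pi_pos simp: fv_Exs fv_Unis)
next
  case (Pi_pos \<alpha> \<Phi> xs)
  then have "\<exists>\<Psi>. (\<exists>\<beta><\<alpha>. Pi_fm \<beta> \<Psi>) \<and> fv \<Psi> = fv (\<Phi> i) \<and>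
      (\<forall>A R (s :: nat \<Rightarrow> 'a). sat A R s \<Psi> \<longleftrightarrow> \<not> sat A R s (\<Phi> i))" for i
    by blast
  then obtain \<Psi> where \<Psi>: "\<And>i. \<exists>\<beta><\<alpha>. Pi_fm \<beta> (\<Psi> i)" "\<And>i. fv (\<Psi> i) = fv (\<Phi> i)"
      "\<And>i A R (s :: nat \<Rightarrow> 'a). sat A R s (\<Psi> i) \<longleftrightarrow> \<not> sat A R s (\<Phi> i)"
    by metis
  have "sat A R s (Unis (xs i) (\<Phi> i)) \<longleftrightarrow> \<not> sat A R s (Exs (xs i) (\<Psi> i))" for A R i and s :: "nat \<Rightarrow> 'a"
    by (rule sat_Unis_not) (simp add: \<Psi>)
  then show ?case
    using \<Psi>(1,2) Pi_pos(1)
    by (intro exI[of _ "BigOr (\<lambda>i. Exs (xs i) (\<Psi> i))"])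
      (auto intro!: Sigma_fm_Pi_fm.Sigma_pos simp: fv_Exs fv_Unis)
qed

text \<open>At positive level \<open>And\<close> does not have the required shape, so the two
  countable conjunctions are interleaved on even and odd indices.\<close>

lemma Pi_conj:
  assumes "Pi_fm \<gamma> \<phi>" "Pi_fm \<gamma> \<psi>"
  shows "\<exists>\<chi>. Pi_fm \<gamma> \<chi> \<and> fv \<chi> = fv \<phi> \<union> fv \<psi> \<and>
    (\<forall>A R (s :: nat \<Rightarrow> 'a). sat A R s \<chi> \<longleftrightarrow> sat A R s \<phi> \<and> sat A R s \<psi>)"
proof (cases "\<gamma> = 0")
  case True
  then show ?thesis
    using assms
    by (intro exI[of _ "And \<phi> \<psi>"]) (auto intro!: Pi_zero finitary_qf.intros dest: Pi_zeroD)
next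
  case False
  then have pos: "0 < \<gamma>"
    using zero_le_cord[of \<gamma>] by (simp add: less_le)
  obtain \<Phi> xs where \<Phi>: "\<phi> = BigAnd (\<lambda>i. Unis (xs i) (\<Phi> i))" "\<And>i. \<exists>\<beta><\<gamma>. Sigma_fm \<beta> (\<Phi> i)"
    using Pi_cases_pos[OF assms(1) pos] by blast
  obtain \<Psi> ys where \<Psi>: "\<psi> = BigAnd (\<lambda>i. Unis (ys i) (\<Psi> i))" "\<And>i. \<exists>\<beta><\<gamma>. Sigma_fm \<beta> (\<Psi> i)"
    using Pi_cases_pos[OF assms(2) pos] by blast
  define zs where "zs i = (if even i then xs (i div 2) else ys (i div 2))" for i :: nat
  define \<Theta> where "\<Theta> i = (if even i then \<Phi> (i div 2) else \<Psi> (i div 2))" for i :: nat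
  have all: "(\<forall>i. P (zs i) (\<Theta> i)) \<longleftrightarrow> (\<forall>i. P (xs i) (\<Phi> i)) \<and> (\<forall>i. P (ys i) (\<Psi> i))" for P
  proof (intro iffI conjI allI)
    fix i assume *: "\<forall>i. P (zs i) (\<Theta> i)"
    show "P (xs i) (\<Phi> i)"
      using *[rule_format, of "2 * i"] by (simp add: zs_def \<Theta>_def)
    show "P (ys i) (\<Psi> i)"
      using *[rule_format, of "Suc (2 * i)"] by (simp add: zs_def \<Theta>_def)
  qed (simp add: zs_def \<Theta>_def)
  have "Pi_fm \<gamma> (BigAnd (\<lambda>i. Unis (zs i) (\<Theta> i)))"
    using \<Phi>(2) \<Psi>(2) by (intro Pi_pos[OF pos]) (simp add: \<Theta>_def)
  moreover have "fv (BigAnd (\<lambda>i. Unis (zs i) (\<Theta> i))) = fv \<phi> \<union> fv \<psi>"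
    using all[of "\<lambda>x \<theta>. v \<notin> fv (Unis x \<theta>)" for v] unfolding \<Phi>(1) \<Psi>(1) by (auto; blast)
  ultimately show ?thesis
    using all[of "\<lambda>x \<theta>. sat A R s (Unis x \<theta>)" for A R and s :: "nat \<Rightarrow> 'a"]
    unfolding \<Phi>(1) \<Psi>(1) by (intro exI[of _ "BigAnd (\<lambda>i. Unis (zs i) (\<Theta> i))"]) auto
qed

lemma Pi_imp_Sigma:
  assumes "Pi_fm \<beta> \<phi>" "\<beta> < \<gamma>"
  shows "Sigma_fm \<gamma> (BigOr (\<lambda>i. Exs [] \<phi>))"
  using assms order.strict_trans1[OF zero_le_cord assms(2)] by (intro Sigma_pos) auto

text \<open>A formula of positive level already has the right shape for every higher level. A
  formula of level \<open>0\<close> has not; being also \<open>Pi_fm 0\<close>, it is wrapped in a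
  constant disjunction with empty quantifier blocks.\<close>

lemma Sigma_mono:
  assumes "Sigma_fm \<beta> \<phi>" "\<beta> \<le> \<gamma>"
  shows "\<exists>\<psi>. Sigma_fm \<gamma> \<psi> \<and> fv \<psi> = fv \<phi> \<and> (\<forall>A R (s :: nat \<Rightarrow> 'a). sat A R s \<psi> \<longleftrightarrow> sat A R s \<phi>)"
proof -
  consider "\<beta> = \<gamma>" | "\<beta> = 0" "\<beta> < \<gamma>" | "0 < \<beta>" "\<beta> < \<gamma>"
    using assms(2) zero_le_cord[of \<beta>] by (metis le_less)
  then show ?thesis
  proof cases
    case 1
    then show ?thesis
      using assms by blast
  next
    case 2
    then have "Pi_fm \<beta> \<phi>"
      using assms(1) by (auto intro: Pi_zero dest: Sigma_zeroD)
    then show ?thesis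
      using Pi_imp_Sigma[OF _ 2(2)] by (intro exI[of _ "BigOr (\<lambda>i. Exs [] \<phi>)"]) (simp add: Exs_Nil)
  next
    case 3
    then have "Sigma_fm \<gamma> \<phi>"
      using Sigma_cases_pos[OF assms(1) 3(1)] Sigma_pos by (metis order.strict_trans)
    then show ?thesis
      by blast
  qed
qed

section \<open>Definable predicates on sets of reals\<close>

definition LE :: "real rel" where
  "LE = {(x, y). x \<le> y}"

text \<open>Working with predicates instead of formulas hides the syntactic normal forms. The
  defining formula is uniform in the universe \<open>X\<close>, and assignments are arbitrary,
  possibly with values outside \<open>X\<close>.\<close>

definition Sg :: "cord \<Rightarrow> nat set \<Rightarrow> (real set \<Rightarrow> (nat \<Rightarrow> real) \<Rightarrow> bool) \<Rightarrow> bool" where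
  "Sg \<gamma> V P \<longleftrightarrow> (\<exists>\<phi>. Sigma_fm \<gamma> \<phi> \<and> fv \<phi> \<subseteq> V \<and> (\<forall>X s. sat X LE s \<phi> \<longleftrightarrow> P X s))"

definition Pg :: "cord \<Rightarrow> nat set \<Rightarrow> (real set \<Rightarrow> (nat \<Rightarrow> real) \<Rightarrow> bool) \<Rightarrow> bool" where
  "Pg \<gamma> V P \<longleftrightarrow> (\<exists>\<phi>. Pi_fm \<gamma> \<phi> \<and> fv \<phi> \<subseteq> V \<and> (\<forall>X s. sat X LE s \<phi> \<longleftrightarrow> P X s))"

lemma Sg_neg: "Sg \<gamma> V (\<lambda>X s. \<not> P X s) \<longleftrightarrow> Pg \<gamma> V P"
proof
  assume "Sg \<gamma> V (\<lambda>X s. \<not> P X s)"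
  then obtain \<phi> where "Sigma_fm \<gamma> \<phi>" "fv \<phi> \<subseteq> V" "\<forall>X s. sat X LE s \<phi> \<longleftrightarrow> \<not> P X s"
    unfolding Sg_def by blast
  then show "Pg \<gamma> V P"
    using Sigma_negation[of \<gamma> \<phi>, where 'a = real] unfolding Pg_def by metis
next
  assume "Pg \<gamma> V P"
  then obtain \<phi> where "Pi_fm \<gamma> \<phi>" "fv \<phi> \<subseteq> V" "\<forall>X s. sat X LE s \<phi> \<longleftrightarrow> P X s"
    unfolding Pg_def by blast
  then show "Sg \<gamma> V (\<lambda>X s. \<not> P X s)"
    using Pi_negation[of \<gamma> \<phi>, where 'a = real] unfolding Sg_def by metis
qed

lemma Sg_mono: "Sg \<beta> V P \<Longrightarrow> \<beta> \<le> \<gamma> \<Longrightarrow> V \<subseteq> W \<Longrightarrow> Sg \<gamma> W P"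
  unfolding Sg_def using Sigma_mono[of \<beta> _ \<gamma>, where 'a = real] by (metis order.trans)

lemma Pg_imp_Sg:
  assumes "Pg \<beta> V P" "\<beta> < \<gamma>"
  shows "Sg \<gamma> V P"
proof -
  obtain \<phi> where "Pi_fm \<beta> \<phi>" "fv \<phi> \<subseteq> V" "\<forall>X s. sat X LE s \<phi> \<longleftrightarrow> P X s"
    using assms(1) unfolding Pg_def by blast
  then show ?thesis
    using Pi_imp_Sigma[OF _ assms(2)] unfolding Sg_def
    by (intro exI[of _ "BigOr (\<lambda>i. Exs [] \<phi>)"]) (auto simp: Exs_Nil)
qed

lemma Sg_qf:
  assumes "finitary_qf \<phi>"
  shows "Sg \<gamma> (fv \<phi>) (\<lambda>X s. sat X LE s \<phi>)"
proof -
  have "Sg 0 (fv \<phi>) (\<lambda>X s. sat X LE s \<phi>)"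
    using assms unfolding Sg_def by (intro exI[of _ \<phi>]) (simp add: Sigma_zero)
  then show ?thesis
    by (rule Sg_mono) auto
qed

lemma Sg_const: "Sg \<gamma> V (\<lambda>X s. b)"
proof (cases b)
  case True
  have "Sg \<gamma> {} (\<lambda>X s. True)"
    using Sg_qf[of Verum \<gamma>] by (simp add: finitary_qf.intros)
  then show ?thesis
    using True Sg_mono by fastforce
next
  case False
  have "Sg \<gamma> {} (\<lambda>X s. False)"
    using Sg_qf[of "Neg Verum" \<gamma>] by (simp add: finitary_qf.intros)
  then show ?thesis
    using False Sg_mono by fastforce
qed

text \<open>Two nested countable disjunctions become one through a pairing of the indices. The empty
  disjunction is the constant \<open>False\<close>, available at every level; hence positivity is
  asked for nonempty \<open>I\<close> only, which later covers an empty left or right part at level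
  \<open>0\<close>.\<close>

lemma Sg_countable_disj:
  assumes "countable I" "\<And>i. i \<in> I \<Longrightarrow> Sg \<gamma> V (P i)" "I \<noteq> {} \<Longrightarrow> 0 < \<gamma>"
  shows "Sg \<gamma> V (\<lambda>X s. \<exists>i\<in>I. P i X s)"
proof (cases "I = {}")
  case True
  then show ?thesis
    using Sg_const[of \<gamma> V False] by simp
next
  case False
  then have pos: "0 < \<gamma>"
    using assms(3) by blast
  define e where "e = from_nat_into I"
  have e: "range e = I"
    unfolding e_def using False assms(1) by (rule range_from_nat_into)
  have "\<exists>\<Phi> xs. (\<forall>j :: nat. \<exists>\<beta><\<gamma>. Pi_fm \<beta> (\<Phi> j)) \<and> (\<forall>j. fv (Exs (xs j) (\<Phi> j)) \<subseteq> V) \<and>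
      (\<forall>X s. (\<exists>j. sat X LE s (Exs (xs j) (\<Phi> j))) \<longleftrightarrow> P (e n) X s)" for n
  proof -
    have "e n \<in> I"
      using e by blast
    then obtain \<phi> where \<phi>: "Sigma_fm \<gamma> \<phi>" "fv \<phi> \<subseteq> V" "\<forall>X s. sat X LE s \<phi> \<longleftrightarrow> P (e n) X s"
      using assms(2) unfolding Sg_def by blast
    obtain \<Phi> xs where \<Phi>: "\<phi> = BigOr (\<lambda>i. Exs (xs i) (\<Phi> i))" "\<And>i. \<exists>\<beta><\<gamma>. Pi_fm \<beta> (\<Phi> i)"
      using Sigma_cases_pos[OF \<phi>(1) pos] by blast
    show ?thesis
      using \<phi>(2,3) \<Phi>(2) unfolding \<Phi>(1) by (intro exI[of _ \<Phi>] exI[of _ xs]) auto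
  qed
  then obtain \<Phi> :: "nat \<Rightarrow> nat \<Rightarrow> fm" and xs where \<Phi>: "\<And>n j. \<exists>\<beta><\<gamma>. Pi_fm \<beta> (\<Phi> n j)" "\<And>n j. fv (Exs (xs n j) (\<Phi> n j)) \<subseteq> V"
      "\<And>n X s. (\<exists>j. sat X LE s (Exs (xs n j) (\<Phi> n j))) \<longleftrightarrow> P (e n) X s"
    by metis
  define \<chi> where "\<chi> = BigOr (\<lambda>k. Exs (xs (fst (prod_decode k)) (snd (prod_decode k)))
    (\<Phi> (fst (prod_decode k)) (snd (prod_decode k))))"
  have "Sigma_fm \<gamma> \<chi>"
    unfolding \<chi>_def using \<Phi>(1) by (intro Sigma_pos[OF pos]) blast
  moreover have "fv \<chi> \<subseteq> V"
    unfolding \<chi>_def using \<Phi>(2) by auto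
  moreover have "sat X LE s \<chi> \<longleftrightarrow> (\<exists>i\<in>I. P i X s)" for X s
  proof -
    have "sat X LE s \<chi> \<longleftrightarrow> (\<exists>n j. sat X LE s (Exs (xs n j) (\<Phi> n j)))"
      unfolding \<chi>_def by simp (metis prod_encode_inverse fst_conv snd_conv)
    also have "\<dots> \<longleftrightarrow> (\<exists>n. P (e n) X s)"
      using \<Phi>(3) by simp
    also have "\<dots> \<longleftrightarrow> (\<exists>i\<in>I. P i X s)"
      unfolding e[symmetric] by simp
    finally show ?thesis .
  qed
  ultimately show ?thesis
    unfolding Sg_def by blast
qed

lemma Sg_ex:
  assumes "Sg \<gamma> V P" "0 < \<gamma>"
  shows "Sg \<gamma> (V - {x}) (\<lambda>X s. \<exists>a\<in>X. P X (s(x := a)))"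
proof -
  obtain \<phi> where \<phi>: "Sigma_fm \<gamma> \<phi>" "fv \<phi> \<subseteq> V" "\<forall>X s. sat X LE s \<phi> \<longleftrightarrow> P X s"
    using assms(1) unfolding Sg_def by blast
  obtain \<Phi> xs where \<Phi>: "\<phi> = BigOr (\<lambda>i. Exs (xs i) (\<Phi> i))" "\<And>i. \<exists>\<beta><\<gamma>. Pi_fm \<beta> (\<Phi> i)"
    using Sigma_cases_pos[OF \<phi>(1) assms(2)] by blast
  have "Sigma_fm \<gamma> (BigOr (\<lambda>i. Exs (x # xs i) (\<Phi> i)))"
    using \<Phi>(2) by (intro Sigma_pos[OF assms(2)]) blast
  moreover have "fv (BigOr (\<lambda>i. Exs (x # xs i) (\<Phi> i))) \<subseteq> V - {x}"
    using \<phi>(2) unfolding \<Phi>(1) by (auto simp: Exs_Cons)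
  moreover have "sat X LE s (BigOr (\<lambda>i. Exs (x # xs i) (\<Phi> i))) \<longleftrightarrow> (\<exists>a\<in>X. P X (s(x := a)))" for X s
  proof -
    have "P X t \<longleftrightarrow> (\<exists>i. sat X LE t (Exs (xs i) (\<Phi> i)))" for t
      using \<phi>(3) unfolding \<Phi>(1) by simp
    then show ?thesis
      by (auto simp: Exs_Cons)
  qed
  ultimately show ?thesis
    unfolding Sg_def by blast
qed

lemma Pi_mono:
  assumes "Pi_fm \<beta> \<phi>" "\<beta> \<le> \<gamma>"
  shows "\<exists>\<psi>. Pi_fm \<gamma> \<psi> \<and> fv \<psi> = fv \<phi> \<and> (\<forall>A R (s :: nat \<Rightarrow> 'a). sat A R s \<psi> \<longleftrightarrow> sat A R s \<phi>)"
proof -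
  obtain \<psi> where \<psi>: "Sigma_fm \<beta> \<psi>" "fv \<psi> = fv \<phi>" "\<forall>A R (s :: nat \<Rightarrow> 'a). sat A R s \<psi> \<longleftrightarrow> \<not> sat A R s \<phi>"
    using Pi_negation[OF assms(1)] by blast
  obtain \<chi> where \<chi>: "Sigma_fm \<gamma> \<chi>" "fv \<chi> = fv \<phi>" "\<forall>A R (s :: nat \<Rightarrow> 'a). sat A R s \<chi> \<longleftrightarrow> \<not> sat A R s \<phi>"
    using Sigma_mono[OF \<psi>(1) assms(2), where 'a = 'a] \<psi>(2,3) by auto
  show ?thesis
    using Sigma_negation[OF \<chi>(1), where 'a = 'a] \<chi>(2,3) by auto
qed

text \<open>Conjunction distributes over the two disjunctions, and each pair of quantifier blocks is
  merged after renaming. Fresh bound variables exist because \<open>V\<close> is finite. The two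
  matrices are lifted to the larger of their levels, which is still below \<gamma>, and conjoined
  there.\<close>

lemma Sg_conj:
  assumes "Sg \<gamma> V P" "Sg \<gamma> V Q" "finite V"
  shows "Sg \<gamma> V (\<lambda>X s. P X s \<and> Q X s)"
proof -
  obtain \<phi> where \<phi>: "Sigma_fm \<gamma> \<phi>" "fv \<phi> \<subseteq> V" "\<forall>X s. sat X LE s \<phi> \<longleftrightarrow> P X s"
    using assms(1) unfolding Sg_def by blast
  obtain \<psi> where \<psi>: "Sigma_fm \<gamma> \<psi>" "fv \<psi> \<subseteq> V" "\<forall>X s. sat X LE s \<psi> \<longleftrightarrow> Q X s"
    using assms(2) unfolding Sg_def by blast
  show ?thesis
  proof (cases "\<gamma> = 0")
    case True
    then show ?thesis
      using \<phi> \<psi> unfolding Sg_def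
      by (intro exI[of _ "And \<phi> \<psi>"]) (auto intro!: Sigma_zero finitary_qf.intros dest: Sigma_zeroD)
  next
    case False
    then have pos: "0 < \<gamma>"
      using zero_le_cord[of \<gamma>] by (simp add: less_le)
    obtain \<Phi> xs where \<Phi>: "\<phi> = BigOr (\<lambda>i. Exs (xs i) (\<Phi> i))" "\<And>i. \<exists>\<beta><\<gamma>. Pi_fm \<beta> (\<Phi> i)"
      using Sigma_cases_pos[OF \<phi>(1) pos] by blast
    obtain \<Psi> ys where \<Psi>: "\<psi> = BigOr (\<lambda>i. Exs (ys i) (\<Psi> i))" "\<And>i. \<exists>\<beta><\<gamma>. Pi_fm \<beta> (\<Psi> i)"
      using Sigma_cases_pos[OF \<psi>(1) pos] by blast
    have fvs: "fv (Exs (xs i) (\<Phi> i)) \<subseteq> V" "fv (Exs (ys i) (\<Psi> i)) \<subseteq> V" for i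
      using \<phi>(2) \<psi>(2) unfolding \<Phi>(1) \<Psi>(1) by (simp_all add: UN_subset_iff)
    then have fin: "finite (fv (Exs (xs i) (\<Phi> i)))" "finite (fv (Exs (ys i) (\<Psi> i)))" for i
      using finite_subset[OF _ assms(3)] by blast+
    have "Sg \<gamma> V (\<lambda>X s. sat X LE s (Exs (xs i) (\<Phi> i)) \<and> sat X LE s (Exs (ys j) (\<Psi> j)))" for i j
    proof -
      obtain f where f: "inj f" "set (map f (xs i)) \<inter> V = {}" "f ` fv (Exs (xs i) (\<Phi> i)) = fv (Exs (xs i) (\<Phi> i))"
          "\<forall>A R (s :: nat \<Rightarrow> real). sat A R s (Exs (map f (xs i)) (ren f (\<Phi> i))) \<longleftrightarrow> sat A R s (Exs (xs i) (\<Phi> i))"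
        using rename_bound[OF fin(1)[of i] assms(3), where 'a = real] by blast
      have finW: "finite (V \<union> set (map f (xs i)))"
        using assms(3) by simp
      \<comment> \<open>The second block has to avoid the renamed first block as well, since it is
        placed inside its scope.\<close>
      obtain g where g: "inj g" "set (map g (ys j)) \<inter> (V \<union> set (map f (xs i))) = {}"
          "g ` fv (Exs (ys j) (\<Psi> j)) = fv (Exs (ys j) (\<Psi> j))"
          "\<forall>A R (s :: nat \<Rightarrow> real). sat A R s (Exs (map g (ys j)) (ren g (\<Psi> j))) \<longleftrightarrow> sat A R s (Exs (ys j) (\<Psi> j))"
        using rename_bound[OF fin(2)[of j] finW, where 'a = real] by blast
      have fvf: "fv (Exs (map f (xs i)) (ren f (\<Phi> i))) \<subseteq> V"
        using fvs(1)[of i] f(3) unfolding ren_Exs[symmetric] fv_ren[OF f(1)] by simp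
      have fvg: "fv (Exs (map g (ys j)) (ren g (\<Psi> j))) \<subseteq> V"
        using fvs(2)[of j] g(3) unfolding ren_Exs[symmetric] fv_ren[OF g(1)] by simp
      obtain \<beta>1 \<beta>2 where b: "\<beta>1 < \<gamma>" "Pi_fm \<beta>1 (\<Phi> i)" "\<beta>2 < \<gamma>" "Pi_fm \<beta>2 (\<Psi> j)"
        using \<Phi>(2) \<Psi>(2) by meson
      obtain \<phi>1 where 1: "Pi_fm (max \<beta>1 \<beta>2) \<phi>1" "fv \<phi>1 = fv (ren f (\<Phi> i))"
          "\<forall>A R (s :: nat \<Rightarrow> real). sat A R s \<phi>1 \<longleftrightarrow> sat A R s (ren f (\<Phi> i))"
        using Pi_mono[OF Pi_ren[OF b(2)], of "max \<beta>1 \<beta>2"] by (metis max.cobounded1)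
      obtain \<psi>1 where 2: "Pi_fm (max \<beta>1 \<beta>2) \<psi>1" "fv \<psi>1 = fv (ren g (\<Psi> j))"
          "\<forall>A R (s :: nat \<Rightarrow> real). sat A R s \<psi>1 \<longleftrightarrow> sat A R s (ren g (\<Psi> j))"
        using Pi_mono[OF Pi_ren[OF b(4)], of "max \<beta>1 \<beta>2"] by (metis max.cobounded2)
      obtain \<chi> where \<chi>: "Pi_fm (max \<beta>1 \<beta>2) \<chi>" "fv \<chi> = fv \<phi>1 \<union> fv \<psi>1"
          "\<forall>A R (s :: nat \<Rightarrow> real). sat A R s \<chi> \<longleftrightarrow> sat A R s \<phi>1 \<and> sat A R s \<psi>1"
        using Pi_conj[OF 1(1) 2(1)] by blast
      define \<theta> where "\<theta> = Exs (map f (xs i) @ map g (ys j)) \<chi>"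
      have "sat X LE s \<theta> \<longleftrightarrow> sat X LE s (Exs (xs i) (\<Phi> i)) \<and> sat X LE s (Exs (ys j) (\<Psi> j))" for X s
      proof -
        have "sat X LE s \<theta> \<longleftrightarrow> sat X LE s (Exs (map f (xs i) @ map g (ys j)) (And (ren f (\<Phi> i)) (ren g (\<Psi> j))))"
          unfolding \<theta>_def by (rule sat_Exs_cong) (simp add: \<chi> 1 2)
        also have "\<dots> \<longleftrightarrow> sat X LE s (Exs (map f (xs i)) (ren f (\<Phi> i))) \<and> sat X LE s (Exs (map g (ys j)) (ren g (\<Psi> j)))"
          by (rule sat_And_Exs_Exs) (use f(2) g(2) fvf fvg in \<open>auto simp: fv_Exs\<close>)
        finally show ?thesis
          using f(4) g(4) by simp
      qed
      moreover have "Sigma_fm \<gamma> (BigOr (\<lambda>_ :: nat. \<theta>))"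
        unfolding \<theta>_def using \<chi>(1) b(1,3) by (intro Sigma_pos[OF pos]) (metis max_less_iff_conj)
      moreover have "fv \<theta> \<subseteq> V"
        unfolding \<theta>_def fv_Exs \<chi> 1 2 using fvf fvg by (auto simp: fv_Exs)
      ultimately show ?thesis
        unfolding Sg_def by (intro exI[of _ "BigOr (\<lambda>_ :: nat. \<theta>)"]) auto
    qed
    then have "Sg \<gamma> V (\<lambda>X s. \<exists>p\<in>UNIV. sat X LE s (Exs (xs (fst p)) (\<Phi> (fst p))) \<and> sat X LE s (Exs (ys (snd p)) (\<Psi> (snd p))))"
      using pos by (intro Sg_countable_disj) auto
    moreover have "(\<lambda>X s. \<exists>p\<in>UNIV. sat X LE s (Exs (xs (fst p)) (\<Phi> (fst p))) \<and> sat X LE s (Exs (ys (snd p)) (\<Psi> (snd p))))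
        = (\<lambda>X s. P X s \<and> Q X s)"
      using \<phi>(3) \<psi>(3) unfolding \<Phi>(1) \<Psi>(1) by (auto simp: fun_eq_iff)
    ultimately show ?thesis
      by simp
  qed
qed

section \<open>Order reversal as negation of reals\<close>

primrec swap :: "fm \<Rightarrow> fm" where
  "swap Verum = Verum"
| "swap (Eqv x y) = Eqv x y"
| "swap (Rel x y) = Rel y x"
| "swap (Neg \<phi>) = Neg (swap \<phi>)"
| "swap (And \<phi> \<psi>) = And (swap \<phi>) (swap \<psi>)"
| "swap (Or \<phi> \<psi>) = Or (swap \<phi>) (swap \<psi>)"
| "swap (Exi x \<phi>) = Exi x (swap \<phi>)"
| "swap (Uni x \<phi>) = Uni x (swap \<phi>)"
| "swap (BigOr \<Phi>) = BigOr (\<lambda>i. swap (\<Phi> i))"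
| "swap (BigAnd \<Phi>) = BigAnd (\<lambda>i. swap (\<Phi> i))"

lemma fv_swap: "fv (swap \<phi>) = fv \<phi>"
  by (induction \<phi>) auto

lemma uminus_comp_fun_upd: "uminus \<circ> s(x := a) = (uminus \<circ> s)(x := - a)" for s :: "nat \<Rightarrow> real"
  by auto

text \<open>Reversing every \<open>Rel\<close> amounts to evaluating in the mirrored structure. This
  is how results on left parts are transferred to right parts.\<close>

lemma sat_swap: "sat X LE s (swap \<phi>) \<longleftrightarrow> sat (uminus ` X) LE (uminus \<circ> s) \<phi>"
  by (induction \<phi> arbitrary: s) (simp_all add: LE_def uminus_comp_fun_upd)

lemma swap_Exs: "swap (Exs xs \<phi>) = Exs xs (swap \<phi>)"
  by (induction xs) (simp_all add: Exs_def)

lemma swap_Unis: "swap (Unis xs \<phi>) = Unis xs (swap \<phi>)"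
  by (induction xs) (simp_all add: Unis_def)

lemma finitary_qf_swap: "finitary_qf \<phi> \<Longrightarrow> finitary_qf (swap \<phi>)"
  by (induction rule: finitary_qf.induct) (simp_all add: finitary_qf.intros)

lemma Sigma_swap: "Sigma_fm \<gamma> \<phi> \<Longrightarrow> Sigma_fm \<gamma> (swap \<phi>)"
  and Pi_swap: "Pi_fm \<gamma> \<phi> \<Longrightarrow> Pi_fm \<gamma> (swap \<phi>)"
proof (induction rule: Sigma_fm_Pi_fm.inducts)
  case (Sigma_pos \<alpha> \<Phi> xs)
  then show ?case
    by (auto simp: swap_Exs intro!: Sigma_fm_Pi_fm.Sigma_pos)
next
  case (Pi_pos \<alpha> \<Phi> xs)
  then show ?case
    by (auto simp: swap_Unis intro!: Sigma_fm_Pi_fm.Pi_pos)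
qed (auto intro: Sigma_fm_Pi_fm.intros finitary_qf_swap)

lemma Sg_swap: "Sg \<gamma> V P \<Longrightarrow> Sg \<gamma> V (\<lambda>X s. P (uminus ` X) (uminus \<circ> s))"
  unfolding Sg_def using Sigma_swap fv_swap sat_swap by metis

section \<open>Definability over intervals with named endpoints\<close>

definition ivl :: "real set \<Rightarrow> real option \<Rightarrow> real option \<Rightarrow> real set" where
  "ivl X l h = {z \<in> X. (\<forall>a. l = Some a \<longrightarrow> a < z) \<and> (\<forall>b. h = Some b \<longrightarrow> z < b)}"

lemma ivl_cut:
  assumes "a \<in> ivl X l h"
  shows "ivl X l (Some a) = ivl X l h \<inter> {..<a}" "ivl X (Some a) h = ivl X l h \<inter> {a<..}"
  using assms by (cases l; cases h; auto simp: ivl_def)+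

text \<open>
  Endpoints of intervals are named by variables, a missing endpoint by \<open>None\<close>; quantifying over
  all names for the endpoints replaces the relativization of formulas to intervals.
\<close>

definition dS :: "cord \<Rightarrow> (real set \<Rightarrow> bool) \<Rightarrow> bool" where
  "dS \<gamma> Q \<longleftrightarrow> (\<forall>lo hi. Sg \<gamma> (set_option lo \<union> set_option hi)
     (\<lambda>X s. Q (ivl X (map_option s lo) (map_option s hi))))"

text \<open>Defined by duality, so that closure properties of \<open>dS\<close> transfer by
  negation; \<open>Sg_neg\<close> recovers actual \<open>Pi_fm\<close> formulas.\<close>

definition dP :: "cord \<Rightarrow> (real set \<Rightarrow> bool) \<Rightarrow> bool" where
  "dP \<gamma> Q \<longleftrightarrow> dS \<gamma> (\<lambda>Y. \<not> Q Y)"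

lemma dP_not: "dP \<gamma> (\<lambda>Y. \<not> Q Y) \<longleftrightarrow> dS \<gamma> Q"
  by (simp add: dP_def)

lemma dS_mono: "dS \<beta> Q \<Longrightarrow> \<beta> \<le> \<gamma> \<Longrightarrow> dS \<gamma> Q"
  unfolding dS_def by (auto intro: Sg_mono)

lemma dP_imp_dS: "dP \<beta> Q \<Longrightarrow> \<beta> < \<gamma> \<Longrightarrow> dS \<gamma> Q"
  unfolding dP_def dS_def Sg_neg by (auto intro: Pg_imp_Sg)

lemma dS_imp_dP: "dS \<beta> Q \<Longrightarrow> \<beta> < \<gamma> \<Longrightarrow> dP \<gamma> Q"
  using dP_imp_dS[of \<beta> "\<lambda>Y. \<not> Q Y" \<gamma>] by (simp add: dP_def)

lemma dS_const: "dS \<gamma> (\<lambda>Y. b)"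
  unfolding dS_def by (simp add: Sg_const)

lemma dS_disj:
  assumes "countable I" "\<And>i. i \<in> I \<Longrightarrow> dS \<gamma> (Q i)" "I \<noteq> {} \<Longrightarrow> 0 < \<gamma>"
  shows "dS \<gamma> (\<lambda>Y. \<exists>i\<in>I. Q i Y)"
  using assms unfolding dS_def by (auto intro!: Sg_countable_disj)

lemma dP_conj:
  assumes "countable I" "\<And>i. i \<in> I \<Longrightarrow> dP \<gamma> (Q i)" "I \<noteq> {} \<Longrightarrow> 0 < \<gamma>"
  shows "dP \<gamma> (\<lambda>Y. \<forall>i\<in>I. Q i Y)"
  using dS_disj[of I \<gamma> "\<lambda>i Y. \<not> Q i Y"] assms unfolding dP_def by simp

lemma dP_and:
  assumes "dP \<gamma> Q" "dP \<gamma> R" "0 < \<gamma>"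
  shows "dP \<gamma> (\<lambda>Y. Q Y \<and> R Y)"
proof -
  have "dP \<gamma> (\<lambda>Y. \<forall>b\<in>UNIV. (if b then Q else R) Y)"
    using assms by (intro dP_conj) auto
  moreover have "(\<lambda>Y. \<forall>b\<in>UNIV. (if b then Q else R) Y) = (\<lambda>Y. Q Y \<and> R Y)"
    by (rule ext) (metis (full_types) UNIV_I)
  ultimately show ?thesis
    by simp
qed

text \<open>The cut point becomes a new named endpoint, so both sides of the cut are again intervals
  of the kind covered by the hypotheses. The price is one existential quantifier, absorbed at
  positive level; membership of the point in the interval is expressed without quantifiers.\<close>

lemma dS_cut:
  assumes Q: "dS \<gamma> Q" and R: "dS \<gamma> R" and pos: "0 < \<gamma>"
  shows "dS \<gamma> (\<lambda>Y. \<exists>z\<in>Y. Q (Y \<inter> {..<z}) \<and> R (Y \<inter> {z<..}))"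
  unfolding dS_def
proof (intro allI)
  fix lo hi :: "nat option"
  define W where "W = set_option lo \<union> set_option hi"
  have finW: "finite W"
    by (simp add: W_def)
  \<comment> \<open>A name different from both endpoint names, so that assigning the cut point
    leaves the endpoints unchanged.\<close>
  then obtain z where z: "z \<notin> W"
    using ex_new_if_finite[OF infinite_UNIV_nat] by blast
  define V where "V = insert z W"
  have finV: "finite V"
    using finW by (simp add: V_def)
  have 1: "Sg \<gamma> V (\<lambda>X s. \<forall>x. lo = Some x \<longrightarrow> s x < s z)"
  proof (cases lo)
    case None
    then show ?thesis
      using Sg_const[of \<gamma> V True] by simp
  next
    case (Some x)
    have "Sg \<gamma> (fv (Neg (Rel z x))) (\<lambda>X s. sat X LE s (Neg (Rel z x)))"
      by (intro Sg_qf finitary_qf.intros)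
    then have "Sg \<gamma> V (\<lambda>X s. sat X LE s (Neg (Rel z x)))"
      by (rule Sg_mono) (auto simp: V_def W_def Some)
    then show ?thesis
      by (simp add: Some LE_def not_le)
  qed
  have 2: "Sg \<gamma> V (\<lambda>X s. \<forall>x. hi = Some x \<longrightarrow> s z < s x)"
  proof (cases hi)
    case None
    then show ?thesis
      using Sg_const[of \<gamma> V True] by simp
  next
    case (Some x)
    have "Sg \<gamma> (fv (Neg (Rel x z))) (\<lambda>X s. sat X LE s (Neg (Rel x z)))"
      by (intro Sg_qf finitary_qf.intros)
    then have "Sg \<gamma> V (\<lambda>X s. sat X LE s (Neg (Rel x z)))"
      by (rule Sg_mono) (auto simp: V_def W_def Some)
    then show ?thesis
      by (simp add: Some LE_def not_le)
  qed
  have 3: "Sg \<gamma> V (\<lambda>X s. Q (ivl X (map_option s lo) (map_option s (Some z))))"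
    using Q[unfolded dS_def, rule_format, of lo "Some z"] by (rule Sg_mono) (auto simp: V_def W_def)
  have 4: "Sg \<gamma> V (\<lambda>X s. R (ivl X (map_option s (Some z)) (map_option s hi)))"
    using R[unfolded dS_def, rule_format, of "Some z" hi] by (rule Sg_mono) (auto simp: V_def W_def)
  have sub: "V - {z} \<subseteq> W"
    by (auto simp: V_def)
  have sg: "Sg \<gamma> W (\<lambda>X s. \<exists>a\<in>X. ((\<forall>x. lo = Some x \<longrightarrow> (s(z := a)) x < (s(z := a)) z) \<and>
      (\<forall>x. hi = Some x \<longrightarrow> (s(z := a)) z < (s(z := a)) x)) \<and>
      Q (ivl X (map_option (s(z := a)) lo) (map_option (s(z := a)) (Some z))) \<and>
      R (ivl X (map_option (s(z := a)) (Some z)) (map_option (s(z := a)) hi)))"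
    using Sg_ex[OF Sg_conj[OF Sg_conj[OF 1 2 finV] Sg_conj[OF 3 4 finV] finV] pos, of z]
    by (rule Sg_mono) (use sub in auto)
  have eq: "(\<lambda>(X :: real set) (s :: nat \<Rightarrow> real). \<exists>a\<in>X. ((\<forall>x. lo = Some x \<longrightarrow> (s(z := a)) x < (s(z := a)) z) \<and>
      (\<forall>x. hi = Some x \<longrightarrow> (s(z := a)) z < (s(z := a)) x)) \<and>
      Q (ivl X (map_option (s(z := a)) lo) (map_option (s(z := a)) (Some z))) \<and>
      R (ivl X (map_option (s(z := a)) (Some z)) (map_option (s(z := a)) hi))) =
    (\<lambda>X s. \<exists>a\<in>ivl X (map_option s lo) (map_option s hi).
      Q (ivl X (map_option s lo) (map_option s hi) \<inter> {..<a}) \<and>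
      R (ivl X (map_option s lo) (map_option s hi) \<inter> {a<..}))"
  proof (intro ext)
    fix X :: "real set" and s :: "nat \<Rightarrow> real"
    have upd: "map_option (s(z := a)) lo = map_option s lo" "map_option (s(z := a)) hi = map_option s hi" for a
      using z by (cases lo; cases hi; simp add: W_def)+
    have ends: "(\<forall>x. lo = Some x \<longrightarrow> (s(z := a)) x < (s(z := a)) z) \<longleftrightarrow> (\<forall>b. map_option s lo = Some b \<longrightarrow> b < a)"
      "(\<forall>x. hi = Some x \<longrightarrow> (s(z := a)) z < (s(z := a)) x) \<longleftrightarrow> (\<forall>b. map_option s hi = Some b \<longrightarrow> a < b)" for a
      using z by (cases lo; cases hi; simp add: W_def)+
    show "(\<exists>a\<in>X. ((\<forall>x. lo = Some x \<longrightarrow> (s(z := a)) x < (s(z := a)) z) \<and>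
      (\<forall>x. hi = Some x \<longrightarrow> (s(z := a)) z < (s(z := a)) x)) \<and>
      Q (ivl X (map_option (s(z := a)) lo) (map_option (s(z := a)) (Some z))) \<and>
      R (ivl X (map_option (s(z := a)) (Some z)) (map_option (s(z := a)) hi))) =
    (\<exists>a\<in>ivl X (map_option s lo) (map_option s hi).
      Q (ivl X (map_option s lo) (map_option s hi) \<inter> {..<a}) \<and>
      R (ivl X (map_option s lo) (map_option s hi) \<inter> {a<..}))"
      unfolding ends unfolding upd option.map(2) fun_upd_same
    proof (intro iffI; elim bexE conjE)
      fix a assume a: "a \<in> X" "\<forall>b. map_option s lo = Some b \<longrightarrow> b < a" "\<forall>b. map_option s hi = Some b \<longrightarrow> a < b"
        and QR: "Q (ivl X (map_option s lo) (Some a))" "R (ivl X (Some a) (map_option s hi))"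
      have mem: "a \<in> ivl X (map_option s lo) (map_option s hi)"
        using a by (simp add: ivl_def)
      then show "\<exists>a\<in>ivl X (map_option s lo) (map_option s hi).
          Q (ivl X (map_option s lo) (map_option s hi) \<inter> {..<a}) \<and>
          R (ivl X (map_option s lo) (map_option s hi) \<inter> {a<..})"
        using QR by (intro bexI[of _ a] conjI) (simp_all only: ivl_cut[OF mem])
    next
      fix a assume mem: "a \<in> ivl X (map_option s lo) (map_option s hi)"
        and QR: "Q (ivl X (map_option s lo) (map_option s hi) \<inter> {..<a})"
          "R (ivl X (map_option s lo) (map_option s hi) \<inter> {a<..})"
      have "a \<in> X" "\<forall>b. map_option s lo = Some b \<longrightarrow> b < a" "\<forall>b. map_option s hi = Some b \<longrightarrow> a < b"
        using mem by (auto simp: ivl_def)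
      then show "\<exists>a\<in>X. ((\<forall>b. map_option s lo = Some b \<longrightarrow> b < a) \<and> (\<forall>b. map_option s hi = Some b \<longrightarrow> a < b)) \<and>
          Q (ivl X (map_option s lo) (Some a)) \<and> R (ivl X (Some a) (map_option s hi))"
        using QR by (intro bexI[of _ a] conjI) (simp_all only: ivl_cut[OF mem])
    qed
  qed
  show "Sg \<gamma> (set_option lo \<union> set_option hi)
      (\<lambda>X s. \<exists>a\<in>ivl X (map_option s lo) (map_option s hi).
      Q (ivl X (map_option s lo) (map_option s hi) \<inter> {..<a}) \<and>
      R (ivl X (map_option s lo) (map_option s hi) \<inter> {a<..}))"
    using sg unfolding eq unfolding W_def .
qed

lemma dP_cut:
  assumes "dP \<gamma> Q" "dP \<gamma> R" "0 < \<gamma>"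
  shows "dP \<gamma> (\<lambda>Y. \<forall>z\<in>Y. Q (Y \<inter> {..<z}) \<or> R (Y \<inter> {z<..}))"
  using dS_cut[of \<gamma> "\<lambda>Y. \<not> Q Y" "\<lambda>Y. \<not> R Y"] assms unfolding dP_def by simp

text \<open>Mirroring exchanges the two endpoints, so the formula for \<open>hi\<close> and
  \<open>lo\<close> interchanged is the one to reverse.\<close>

lemma dS_mirror:
  assumes "dS \<gamma> Q"
  shows "dS \<gamma> (\<lambda>Y. Q (uminus ` Y))"
  unfolding dS_def
proof (intro allI)
  fix lo hi :: "nat option"
  have "ivl (uminus ` X) (map_option (uminus \<circ> s) hi) (map_option (uminus \<circ> s) lo)
      = uminus ` ivl X (map_option s lo) (map_option s hi)" for X and s :: "nat \<Rightarrow> real"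
    unfolding ivl_def by (cases lo; cases hi; auto)
  then show "Sg \<gamma> (set_option lo \<union> set_option hi)
      (\<lambda>X s. Q (uminus ` ivl X (map_option s lo) (map_option s hi)))"
    using Sg_swap[OF assms[unfolded dS_def, rule_format, of hi lo]] by (simp add: Un_commute)
qed

lemma dP_mirror: "dP \<gamma> Q \<Longrightarrow> dP \<gamma> (\<lambda>Y. Q (uminus ` Y))"
  unfolding dP_def by (rule dS_mirror)

text \<open>With both endpoints absent the interval is the whole universe and no free variable
  remains.\<close>

lemma dP_sentence:
  assumes "dP \<gamma> Q"
  shows "\<exists>\<phi>. Pi_fm \<gamma> \<phi> \<and> fv \<phi> = {} \<and> (\<forall>X s. sat X LE s \<phi> \<longleftrightarrow> Q X)"
proof -
  have "Pg \<gamma> {} (\<lambda>X s. Q X)"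
    using assms[unfolded dP_def dS_def Sg_neg, rule_format, of None None] by (simp add: ivl_def)
  then show ?thesis
    unfolding Pg_def by simp
qed


section \<open>Isomorphism of sets of reals\<close>

definition oiso :: "real set \<Rightarrow> real set \<Rightarrow> bool" where
  "oiso X Y \<longleftrightarrow> (\<exists>f. strict_mono_on X f \<and> f ` X = Y)"

lemma strict_mono_on_less_iff:
  fixes f :: "real \<Rightarrow> real"
  assumes "strict_mono_on X f" "x \<in> X" "y \<in> X"
  shows "f x < f y \<longleftrightarrow> x < y"
  using assms by (metis monotone_onD less_asym less_linear)

lemma oiso_refl: "oiso X X"
  unfolding oiso_def by (intro exI[of _ id]) (simp add: monotone_on_def)

lemma oiso_trans: "oiso X Y \<Longrightarrow> oiso Y Z \<Longrightarrow> oiso X Z"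
  unfolding oiso_def
proof (elim exE conjE)
  fix f g assume "strict_mono_on X f" "f ` X = Y" "strict_mono_on Y g" "g ` Y = Z"
  then have "strict_mono_on X (g \<circ> f)" "(g \<circ> f) ` X = Z"
    unfolding monotone_on_def image_comp[symmetric] by simp_all blast
  then show "\<exists>f. strict_mono_on X f \<and> f ` X = Z"
    by blast
qed

lemma oiso_sym: "oiso X Y \<Longrightarrow> oiso Y X"
  unfolding oiso_def
proof (elim exE conjE)
  fix f assume f: "strict_mono_on X f" "f ` X = Y"
  then have "inj_on f X"
    by (simp add: strict_mono_on_imp_inj_on)
  then have inv: "inv_into X f (f x) = x" if "x \<in> X" for x
    using that by simp
  have "strict_mono_on Y (inv_into X f)"
  proof (rule monotone_onI)
    fix y y' assume "y \<in> Y" "y' \<in> Y" "y < y'"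
    then obtain x x' where "x \<in> X" "x' \<in> X" "y = f x" "y' = f x'"
      using f(2) by blast
    then show "inv_into X f y < inv_into X f y'"
      using \<open>y < y'\<close> strict_mono_on_less_iff[OF f(1)] by (simp add: inv)
  qed
  moreover have "inv_into X f ` Y = X"
    using inv unfolding f(2)[symmetric] by force
  ultimately show "\<exists>f. strict_mono_on Y f \<and> f ` Y = X"
    by blast
qed

lemma image_Int_lessThan:
  fixes f :: "real \<Rightarrow> real"
  assumes "strict_mono_on X f" "f ` X = Y" "a \<in> X"
  shows "f ` (X \<inter> {..<a}) = Y \<inter> {..<f a}"
  unfolding assms(2)[symmetric] using strict_mono_on_less_iff[OF assms(1) _ assms(3)] by auto

lemma image_Int_greaterThanLessThan:
  fixes f :: "real \<Rightarrow> real"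
  assumes "strict_mono_on X f" "f ` X = Y" "a \<in> X" "b \<in> X"
  shows "f ` (X \<inter> {a<..<b}) = Y \<inter> {f a<..<f b}"
  unfolding assms(2)[symmetric]
  using strict_mono_on_less_iff[OF assms(1) _ assms(4)] strict_mono_on_less_iff[OF assms(1) assms(3)]
  by auto

lemma oiso_image: "strict_mono_on X f \<Longrightarrow> Z \<subseteq> X \<Longrightarrow> oiso Z (f ` Z)"
  unfolding oiso_def by (intro exI[of _ f]) (auto intro: monotone_on_subset)

lemma oiso_Un:
  assumes "oiso X X'" "oiso Y Y'" "\<And>x y. x \<in> X \<Longrightarrow> y \<in> Y \<Longrightarrow> x < y" "\<And>x y. x \<in> X' \<Longrightarrow> y \<in> Y' \<Longrightarrow> x < y"
  shows "oiso (X \<union> Y) (X' \<union> Y')"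
proof -
  obtain f g where f: "strict_mono_on X f" "f ` X = X'" and g: "strict_mono_on Y g" "g ` Y = Y'"
    using assms(1,2) unfolding oiso_def by blast
  define h where "h z = (if z \<in> X then f z else g z)" for z
  have Y: "y \<notin> X" if "y \<in> Y" for y
    using assms(3) that by blast
  have hX: "h x = f x" if "x \<in> X" for x
    using that by (simp add: h_def)
  have hY: "h y = g y" if "y \<in> Y" for y
    using that Y by (simp add: h_def)
  have "strict_mono_on (X \<union> Y) h"
  proof (rule monotone_onI)
    fix x y assume "x \<in> X \<union> Y" "y \<in> X \<union> Y" "x < y"
    then consider "x \<in> X" "y \<in> X" | "x \<in> X" "y \<in> Y" | "x \<in> Y" "y \<in> Y"
      using assms(3) by (auto dest: less_asym)
    then show "h x < h y"
    proof cases
      case 1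
      then show ?thesis
        using f(1) \<open>x < y\<close> by (simp add: hX monotone_on_def)
    next
      case 2
      then show ?thesis
        using assms(4) f(2) g(2) by (auto simp: hX hY)
    next
      case 3
      then show ?thesis
        using g(1) \<open>x < y\<close> by (simp add: hY monotone_on_def)
    qed
  qed
  moreover have "h ` (X \<union> Y) = X' \<union> Y'"
    using f(2) g(2) hX hY by (simp add: image_Un)
  ultimately show ?thesis
    unfolding oiso_def by blast
qed

lemma oiso_uminus: "oiso X Y \<Longrightarrow> oiso (uminus ` X) (uminus ` Y)"
  unfolding oiso_def
proof (elim exE conjE)
  fix f assume "strict_mono_on X f" "f ` X = Y"
  then have "strict_mono_on (uminus ` X) (\<lambda>x. - f (- x))" "(\<lambda>x. - f (- x)) ` uminus ` X = uminus ` Y"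
    by (auto simp: monotone_on_def image_image)
  then show "\<exists>f. strict_mono_on (uminus ` X) f \<and> f ` uminus ` X = uminus ` Y"
    by blast
qed

lemma uminus_image_uminus: "uminus ` uminus ` X = (X :: real set)"
  by (simp add: image_image)

lemma oiso_uminus_iff: "oiso (uminus ` X) (uminus ` Y) \<longleftrightarrow> oiso X Y"
  using oiso_uminus[of X Y] oiso_uminus[of "uminus ` X" "uminus ` Y"] by (auto simp: uminus_image_uminus)

lemma oiso_singleton: "oiso {a} {b}"
  unfolding oiso_def by (intro exI[of _ "\<lambda>_. b"]) (simp add: monotone_on_def)

lemma oiso_imp_structure_iso:
  assumes "oiso X Y"
  shows "\<exists>f. structure_iso f X LE Y LE"
proof -
  obtain f where f: "strict_mono_on X f" "f ` X = Y"
    using assms unfolding oiso_def by blast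
  have "f x \<le> f y \<longleftrightarrow> x \<le> y" if "x \<in> X" "y \<in> X" for x y
    using strict_mono_on_less_iff[OF f(1) that(2,1)] by linarith
  then have "structure_iso f X LE Y LE"
    using f by (simp add: structure_iso_def bij_betw_def LE_def strict_mono_on_imp_inj_on)
  then show ?thesis
    by blast
qed

text \<open>Definable properties are given by sentences, hence invariant under isomorphism. A
  description therefore has to be verified in one order only.\<close>

lemma dP_oiso_cong:
  assumes "dP \<gamma> Q" "oiso X Y"
  shows "Q X \<longleftrightarrow> Q Y"
proof -
  obtain \<phi> where \<phi>: "fv \<phi> = {}" "\<forall>X s. sat X LE s \<phi> \<longleftrightarrow> Q X"
    using dP_sentence[OF assms(1)] by blast
  obtain f where "structure_iso f X LE Y LE"
    using oiso_imp_structure_iso[OF assms(2)] by blast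
  then show ?thesis
    using models_structure_iso[of f X LE Y LE \<phi>] \<phi> by (simp add: models_def)
qed

section \<open>Condensation rank\<close>

abbreviation btw :: "real \<Rightarrow> real \<Rightarrow> real set" where
  "btw u v \<equiv> {min u v<..<max u v}"

text \<open>
  \<open>cr \<delta> X\<close> holds iff the relation ``the points strictly between \<open>u\<close> and \<open>v\<close> have smaller rank''
  has finitely many classes in \<open>X\<close>.  It is a consequence of \<open>HR \<delta>\<close> that is stable under all the
  operations below.
\<close>

inductive cr :: "cord \<Rightarrow> real set \<Rightarrow> bool" where
  crI: "finite F \<Longrightarrow> F \<subseteq> X \<Longrightarrow> (\<forall>u\<in>X. \<exists>f\<in>F. u = f \<or> (\<exists>\<delta>'<\<delta>. cr \<delta>' (X \<inter> btw u f))) \<Longrightarrow> cr \<delta> X"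

text \<open>The notion of smallness behind the condensation of level \<delta>. It is closed under
  subsets and under sums of two sets, which makes
  \<open>u = v \<or> crl \<delta> (X \<inter> btw u v)\<close> an equivalence relation. Nothing is
  small for \<delta> = 0, so there the classes are single points.\<close>

definition crl :: "cord \<Rightarrow> real set \<Rightarrow> bool" where
  "crl \<delta> X \<longleftrightarrow> (\<exists>\<delta>'<\<delta>. cr \<delta>' X)"

lemma cr_iff: "cr \<delta> X \<longleftrightarrow> (\<exists>F. finite F \<and> F \<subseteq> X \<and> (\<forall>u\<in>X. \<exists>f\<in>F. u = f \<or> crl \<delta> (X \<inter> btw u f)))"
  unfolding crl_def by (subst cr.simps) blast

lemma btw_commute: "btw u v = btw v u"
  by (simp add: min.commute max.commute)

lemma crl_mono: "crl \<delta> X \<Longrightarrow> \<delta> \<le> \<gamma> \<Longrightarrow> crl \<gamma> X"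
  unfolding crl_def using order.strict_trans2 by blast

lemma cr_mono: "cr \<delta> X \<Longrightarrow> \<delta> \<le> \<gamma> \<Longrightarrow> cr \<gamma> X"
  unfolding cr_iff using crl_mono by meson

lemma cr_imp_crl: "cr \<delta> X \<Longrightarrow> \<delta> < \<gamma> \<Longrightarrow> crl \<gamma> X"
  unfolding crl_def by blast

lemma crl_pos: "crl \<delta> X \<Longrightarrow> 0 < \<delta>"
  unfolding crl_def using zero_le_cord order.strict_trans1 by blast

lemma cr_finite: "finite X \<Longrightarrow> cr \<delta> X"
  unfolding cr_iff by blast

lemma crl_finite: "finite X \<Longrightarrow> 0 < \<delta> \<Longrightarrow> crl \<delta> X"
  unfolding crl_def using cr_finite by blast

text \<open>By convexity the points between two elements of a summand are the same in the summand
  and in the union, so the union of the sets of representatives works.\<close>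

lemma cr_UN:
  assumes "finite I" "\<And>i. i \<in> I \<Longrightarrow> cr \<delta> (M i)"
    and convex: "\<And>i x y. i \<in> I \<Longrightarrow> x \<in> M i \<Longrightarrow> y \<in> M i \<Longrightarrow> (\<Union>i\<in>I. M i) \<inter> btw x y \<subseteq> M i"
  shows "cr \<delta> (\<Union>i\<in>I. M i)"
proof -
  have "\<exists>F. finite F \<and> F \<subseteq> M i \<and> (\<forall>u\<in>M i. \<exists>f\<in>F. u = f \<or> crl \<delta> (M i \<inter> btw u f))" if "i \<in> I" for i
    using assms(2)[OF that] unfolding cr_iff .
  then obtain F where F: "\<And>i. i \<in> I \<Longrightarrow> finite (F i)" "\<And>i. i \<in> I \<Longrightarrow> F i \<subseteq> M i"
      "\<And>i u. i \<in> I \<Longrightarrow> u \<in> M i \<Longrightarrow> \<exists>f\<in>F i. u = f \<or> crl \<delta> (M i \<inter> btw u f)"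
    by metis
  have "\<exists>f\<in>(\<Union>i\<in>I. F i). u = f \<or> crl \<delta> ((\<Union>i\<in>I. M i) \<inter> btw u f)" if u: "u \<in> (\<Union>i\<in>I. M i)" for u
  proof -
    obtain i where i: "i \<in> I" "u \<in> M i"
      using u by blast
    obtain f where f: "f \<in> F i" "u = f \<or> crl \<delta> (M i \<inter> btw u f)"
      using F(3)[OF i] by blast
    have "(\<Union>i\<in>I. M i) \<inter> btw u f = M i \<inter> btw u f"
      using convex[OF i(1,2), of f] F(2)[OF i(1)] f(1) i(1) by blast
    then have "u = f \<or> crl \<delta> ((\<Union>i\<in>I. M i) \<inter> btw u f)"
      using f(2) by (simp only:)
    then show ?thesis
      using f(1) i(1) by blast
  qed
  then show ?thesis
    unfolding cr_iff using F(1,2) assms(1) by (intro exI[of _ "\<Union>i\<in>I. F i"]) blast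
qed

lemma cr_Un:
  assumes "cr \<delta> X" "cr \<delta> Y" "\<And>x y. x \<in> X \<Longrightarrow> y \<in> Y \<Longrightarrow> x < y"
  shows "cr \<delta> (X \<union> Y)"
proof -
  define M where "M b = (if b then X else Y)" for b
  have Un: "(\<Union>b\<in>UNIV. M b) = X \<union> Y"
    by (auto simp: M_def)
  have ord: "\<not> y < x" if "x \<in> X" "y \<in> Y" for x y
    using assms(3)[OF that] by simp
  have "cr \<delta> (\<Union>b\<in>UNIV. M b)"
  proof (rule cr_UN)
    show "(\<Union>i\<in>UNIV. M i) \<inter> btw x y \<subseteq> M i" if "x \<in> M i" "y \<in> M i" for i x y
      unfolding Un using that ord
      by (auto simp: M_def less_max_iff_disj min_less_iff_disj split: if_splits)
  qed (use assms in \<open>auto simp: M_def\<close>)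
  then show ?thesis
    unfolding Un .
qed

lemma crl_Un:
  assumes "crl \<delta> X" "crl \<delta> Y" "\<And>x y. x \<in> X \<Longrightarrow> y \<in> Y \<Longrightarrow> x < y"
  shows "crl \<delta> (X \<union> Y)"
proof -
  obtain d e where "d < \<delta>" "cr d X" "e < \<delta>" "cr e Y"
    using assms(1,2) unfolding crl_def by blast
  then have "cr (max d e) (X \<union> Y)" "max d e < \<delta>"
    using assms(3) by (auto intro!: cr_Un intro: cr_mono)
  then show ?thesis
    by (rule cr_imp_crl)
qed

text \<open>The cut point is a finite middle piece. Read contrapositively: in a set that is not
  small, no point has small parts on both sides. This keeps left and right parts of an order
  apart.\<close>

lemma crl_cut:
  assumes "crl \<delta> (X \<inter> {..<u})" "crl \<delta> (X \<inter> {u<..})"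
  shows "crl \<delta> X"
proof -
  have "crl \<delta> (X \<inter> {u})"
    by (rule crl_finite) (use crl_pos[OF assms(1)] in auto)
  then have "crl \<delta> (X \<inter> {..<u} \<union> (X \<inter> {u} \<union> X \<inter> {u<..}))"
    using assms by (intro crl_Un) auto
  then show ?thesis
    by (rule back_subst[of "crl \<delta>"]) auto
qed

text \<open>Either one of the given intervals contains the new one, or \<open>v\<close> lies
  strictly inside it and the two are glued at \<open>v\<close>. Closure under subsets is a
  hypothesis because the lemma is used within the induction that establishes it.\<close>

lemma crl_btw_trans_aux:
  assumes sub: "\<And>Y Z. crl \<delta> Y \<Longrightarrow> Z \<subseteq> Y \<Longrightarrow> crl \<delta> Z"
    and 1: "crl \<delta> (X \<inter> btw u v)" and 2: "crl \<delta> (X \<inter> btw v w)"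
  shows "crl \<delta> (X \<inter> btw u w)"
proof -
  have "w \<in> {min u v..max u v} \<or> u \<in> {min v w..max v w} \<or> v \<in> btw u w"
    unfolding atLeastAtMost_iff greaterThanLessThan_iff by linarith
  then consider "w \<in> {min u v..max u v}" | "u \<in> {min v w..max v w}" | "v \<in> btw u w"
    by blast
  then show ?thesis
  proof cases
    case 1
    then show ?thesis
      by (intro sub[OF assms(2)]) (auto simp: min_def max_def split: if_splits)
  next
    case 2
    then show ?thesis
      by (intro sub[OF assms(3)]) (auto simp: min_def max_def split: if_splits)
  next
    case 3
    show ?thesis
    proof (rule crl_cut[of _ _ v]; cases "u < w")
      assume "u < w"
      then show "crl \<delta> (X \<inter> btw u w \<inter> {..<v})"
        using 3 by (intro sub[OF assms(2)]) auto
      show "crl \<delta> (X \<inter> btw u w \<inter> {v<..})"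
        using 3 \<open>u < w\<close> by (intro sub[OF assms(3)]) auto
    next
      assume "\<not> u < w"
      then show "crl \<delta> (X \<inter> btw u w \<inter> {..<v})"
        using 3 by (intro sub[OF assms(3)]) auto
      show "crl \<delta> (X \<inter> btw u w \<inter> {v<..})"
        using 3 \<open>\<not> u < w\<close> by (intro sub[OF assms(2)]) auto
    qed
  qed
qed

text \<open>Representatives for \<open>X\<close> need not lie in \<open>Y\<close>. Each one that is
  related to some point of \<open>Y\<close> is replaced by such a point, which represents the same
  class by transitivity; the induction hypothesis provides the closure under subsets on which
  transitivity rests.\<close>

lemma cr_subset:
  assumes "cr \<delta> X" "Y \<subseteq> X"
  shows "cr \<delta> Y"
  using assms
proof (induction \<delta> arbitrary: X Y rule: less_induct)
  case (less \<delta>)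
  have sub: "crl \<delta> Z" if YZ: "crl \<delta> Y" "Z \<subseteq> Y" for Y Z
  proof -
    obtain d where "d < \<delta>" "cr d Y"
      using YZ(1) unfolding crl_def by blast
    then show ?thesis
      using less.IH[OF _ _ YZ(2)] cr_imp_crl by blast
  qed
  define E where "E u v \<longleftrightarrow> u = v \<or> crl \<delta> (X \<inter> btw u v)" for u v
  have E_trans: "E u w" if "E u v" "E v w" for u v w
  proof -
    have "crl \<delta> (X \<inter> btw u w)" if "crl \<delta> (X \<inter> btw u v)" "crl \<delta> (X \<inter> btw v w)"
      by (rule crl_btw_trans_aux[OF _ that]) (rule sub)
    then show ?thesis
      using that unfolding E_def by blast
  qed
  have E_sym: "E u v" if "E v u" for u v
    using that btw_commute[of u v] unfolding E_def by auto
  obtain F where F: "finite F" "F \<subseteq> X" "\<And>u. u \<in> X \<Longrightarrow> \<exists>f\<in>F. E u f"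
    using less.prems(1) unfolding cr_iff E_def by blast
  define F' where "F' = {f \<in> F. \<exists>u\<in>Y. E u f}"
  have "\<forall>f\<in>F'. \<exists>u. u \<in> Y \<and> E u f"
    unfolding F'_def by blast
  then obtain g where g: "\<forall>f\<in>F'. g f \<in> Y \<and> E (g f) f"
    using bchoice by metis
  have "\<exists>v\<in>g ` F'. u = v \<or> crl \<delta> (Y \<inter> btw u v)" if u: "u \<in> Y" for u
  proof -
    obtain f where f: "f \<in> F" "E u f"
      using F(3) u less.prems(2) by blast
    then have "f \<in> F'"
      unfolding F'_def using u by blast
    then have "E u (g f)"
      using g f(2) E_trans E_sym by blast
    then have "u = g f \<or> crl \<delta> (Y \<inter> btw u (g f))"
      unfolding E_def using Int_mono[OF less.prems(2) order_refl] sub by metis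
    then show ?thesis
      using \<open>f \<in> F'\<close> by blast
  qed
  moreover have "finite (g ` F')" "g ` F' \<subseteq> Y"
    using F(1) g unfolding F'_def by auto
  ultimately show ?case
    unfolding cr_iff by blast
qed

lemma crl_subset: "crl \<delta> X \<Longrightarrow> Y \<subseteq> X \<Longrightarrow> crl \<delta> Y"
  unfolding crl_def using cr_subset by blast

lemma crl_btw_trans: "crl \<delta> (X \<inter> btw u v) \<Longrightarrow> crl \<delta> (X \<inter> btw v w) \<Longrightarrow> crl \<delta> (X \<inter> btw u w)"
  by (rule crl_btw_trans_aux) (rule crl_subset)

lemma image_Int_btw:
  fixes f :: "real \<Rightarrow> real"
  assumes "strict_mono_on X f" "u \<in> X" "v \<in> X"
  shows "f ` (X \<inter> btw u v) = f ` X \<inter> btw (f u) (f v)"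
proof (cases "u \<le> v")
  case True
  then have "f u \<le> f v"
    using strict_mono_on_less_iff[OF assms(1,3,2)] by linarith
  then show ?thesis
    using True image_Int_greaterThanLessThan[OF assms(1) refl assms(2,3)] by simp
next
  case False
  then have "f v < f u"
    using strict_mono_on_less_iff[OF assms(1,3,2)] by linarith
  then show ?thesis
    using False image_Int_greaterThanLessThan[OF assms(1) refl assms(3,2)] by simp
qed

lemma cr_image:
  assumes "cr \<delta> X" "strict_mono_on X f"
  shows "cr \<delta> (f ` X)"
  using assms
proof (induction rule: cr.induct)
  case (crI F X \<delta>)
  have "\<exists>g\<in>f ` F. v = g \<or> (\<exists>\<delta>'<\<delta>. cr \<delta>' (f ` X \<inter> btw v g))" if v: "v \<in> f ` X" for v
  proof -
    obtain u where u: "u \<in> X" "v = f u"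
      using v by blast
    obtain g where g: "g \<in> F" "u = g \<or> (\<exists>\<delta>'<\<delta>. cr \<delta>' (X \<inter> btw u g) \<and>
        (strict_mono_on (X \<inter> btw u g) f \<longrightarrow> cr \<delta>' (f ` (X \<inter> btw u g))))"
      using crI.IH u(1) by blast
    have "strict_mono_on (X \<inter> btw u g) f"
      using crI.prems by (rule monotone_on_subset) auto
    then show ?thesis
      using g image_Int_btw[OF crI.prems u(1), of g] crI.hyps(2) u(2)
      by (intro bexI[of _ "f g"]) auto
  qed
  then show ?case
    using crI.hyps by (intro cr.crI[of "f ` F"]) auto
qed

lemma cr_oiso: "oiso X Y \<Longrightarrow> cr \<delta> X \<Longrightarrow> cr \<delta> Y"
  unfolding oiso_def using cr_image by blast

lemma crl_oiso: "oiso X Y \<Longrightarrow> crl \<delta> X \<Longrightarrow> crl \<delta> Y"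
  unfolding crl_def using cr_oiso by blast

lemma uminus_Int_btw: "uminus ` (X \<inter> btw u v) = uminus ` X \<inter> btw (- u) (- v)" for u v :: real
  by (auto simp: min_def max_def)

lemma cr_uminus: "cr \<delta> X \<Longrightarrow> cr \<delta> (uminus ` X)"
proof (induction rule: cr.induct)
  case (crI F X \<delta>)
  have "\<exists>g\<in>uminus ` F. - u = g \<or> (\<exists>\<delta>'<\<delta>. cr \<delta>' (uminus ` X \<inter> btw (- u) g))" if "u \<in> X" for u
    using crI.IH that unfolding bex_simps(7) uminus_Int_btw[symmetric] by auto
  then show ?case
    using crI.hyps by (intro cr.crI[of "uminus ` F"]) auto
qed

lemma crl_uminus: "crl \<delta> X \<Longrightarrow> crl \<delta> (uminus ` X)"
  unfolding crl_def using cr_uminus by blast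

lemma crl_uminus_iff: "crl \<delta> (uminus ` X) \<longleftrightarrow> crl \<delta> X"
  using crl_uminus[of \<delta> X] crl_uminus[of \<delta> "uminus ` X"] by (auto simp: uminus_image_uminus)

text \<open>The number of classes is used to locate a point of an order up to its class.\<close>

definition indep :: "cord \<Rightarrow> real set \<Rightarrow> real set \<Rightarrow> bool" where
  "indep \<delta> X S \<longleftrightarrow> finite S \<and> S \<subseteq> X \<and> (\<forall>u\<in>S. \<forall>v\<in>S. u \<noteq> v \<longrightarrow> \<not> crl \<delta> (X \<inter> btw u v))"

definition at_most_classes :: "cord \<Rightarrow> nat \<Rightarrow> real set \<Rightarrow> bool" where
  "at_most_classes \<delta> n X \<longleftrightarrow> (\<forall>S. indep \<delta> X S \<longrightarrow> card S \<le> n)"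

text \<open>By transitivity two independent points cannot share a representative.\<close>

lemma cr_imp_at_most_classes:
  assumes "cr \<delta> X"
  shows "\<exists>n. at_most_classes \<delta> n X"
proof -
  obtain F where F: "finite F" "\<forall>u\<in>X. \<exists>f\<in>F. u = f \<or> crl \<delta> (X \<inter> btw u f)"
    using assms unfolding cr_iff by blast
  then obtain g where g: "\<And>u. u \<in> X \<Longrightarrow> g u \<in> F \<and> (u = g u \<or> crl \<delta> (X \<inter> btw u (g u)))"
    by metis
  have "card S \<le> card F" if S: "indep \<delta> X S" for S
  proof (rule card_inj_on_le[OF _ _ F(1)])
    show "inj_on g S"
    proof (rule inj_onI, rule ccontr)
      fix u v assume uv: "u \<in> S" "v \<in> S" "g u = g v" "u \<noteq> v"
      then have "u \<in> X" "v \<in> X"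
        using S unfolding indep_def by auto
      then have "crl \<delta> (X \<inter> btw u v)"
        using g[of u] g[of v] uv(3,4) crl_btw_trans[of \<delta> X u "g u" v] by (auto simp: btw_commute)
      then show False
        using S uv unfolding indep_def by blast
    qed
    show "g ` S \<subseteq> F"
      using S g unfolding indep_def by blast
  qed
  then show ?thesis
    unfolding at_most_classes_def by blast
qed

lemma indep_image:
  assumes "strict_mono_on X f" "indep \<delta> X S"
  shows "indep \<delta> (f ` X) (f ` S)" "card (f ` S) = card S"
proof -
  have S: "finite S" "S \<subseteq> X" "\<And>u v. u \<in> S \<Longrightarrow> v \<in> S \<Longrightarrow> u \<noteq> v \<Longrightarrow> \<not> crl \<delta> (X \<inter> btw u v)"
    using assms(2) unfolding indep_def by auto
  have "inj_on f S"
    using strict_mono_on_imp_inj_on[OF assms(1)] S(2) inj_on_subset by blast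
  then show "card (f ` S) = card S"
    by (rule card_image)
  have "\<not> crl \<delta> (f ` X \<inter> btw (f u) (f v))" if "u \<in> S" "v \<in> S" "f u \<noteq> f v" for u v
  proof -
    have uv: "u \<in> X" "v \<in> X" "u \<noteq> v"
      using that S(2) by auto
    have "oiso (f ` (X \<inter> btw u v)) (X \<inter> btw u v)"
      by (rule oiso_sym[OF oiso_image[OF assms(1)]]) auto
    then show ?thesis
      using S(3)[OF that(1,2) uv(3)] crl_oiso unfolding image_Int_btw[OF assms(1) uv(1,2)] by blast
  qed
  then show "indep \<delta> (f ` X) (f ` S)"
    using S(1,2) unfolding indep_def by blast
qed

lemma at_most_classes_oiso:
  assumes "oiso X Y" "at_most_classes \<delta> n X"
  shows "at_most_classes \<delta> n Y"
proof -
  obtain f where f: "strict_mono_on Y f" "f ` Y = X"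
    using oiso_sym[OF assms(1)] unfolding oiso_def by blast
  then show ?thesis
    using assms(2) indep_image[OF f(1)] unfolding at_most_classes_def by metis
qed

lemma indep_convex:
  assumes "indep \<delta> Y S" "Y \<subseteq> X" "\<And>u v. u \<in> Y \<Longrightarrow> v \<in> Y \<Longrightarrow> X \<inter> btw u v \<subseteq> Y"
  shows "indep \<delta> X S"
proof -
  have "X \<inter> btw u v = Y \<inter> btw u v" if "u \<in> Y" "v \<in> Y" for u v
    using assms(2) assms(3)[OF that] by blast
  then show ?thesis
    using assms(1,2) unfolding indep_def by (metis subset_iff)
qed

lemma indep_lessThan: "indep \<delta> (X \<inter> {..<b}) S \<Longrightarrow> indep \<delta> X S"
  by (erule indep_convex) auto

lemma indep_lessThan_iff: "indep \<delta> (X \<inter> {..<b}) S \<longleftrightarrow> indep \<delta> X S \<and> S \<subseteq> {..<b}"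
proof
  assume "indep \<delta> (X \<inter> {..<b}) S"
  then show "indep \<delta> X S \<and> S \<subseteq> {..<b}"
    using indep_lessThan by (auto simp: indep_def)
next
  assume "indep \<delta> X S \<and> S \<subseteq> {..<b}"
  moreover have "X \<inter> {..<b} \<inter> btw u v = X \<inter> btw u v" if "u < b" "v < b" for u v
    using that by auto
  ultimately show "indep \<delta> (X \<inter> {..<b}) S"
    unfolding indep_def by (metis Int_subset_iff lessThan_iff subset_iff)
qed

lemma at_most_classes_lessThan: "at_most_classes \<delta> n X \<Longrightarrow> at_most_classes \<delta> n (X \<inter> {..<b})"
  unfolding at_most_classes_def using indep_lessThan by blast

text \<open>Every interval from an older point to \<open>a\<close> contains the gap between the
  maximum \<open>m\<close> and \<open>a\<close>, so it is enough that this gap is large.\<close>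

lemma indep_insert:
  assumes "indep \<delta> X S" "m \<in> S" "\<And>u. u \<in> S \<Longrightarrow> u \<le> m" "a \<in> X" "m < a" "\<not> crl \<delta> (X \<inter> {m<..<a})"
  shows "indep \<delta> X (insert a S)" "card (insert a S) = Suc (card S)"
proof -
  have "\<not> crl \<delta> (X \<inter> btw u a)" if "u \<in> S" for u
  proof
    assume "crl \<delta> (X \<inter> btw u a)"
    then have "crl \<delta> (X \<inter> {m<..<a})"
      by (rule crl_subset) (use assms(3)[OF that] assms(5) in auto)
    then show False
      using assms(6) by blast
  qed
  then show "indep \<delta> X (insert a S)"
    using assms(1,4) unfolding indep_def by (auto simp: btw_commute[of a])
  have "a \<notin> S"
    using assms(3,5) by force
  then show "card (insert a S) = Suc (card S)"
    using assms(1) unfolding indep_def by simp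
qed

text \<open>At no level below \<tau> is there a last condensation class. This is vacuous for \<tau>
  = 0; for larger \<tau> it implies that \<open>X\<close> has no greatest element.\<close>

definition unb :: "cord \<Rightarrow> real set \<Rightarrow> bool" where
  "unb \<tau> X \<longleftrightarrow> (\<forall>p\<in>X. \<forall>\<delta><\<tau>. \<exists>a\<in>X. p < a \<and> \<not> crl \<delta> (X \<inter> {p<..<a}))"

text \<open>Stepping repeatedly beyond the current maximum produces \<open>n + 1\<close> independent
  points, and one more step gives an \<open>a\<close> above all of them.\<close>

lemma unb_not_at_most_classes:
  assumes "unb \<tau> X" "X \<noteq> {}" "\<delta> < \<tau>"
  shows "\<exists>a\<in>X. \<not> at_most_classes \<delta> n (X \<inter> {..<a})"
proof -
  have "\<exists>S. indep \<delta> X S \<and> card S = Suc n"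
  proof (induction n)
    case 0
    obtain x where "x \<in> X"
      using assms(2) by blast
    then show ?case
      by (intro exI[of _ "{x}"]) (simp add: indep_def)
  next
    case (Suc n)
    then obtain S where S: "indep \<delta> X S" "card S = Suc n"
      by blast
    then have S': "finite S" "S \<noteq> {}" "S \<subseteq> X"
      unfolding indep_def by auto
    then have m: "Max S \<in> S" "\<And>u. u \<in> S \<Longrightarrow> u \<le> Max S"
      by simp_all
    then obtain a where "a \<in> X" "Max S < a" "\<not> crl \<delta> (X \<inter> {Max S<..<a})"
      using assms(1,3) S'(3) unfolding unb_def by blast
    then show ?case
      using indep_insert[OF S(1) m] S(2) by metis
  qed
  then obtain S where S: "indep \<delta> X S" "card S = Suc n"
    by blast
  then have S': "finite S" "S \<noteq> {}" "S \<subseteq> X"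
    unfolding indep_def by auto
  then have m: "Max S \<in> S" "\<And>u. u \<in> S \<Longrightarrow> u \<le> Max S"
    by simp_all
  then obtain a where a: "a \<in> X" "Max S < a"
    using assms(1,3) S'(3) unfolding unb_def by blast
  have "indep \<delta> (X \<inter> {..<a}) S"
    unfolding indep_lessThan_iff using S(1) m(2) a(2) by force
  then show ?thesis
    using S(2) a(1) unfolding at_most_classes_def by (metis Suc_n_not_le_n)
qed

lemma unb_not_crl: "unb \<tau> X \<Longrightarrow> X \<noteq> {} \<Longrightarrow> \<not> crl \<tau> X"
  unfolding crl_def
  using cr_imp_at_most_classes unb_not_at_most_classes at_most_classes_lessThan by metis

section \<open>Recognizing an order from its initial segments\<close>

text \<open>
  The initial segments of \<open>X\<close> alone do not determine how they are glued together.  The idea is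
  that the points \<open>a\<close> with \<open>D k (X \<inter> {..<a})\<close> form an initial segment that is respected by every
  isomorphism of larger initial segments.
\<close>

lemma oiso_by_invariant_cuts:
  assumes mono: "\<And>j k Z. j \<le> k \<Longrightarrow> D j Z \<Longrightarrow> D k Z"
    and iso: "\<And>k Z Z'. oiso Z Z' \<Longrightarrow> D k Z \<Longrightarrow> D k Z'"
    and init: "\<And>k Z b. D k Z \<Longrightarrow> D k (Z \<inter> {..<b})"
    and cover: "\<And>a. a \<in> X \<Longrightarrow> \<exists>k :: nat. D k (X \<inter> {..<a})"
    and proper: "\<And>k. \<exists>a\<in>X. \<not> D k (X \<inter> {..<a})"
    and YX: "\<And>y. y \<in> Y \<Longrightarrow> \<exists>a\<in>X. oiso (Y \<inter> {..<y}) (X \<inter> {..<a})"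
    and XY: "\<And>a. a \<in> X \<Longrightarrow> \<exists>y\<in>Y. oiso (Y \<inter> {..<y}) (X \<inter> {..<a})"
  shows "oiso Y X"
proof -
  define IX where "IX k = {a \<in> X. D k (X \<inter> {..<a})}" for k
  define IY where "IY k = {y \<in> Y. D k (Y \<inter> {..<y})}" for k
  have init': "D k (Z \<inter> {..<b})" if "D k (Z \<inter> {..<c})" "b \<le> c" for k Z b c
  proof -
    have "Z \<inter> {..<c} \<inter> {..<b} = Z \<inter> {..<b}"
      using that(2) by auto
    then show ?thesis
      using init[OF that(1), of b] by simp
  qed
  \<comment> \<open>A point \<open>a\<close> outside stage \<open>k\<close> has a counterpart
    \<open>y\<close>. Any isomorphism between their initial segments preserves the truth of
    \<open>D j\<close> at each point, so it maps stage \<open>j\<close> of \<open>Y\<close> onto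
    stage \<open>j\<close> of \<open>X\<close> for all \<open>j \<le> k\<close>.\<close>
  have "\<exists>f. strict_mono_on (IY k) f \<and> (\<forall>j\<le>k. f ` IY j = IX j)" for k
  proof -
    obtain a where a: "a \<in> X" "\<not> D k (X \<inter> {..<a})"
      using proper by blast
    obtain y where y: "y \<in> Y" "oiso (Y \<inter> {..<y}) (X \<inter> {..<a})"
      using XY[OF a(1)] by blast
    obtain f where f: "strict_mono_on (Y \<inter> {..<y}) f" "f ` (Y \<inter> {..<y}) = X \<inter> {..<a}"
      using y(2) unfolding oiso_def by blast
    have same: "D j (Y \<inter> {..<z}) \<longleftrightarrow> D j (X \<inter> {..<f z})" if z: "z \<in> Y" "z < y" for j z
    proof -
      have zin: "z \<in> Y \<inter> {..<y}"
        using z by simp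
      then have "f z < a"
        using f(2) by blast
      have "oiso (Y \<inter> {..<y} \<inter> {..<z}) (f ` (Y \<inter> {..<y} \<inter> {..<z}))"
        by (rule oiso_image[OF f(1)]) auto
      moreover have "Y \<inter> {..<y} \<inter> {..<z} = Y \<inter> {..<z}"
        using z(2) by auto
      moreover have "f ` (Y \<inter> {..<y} \<inter> {..<z}) = X \<inter> {..<f z}"
        unfolding image_Int_lessThan[OF f zin] using \<open>f z < a\<close> by auto
      ultimately have "oiso (Y \<inter> {..<z}) (X \<inter> {..<f z})"
        by simp
      then show ?thesis
        using iso oiso_sym by blast
    qed
    have notD: "\<not> D j (Y \<inter> {..<y})" "\<not> D j (X \<inter> {..<a})" if "j \<le> k" for j
      using a(2) iso[OF y(2)] mono[OF that] by blast+
    have IY: "z < y" if "z \<in> IY j" "j \<le> k" for z j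
      using that notD(1)[OF that(2)] init'[of j Y z y] unfolding IY_def by force
    have IX: "x < a" if "x \<in> IX j" "j \<le> k" for x j
      using that notD(2)[OF that(2)] init'[of j X x a] unfolding IX_def by force
    have "f ` IY j = IX j" if j: "j \<le> k" for j
    proof (intro equalityI subsetI)
      fix x assume "x \<in> f ` IY j"
      then obtain z where z: "z \<in> IY j" "x = f z"
        by blast
      then have "z \<in> Y" "z < y"
        using IY[OF _ j] unfolding IY_def by auto
      moreover have "f z \<in> X"
        using f(2) calculation by blast
      ultimately show "x \<in> IX j"
        using z same unfolding IX_def IY_def by blast
    next
      fix x assume x: "x \<in> IX j"
      then have "x \<in> X \<inter> {..<a}"
        using IX[OF _ j] unfolding IX_def by auto
      then obtain z where "z \<in> Y" "z < y" "x = f z"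
        using f(2) by blast
      then show "x \<in> f ` IY j"
        using x same unfolding IX_def IY_def by blast
    qed
    moreover have "IY k \<subseteq> Y \<inter> {..<y}"
      using IY unfolding IY_def by auto
    ultimately show ?thesis
      using monotone_on_subset[OF f(1)] by blast
  qed
  then obtain f where f: "\<And>k. strict_mono_on (IY k) (f k)" "\<And>k j. j \<le> k \<Longrightarrow> f k ` IY j = IX j"
    by metis
  define \<kappa> where "\<kappa> z = (LEAST k. z \<in> IY k)" for z
  \<comment> \<open>The maps for different stages need not agree, so each point is sent by the map
    of the stage in which it appears. Order between stages is kept because \<open>f k\<close> also
    respects all stages before \<open>k\<close>.\<close>
  define g where "g z = f (\<kappa> z) z" for z
  have IYmono: "IY j \<subseteq> IY k" if "j \<le> k" for j k
    using mono[OF that] unfolding IY_def by blast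
  have \<kappa>: "z \<in> IY (\<kappa> z)" if z: "z \<in> Y" for z
  proof -
    obtain a where "a \<in> X" "oiso (Y \<inter> {..<z}) (X \<inter> {..<a})"
      using YX[OF z] by blast
    then have "\<exists>k. z \<in> IY k"
      unfolding IY_def using z cover iso oiso_sym by blast
    then show ?thesis
      unfolding \<kappa>_def by (rule LeastI_ex)
  qed
  have \<kappa>_le: "\<kappa> z \<le> k" if "z \<in> IY k" for z k
    unfolding \<kappa>_def using that by (rule Least_le)
  have gX: "g z \<in> IX (\<kappa> z)" if "z \<in> Y" for z
    using f(2)[of "\<kappa> z" "\<kappa> z"] \<kappa>[OF that] unfolding g_def by blast
  have "strict_mono_on Y g"
  proof (rule monotone_onI)
    fix z z' assume z: "z \<in> Y" "z' \<in> Y" "z < z'"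
    have "z \<in> IY (\<kappa> z')"
      using \<kappa>[OF z(2)] z init'[of "\<kappa> z'" Y z' z] unfolding IY_def by simp
    then have le: "\<kappa> z \<le> \<kappa> z'"
      by (rule \<kappa>_le)
    show "g z < g z'"
    proof (cases "\<kappa> z = \<kappa> z'")
      case True
      then show ?thesis
        using \<kappa>[OF z(1)] \<kappa>[OF z(2)] f(1)[of "\<kappa> z'"] z(3) unfolding g_def by (simp add: monotone_on_def)
    next
      case False
      \<comment> \<open>Otherwise some \<open>w\<close> of the earlier stage has the same image as
        \<open>z'\<close>, hence equals \<open>z'\<close> by injectivity, against the minimality of
        \<open>\<kappa> z'\<close>.\<close>
      have "g z' \<notin> IX (\<kappa> z)"
      proof
        assume "g z' \<in> IX (\<kappa> z)"
        then obtain w where w: "w \<in> IY (\<kappa> z)" "f (\<kappa> z') w = f (\<kappa> z') z'"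
          using f(2)[OF le] unfolding g_def by (metis imageE)
        moreover have "w \<in> IY (\<kappa> z')"
          using w(1) IYmono[OF le] by blast
        ultimately have "w = z'"
          using strict_mono_on_imp_inj_on[OF f(1)[of "\<kappa> z'"]] \<kappa>[OF z(2)] by (simp add: inj_on_eq_iff)
        then show False
          using w(1) \<kappa>_le[of z' "\<kappa> z"] le False by simp
      qed
      then show ?thesis
        using gX[OF z(1)] gX[OF z(2)] init'[of "\<kappa> z" X "g z" "g z'"] unfolding IX_def by force
    qed
  qed
  moreover have "g ` Y = X"
  proof (intro equalityI subsetI)
    fix x assume "x \<in> g ` Y"
    then show "x \<in> X"
      using gX unfolding IX_def by blast
  next
    fix x assume "x \<in> X"
    then have ex: "\<exists>k. x \<in> IX k"
      using cover unfolding IX_def by blast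
    define k where "k = (LEAST k. x \<in> IX k)"
    have k: "x \<in> IX k" "\<And>j. j < k \<Longrightarrow> x \<notin> IX j"
      unfolding k_def using ex by (auto intro: LeastI_ex dest: not_less_Least)
    then obtain z where z: "z \<in> IY k" "x = f k z"
      using f(2)[of k k] by blast
    have "\<kappa> z = k"
    proof (rule ccontr)
      assume "\<kappa> z \<noteq> k"
      then have lt: "\<kappa> z < k"
        using \<kappa>_le[OF z(1)] by simp
      have "z \<in> IY (\<kappa> z)"
        using \<kappa> z(1) unfolding IY_def by blast
      then have "x \<in> IX (\<kappa> z)"
        using f(2)[of "\<kappa> z" k] lt z(2) by (metis imageI less_imp_le)
      then show False
        using k(2)[OF lt] by blast
    qed
    then show "x \<in> g ` Y"
      using z unfolding g_def IY_def by blast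
  qed
  ultimately show ?thesis
    unfolding oiso_def by blast
qed

text \<open>The invariant \<open>D k\<close> states that one of the conditions numbered
  \<open>0\<close> to \<open>k\<close> holds, where the conditions bound the number of
  \<delta>-classes by \<open>n\<close> and the pairs of \<delta> < \<tau> and \<open>n\<close> form
  one sequence, as \<tau> is countable. Smallness of the initial segments makes every point satisfy
  some condition; unboundedness makes each condition fail somewhere.\<close>

lemma oiso_by_initial_segments:
  assumes bound: "\<And>a. a \<in> X \<Longrightarrow> crl \<tau> (X \<inter> {..<a})" and unb: "unb \<tau> X"
    and YX: "\<And>y. y \<in> Y \<Longrightarrow> \<exists>a\<in>X. oiso (Y \<inter> {..<y}) (X \<inter> {..<a})"
    and XY: "\<And>a. a \<in> X \<Longrightarrow> \<exists>y\<in>Y. oiso (Y \<inter> {..<y}) (X \<inter> {..<a})"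
  shows "oiso Y X"
proof (cases "X = {}")
  case True
  then have "Y = {}"
    using YX by blast
  then show ?thesis
    using True oiso_refl by blast
next
  case False
  then have "0 < \<tau>"
    using bound crl_pos by blast
  define P where "P = {..<\<tau>} \<times> (UNIV :: nat set)"
  have "countable P" "P \<noteq> {}"
    unfolding P_def using countable_strict_lower_set \<open>0 < \<tau>\<close> by auto
  then have c: "range (from_nat_into P) = P"
    by (simp add: range_from_nat_into)
  define E where "E j = at_most_classes (fst (from_nat_into P j)) (snd (from_nat_into P j))" for j
  define D where "D k Z \<longleftrightarrow> (\<exists>j\<le>k. E j Z)" for k :: nat and Z
  have E_iso: "E j Z'" if "oiso Z Z'" "E j Z" for j Z Z'
    using that at_most_classes_oiso unfolding E_def by blast
  have E_less: "E j (Z \<inter> {..<b})" if "E j Z" for j Z b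
    using that at_most_classes_lessThan unfolding E_def by blast
  show ?thesis
  proof (rule oiso_by_invariant_cuts[of D])
    show "D k Z" if "j \<le> k" "D j Z" for j k Z
      using that unfolding D_def by (auto intro: order.trans)
    show "D k Z'" if "oiso Z Z'" "D k Z" for k Z Z'
      using that(2) E_iso[OF that(1)] unfolding D_def by blast
    show "D k (Z \<inter> {..<b})" if "D k Z" for k Z b
      using that E_less unfolding D_def by blast
    show "\<exists>k. D k (X \<inter> {..<a})" if a: "a \<in> X" for a
    proof -
      obtain \<delta> n where \<delta>: "\<delta> < \<tau>" "at_most_classes \<delta> n (X \<inter> {..<a})"
        using bound[OF a] cr_imp_at_most_classes unfolding crl_def by blast
      then have "(\<delta>, n) \<in> range (from_nat_into P)"
        unfolding c by (simp add: P_def)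
      then obtain j where "from_nat_into P j = (\<delta>, n)"
        by (metis rangeE)
      then have "E j (X \<inter> {..<a})"
        using \<delta>(2) unfolding E_def by simp
      then show ?thesis
        unfolding D_def by blast
    qed
    show "\<exists>a\<in>X. \<not> D k (X \<inter> {..<a})" for k
    proof -
      have "\<exists>a. a \<in> X \<and> \<not> E j (X \<inter> {..<a})" for j
      proof -
        have "from_nat_into P j \<in> P"
          using c by blast
        then have "fst (from_nat_into P j) < \<tau>"
          by (auto simp: P_def)
        then show ?thesis
          using unb_not_at_most_classes[OF unb False] unfolding E_def by blast
      qed
      then have "\<forall>j. \<exists>a. a \<in> X \<and> \<not> E j (X \<inter> {..<a})"
        by blast
      from choice[OF this] obtain h where h: "\<And>j. h j \<in> X" "\<And>j. \<not> E j (X \<inter> {..<h j})"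
        by blast
      \<comment> \<open>All conditions are inherited by initial segments, so the largest of the
        points refuting the conditions \<open>0\<close> to \<open>k\<close> refutes all of them at
        once.\<close>
      define a where "a = Max (h ` {..k})"
      have "a \<in> h ` {..k}"
        unfolding a_def by (intro Max_in) auto
      then have "a \<in> X"
        using h(1) by blast
      moreover have "\<not> D k (X \<inter> {..<a})"
      proof
        assume "D k (X \<inter> {..<a})"
        then obtain j where j: "j \<le> k" "E j (X \<inter> {..<a})"
          unfolding D_def by blast
        have "h j \<le> a"
          unfolding a_def using j(1) by simp
        then have "X \<inter> {..<a} \<inter> {..<h j} = X \<inter> {..<h j}"
          by auto
        then show False
          using h(2)[of j] E_less[OF j(2), of "h j"] by simp
      qed
      ultimately show ?thesis
        by blast
    qed
  qed (use YX XY in blast)+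
qed

text \<open>The candidate for a copy of \<open>X\<close> at the beginning of a model
  \<open>Y\<close>. It is read off from the types of initial segments, so no parameter has to name
  its end.\<close>

definition lft :: "real set \<Rightarrow> real set \<Rightarrow> real set" where
  "lft Y X = {z \<in> Y. \<exists>a\<in>X. oiso (Y \<inter> {..<z}) (X \<inter> {..<a})}"

lemma lft_initial:
  assumes "z \<in> lft Y X" "z' \<in> Y" "z' < z"
  shows "z' \<in> lft Y X"
proof -
  obtain a f where a: "a \<in> X" and f: "strict_mono_on (Y \<inter> {..<z}) f" "f ` (Y \<inter> {..<z}) = X \<inter> {..<a}"
    using assms(1) unfolding lft_def oiso_def by blast
  have z': "z' \<in> Y \<inter> {..<z}"
    using assms by simp
  then have fz': "f z' \<in> X" "f z' < a"
    using f(2) by blast+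
  have "oiso (Y \<inter> {..<z} \<inter> {..<z'}) (f ` (Y \<inter> {..<z} \<inter> {..<z'}))"
    by (rule oiso_image[OF f(1)]) auto
  moreover have "Y \<inter> {..<z} \<inter> {..<z'} = Y \<inter> {..<z'}"
    using assms(3) by auto
  moreover have "f ` (Y \<inter> {..<z} \<inter> {..<z'}) = X \<inter> {..<f z'}"
    unfolding image_Int_lessThan[OF f z'] using fz'(2) by auto
  ultimately have "oiso (Y \<inter> {..<z'}) (X \<inter> {..<f z'})"
    by simp
  then show ?thesis
    using assms(2) fz'(1) unfolding lft_def by blast
qed

lemma lft_subset: "lft Y X \<subseteq> Y"
  unfolding lft_def by blast

lemma lft_Int_lessThan: "z \<in> lft Y X \<Longrightarrow> lft Y X \<inter> {..<z} = Y \<inter> {..<z}"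
  using lft_subset by (auto intro: lft_initial)

text \<open>Below its own points \<open>lft Y X\<close> coincides with \<open>Y\<close>, so the
  criterion applies with \<open>lft Y X\<close> in place of \<open>Y\<close>.\<close>

lemma oiso_lft_unb:
  assumes "\<And>a. a \<in> X \<Longrightarrow> crl \<tau> (X \<inter> {..<a})" "unb \<tau> X"
    and XY: "\<And>a. a \<in> X \<Longrightarrow> \<exists>y\<in>Y. oiso (Y \<inter> {..<y}) (X \<inter> {..<a})"
  shows "oiso (lft Y X) X"
proof (rule oiso_by_initial_segments[OF assms(1,2)])
  show "\<exists>a\<in>X. oiso (lft Y X \<inter> {..<y}) (X \<inter> {..<a})" if "y \<in> lft Y X" for y
    unfolding lft_Int_lessThan[OF that] using that unfolding lft_def by blast
  show "\<exists>y\<in>lft Y X. oiso (lft Y X \<inter> {..<y}) (X \<inter> {..<a})" if "a \<in> X" for a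
  proof -
    obtain y where y: "y \<in> Y" "oiso (Y \<inter> {..<y}) (X \<inter> {..<a})"
      using XY[OF \<open>a \<in> X\<close>] by blast
    then have "y \<in> lft Y X"
      using \<open>a \<in> X\<close> unfolding lft_def by blast
    then show ?thesis
      using y(2) by (intro bexI[of _ y]) (simp_all add: lft_Int_lessThan)
  qed
qed

lemma oiso_Int_greaterThan_lessThan:
  assumes "strict_mono_on (Y \<inter> {..<y}) f" "f ` (Y \<inter> {..<y}) = X \<inter> {..<a}" "e \<in> Y" "e < y"
  shows "oiso (Y \<inter> {..<e}) (X \<inter> {..<f e})" "oiso (Y \<inter> {e<..} \<inter> {..<y}) (X \<inter> {f e<..<a})"
proof -
  have e: "e \<in> Y \<inter> {..<y}"
    using assms(3,4) by simp
  then have fe: "f e < a"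
    using assms(2) by blast
  have less: "f x < f e \<longleftrightarrow> x < e" "f e < f x \<longleftrightarrow> e < x" if "x \<in> Y \<inter> {..<y}" for x
    using strict_mono_on_less_iff[OF assms(1) that e] strict_mono_on_less_iff[OF assms(1) e that] by auto
  have "f ` (Y \<inter> {..<y} \<inter> {..<e}) = X \<inter> {..<f e}"
    unfolding image_Int_lessThan[OF assms(1,2) e] using fe by auto
  moreover have "Y \<inter> {..<y} \<inter> {..<e} = Y \<inter> {..<e}"
    using assms(4) by auto
  ultimately show "oiso (Y \<inter> {..<e}) (X \<inter> {..<f e})"
    using oiso_image[OF assms(1), of "Y \<inter> {..<y} \<inter> {..<e}"] by auto
  have "f ` (Y \<inter> {..<y} \<inter> {e<..}) = X \<inter> {..<a} \<inter> {f e<..}"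
    unfolding assms(2)[symmetric] using less by auto
  moreover have "X \<inter> {..<a} \<inter> {f e<..} = X \<inter> {f e<..<a}" "Y \<inter> {..<y} \<inter> {e<..} = Y \<inter> {e<..} \<inter> {..<y}"
    by auto
  ultimately show "oiso (Y \<inter> {e<..} \<inter> {..<y}) (X \<inter> {f e<..<a})"
    using oiso_image[OF assms(1), of "Y \<inter> {..<y} \<inter> {e<..}"] by auto
qed

lemma oiso_extend:
  assumes "oiso (Y \<inter> {..<e}) (X \<inter> {..<p})" "oiso Z W" "Z \<subseteq> {e<..}" "W \<subseteq> {p<..}"
  shows "oiso (Y \<inter> {..<e} \<union> ({e} \<union> Z)) (X \<inter> {..<p} \<union> ({p} \<union> W))"
proof (rule oiso_Un[OF assms(1) oiso_Un[OF oiso_singleton assms(2)]])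
qed (use assms(3,4) in fastforce)+

text \<open>
  The second condition excludes points of \<open>Z\<close> that lie above the end of the copy of \<open>X\<close>
  but still have an initial segment like those in \<open>X\<close>.  Taking \<open>crl \<delta>\<close> instead of all pairs
  keeps the complexity below \<open>2 * \<delta> + 2\<close>.
\<close>

definition tail_cond :: "cord \<Rightarrow> cord \<Rightarrow> real \<Rightarrow> real set \<Rightarrow> real set \<Rightarrow> bool" where
  "tail_cond \<tau> \<delta> p X Z \<longleftrightarrow>
     (\<forall>a\<in>X \<inter> {p<..}. \<exists>y\<in>Z. oiso (Z \<inter> {..<y}) (X \<inter> {p<..<a})) \<and>
     (\<forall>c\<in>{(c, c'). c \<in> X \<and> c' \<in> X \<and> crl \<delta> (X \<inter> {c<..<c'}) \<and> \<not> crl \<tau> (X \<inter> {c<..<c'})}.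
        \<not> (\<exists>y\<in>Z. oiso (Z \<inter> {..<y}) (X \<inter> {fst c<..<snd c})))"

text \<open>Above \<open>p\<close> the order is unbounded at level \<tau>, so the tail
  \<open>W\<close> is recovered as \<open>lft Z W\<close>. The danger is a point of
  \<open>lft Y X\<close> beyond this copy: the map matching its initial segment with one of
  \<open>X\<close> may send \<open>e\<close> not to \<open>p\<close> but to another point
  \<open>c\<close>. Counting classes limits this: there are \<open>card S\<close> independent points
  up to \<open>c\<close>, so by maximality the rest of the match is \<open>crl \<delta>\<close>,
  where \<open>tail_cond\<close> has a say.\<close>

lemma oiso_lft_tail:
  assumes p: "p \<in> X"
    and bound: "\<And>a. a \<in> X \<Longrightarrow> p < a \<Longrightarrow> crl \<tau> (X \<inter> {p<..<a})"
    and unb: "\<And>q \<gamma>. q \<in> X \<Longrightarrow> p \<le> q \<Longrightarrow> \<gamma> < \<tau> \<Longrightarrow> \<exists>a\<in>X. q < a \<and> \<not> crl \<gamma> (X \<inter> {q<..<a})"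
    and S: "indep \<delta> X S" "S \<subseteq> {..p}" "at_most_classes \<delta> (card S) X"
    and e: "e \<in> Y" "oiso (Y \<inter> {..<e}) (X \<inter> {..<p})" "tail_cond \<tau> \<delta> p X (Y \<inter> {e<..})"
  shows "oiso (lft Y X) X"
proof -
  define W where "W = X \<inter> {p<..}"
  define Z where "Z = Y \<inter> {e<..}"
  have W_less: "W \<inter> {..<a} = X \<inter> {p<..<a}" for a
    unfolding W_def by auto
  have "unb \<tau> W"
    unfolding unb_def
  proof (intro ballI allI impI)
    fix q \<gamma> assume q: "q \<in> W" "\<gamma> < \<tau>"
    then obtain a where a: "a \<in> X" "q < a" "\<not> crl \<gamma> (X \<inter> {q<..<a})"
      using unb[of q \<gamma>] unfolding W_def by auto
    moreover have "W \<inter> {q<..<a} = X \<inter> {q<..<a}"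
      using q(1) unfolding W_def by auto
    ultimately show "\<exists>a\<in>W. q < a \<and> \<not> crl \<gamma> (W \<inter> {q<..<a})"
      using q(1) unfolding W_def by (intro bexI[of _ a]) auto
  qed
  have "oiso (lft Z W) W"
  proof (rule oiso_lft_unb[OF _ \<open>unb \<tau> W\<close>])
    show "crl \<tau> (W \<inter> {..<a})" if "a \<in> W" for a
      unfolding W_less using that bound unfolding W_def by simp
    show "\<exists>y\<in>Z. oiso (Z \<inter> {..<y}) (W \<inter> {..<a})" if "a \<in> W" for a
      unfolding W_less using that e(3) unfolding W_def Z_def tail_cond_def by blast
  qed
  have X: "X = X \<inter> {..<p} \<union> ({p} \<union> W)"
    using p unfolding W_def by auto
  have e_lft: "e \<in> lft Y X"
    using e(1,2) p unfolding lft_def by blast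
  have "y \<in> lft Z W" if y: "y \<in> lft Y X" "e < y" for y
  proof (rule ccontr)
    assume notin: "y \<notin> lft Z W"
    obtain a f where a: "a \<in> X" and f: "strict_mono_on (Y \<inter> {..<y}) f" "f ` (Y \<inter> {..<y}) = X \<inter> {..<a}"
      using y(1) unfolding lft_def oiso_def by blast
    have yY: "y \<in> Y"
      using y(1) lft_subset by blast
    define c where "c = f e"
    have c: "c \<in> X" "c < a"
      using f(2) e(1) y(2) unfolding c_def by blast+
    have below: "oiso (Y \<inter> {..<e}) (X \<inter> {..<c})" and above: "oiso (Z \<inter> {..<y}) (X \<inter> {c<..<a})"
      using oiso_Int_greaterThan_lessThan[OF f e(1) y(2)] unfolding c_def Z_def by blast+
    have "oiso (X \<inter> {..<p} \<union> ({p} \<union> {})) (X \<inter> {..<c} \<union> ({c} \<union> {}))"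
      using oiso_extend[OF oiso_trans[OF oiso_sym[OF e(2)] below] oiso_refl[of "{}"]] by simp
    moreover have "X \<inter> {..<q} \<union> ({q} \<union> {}) = X \<inter> {..q}" if "q \<in> X" for q
      using that by auto
    \<comment> \<open>The part of \<open>Y\<close> below \<open>e\<close> is matched with both
      initial segments; composing the two matches carries the closed segment up to \<open>p\<close>
      to the one up to \<open>c\<close>.\<close>
    ultimately obtain g where g: "strict_mono_on (X \<inter> {..p}) g" "g ` (X \<inter> {..p}) = X \<inter> {..c}"
      using p c(1) unfolding oiso_def by metis
    have "indep \<delta> (X \<inter> {..p}) S"
    proof -
      have "X \<inter> {..p} \<inter> btw u v = X \<inter> btw u v" if "u \<le> p" "v \<le> p" for u v
        using that by auto
      then show ?thesis
        using S(1,2) unfolding indep_def by (metis Int_subset_iff atMost_iff subset_iff)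
    qed
    then have S': "indep \<delta> (X \<inter> {..c}) (g ` S)" "card (g ` S) = card S"
      using indep_image[OF g(1)] unfolding g(2) by blast+
    then have ind: "indep \<delta> X (g ` S)"
      by (elim indep_convex) auto
    have crl: "crl \<delta> (X \<inter> {c<..<a})"
    proof (rule ccontr)
      assume not: "\<not> crl \<delta> (X \<inter> {c<..<a})"
      have "S \<noteq> {}"
      proof
        assume "S = {}"
        moreover have "indep \<delta> X {p}"
          using p by (simp add: indep_def)
        ultimately show False
          using S(3) unfolding at_most_classes_def by fastforce
      qed
      moreover have "finite (g ` S)"
        using S(1) unfolding indep_def by simp
      ultimately have m: "Max (g ` S) \<in> g ` S" "\<And>u. u \<in> g ` S \<Longrightarrow> u \<le> Max (g ` S)"
        by simp_all
      have mc: "Max (g ` S) \<le> c"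
        using m(1) S'(1) unfolding indep_def by auto
      have "\<not> crl \<delta> (X \<inter> {Max (g ` S)<..<a})"
      proof
        assume "crl \<delta> (X \<inter> {Max (g ` S)<..<a})"
        then have "crl \<delta> (X \<inter> {c<..<a})"
          by (rule crl_subset) (use mc in auto)
        then show False
          using not by blast
      qed
      then have "indep \<delta> X (insert a (g ` S))" "card (insert a (g ` S)) = Suc (card (g ` S))"
        using indep_insert[OF ind m a(1)] mc c(2) by auto
      then show False
        using S(3) S'(2) unfolding at_most_classes_def by fastforce
    qed
    have "y \<in> Z"
      using yY y(2) unfolding Z_def by simp
    \<comment> \<open>If this failed, \<open>(c, a)\<close> would be a pair excluded by the second
      condition, with \<open>y\<close> as the excluded witness.\<close>
    then have "crl \<tau> (X \<inter> {c<..<a})"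
      using e(3) a c(1) crl above unfolding tail_cond_def Z_def[symmetric] by fastforce
    then have "crl \<tau> (Z \<inter> {..<y})"
      using crl_oiso[OF oiso_sym[OF above]] by blast
    moreover have "lft Z W \<subseteq> Z \<inter> {..<y}"
    proof
      fix w assume w: "w \<in> lft Z W"
      then have "w < y"
        using notin lft_initial[OF w \<open>y \<in> Z\<close>] by (metis linorder_neqE)
      then show "w \<in> Z \<inter> {..<y}"
        using w lft_subset by auto
    qed
    ultimately have "crl \<tau> W"
      using crl_subset crl_oiso[OF \<open>oiso (lft Z W) W\<close>] by blast
    \<comment> \<open>\<open>crl \<tau> W\<close> forces \<tau> to be positive, so unboundedness at
      level \<open>0\<close> yields a point above \<open>p\<close>.\<close>
    then have "W \<noteq> {}"
      using unb[OF p order_refl, of 0] crl_pos unfolding W_def by auto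
    then show False
      using unb_not_crl[OF \<open>unb \<tau> W\<close>] \<open>crl \<tau> W\<close> by blast
  qed
  moreover have "y \<in> lft Y X" if y: "y \<in> lft Z W" for y
  proof -
    obtain a where a: "a \<in> W" "oiso (Z \<inter> {..<y}) (W \<inter> {..<a})"
      using y unfolding lft_def by blast
    have yZ: "y \<in> Y" "e < y"
      using y lft_subset unfolding Z_def by auto
    have "oiso (Y \<inter> {..<e} \<union> ({e} \<union> Z \<inter> {..<y})) (X \<inter> {..<p} \<union> ({p} \<union> W \<inter> {..<a}))"
      by (rule oiso_extend[OF e(2) a(2)]) (auto simp: Z_def W_def)
    moreover have "Y \<inter> {..<e} \<union> ({e} \<union> Z \<inter> {..<y}) = Y \<inter> {..<y}"
      using e(1) yZ unfolding Z_def by auto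
    moreover have "X \<inter> {..<p} \<union> ({p} \<union> W \<inter> {..<a}) = X \<inter> {..<a}"
      using p a(1) unfolding W_def by auto
    ultimately show ?thesis
      using yZ(1) a(1) unfolding lft_def W_def by auto
  qed
  moreover have "lft Z W \<subseteq> {e<..}"
    using lft_subset[of Z W] unfolding Z_def by auto
  ultimately have lft: "lft Y X = Y \<inter> {..<e} \<union> ({e} \<union> lft Z W)"
    using e_lft lft_initial[OF e_lft] lft_subset[of Y X]
    by (intro equalityI subsetI) (auto simp: not_less le_less)
  have "oiso (Y \<inter> {..<e} \<union> ({e} \<union> lft Z W)) (X \<inter> {..<p} \<union> ({p} \<union> W))"
    by (rule oiso_extend[OF e(2) \<open>oiso (lft Z W) W\<close> \<open>lft Z W \<subseteq> {e<..}\<close>]) (auto simp: W_def)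
  then show ?thesis
    using lft X by simp
qed

lemma ex_max_indep:
  assumes "cr \<delta> X"
  shows "\<exists>S. indep \<delta> X S \<and> at_most_classes \<delta> (card S) X"
proof -
  obtain n where n: "at_most_classes \<delta> n X"
    using cr_imp_at_most_classes[OF assms] by blast
  define K where "K = card ` {S. indep \<delta> X S}"
  have "K \<subseteq> {..n}"
    using n unfolding K_def at_most_classes_def by auto
  then have fin: "finite K"
    using finite_subset by blast
  have "indep \<delta> X {}"
    by (simp add: indep_def)
  then have "K \<noteq> {}"
    unfolding K_def by blast
  then have "Max K \<in> K"
    using fin by (intro Max_in) auto
  then obtain S where S: "indep \<delta> X S" "card S = Max K"
    unfolding K_def by auto
  have "card T \<le> Max K" if "indep \<delta> X T" for T
    using that fin by (intro Max_ge) (auto simp: K_def)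
  then show ?thesis
    using S unfolding at_most_classes_def by metis
qed

text \<open>\<tau> is the least level at which some point \<open>p0\<close> has only small intervals
  to its right; minimality is the unboundedness below \<tau>. The part below \<open>p0\<close> has
  some rank \<delta>1 < \<beta>, and \<delta> is the maximum of \<delta>1 and \<tau>, so that
  \<delta> bounds the rank of all of \<open>A\<close> and a largest independent set exists.\<close>

lemma ex_tail:
  assumes bound: "\<And>a. a \<in> A \<Longrightarrow> crl \<beta> (A \<inter> {..<a})" and "\<not> unb \<beta> A"
  shows "\<exists>p \<tau> \<delta> S. p \<in> A \<and> \<tau> \<le> \<delta> \<and> \<delta> < \<beta> \<and>
    (\<forall>a\<in>A. p < a \<longrightarrow> crl \<tau> (A \<inter> {p<..<a})) \<and>
    (\<forall>q\<in>A. \<forall>\<gamma><\<tau>. p \<le> q \<longrightarrow> (\<exists>a\<in>A. q < a \<and> \<not> crl \<gamma> (A \<inter> {q<..<a}))) \<and>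
    indep \<delta> A S \<and> S \<subseteq> {..p} \<and> at_most_classes \<delta> (card S) A"
proof -
  define Q where "Q \<tau> \<longleftrightarrow> (\<exists>p\<in>A. \<forall>a\<in>A. p < a \<longrightarrow> crl \<tau> (A \<inter> {p<..<a}))" for \<tau>
  obtain \<tau>0 where \<tau>0: "\<tau>0 < \<beta>" "Q \<tau>0"
    using assms(2) unfolding unb_def Q_def by blast
  define \<tau> where "\<tau> = (LEAST \<tau>. Q \<tau>)"
  have "Q \<tau>"
    unfolding \<tau>_def using \<tau>0(2) by (rule LeastI)
  then obtain p0 where p0: "p0 \<in> A" "\<And>a. a \<in> A \<Longrightarrow> p0 < a \<Longrightarrow> crl \<tau> (A \<inter> {p0<..<a})"
    unfolding Q_def by blast
  have "\<tau> < \<beta>"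
    unfolding \<tau>_def using Least_le[of Q, OF \<tau>0(2)] \<tau>0(1) by (rule order.strict_trans1)
  have min: "\<exists>a\<in>A. q < a \<and> \<not> crl \<gamma> (A \<inter> {q<..<a})" if "q \<in> A" "\<gamma> < \<tau>" for q \<gamma>
    using not_less_Least[of \<gamma> Q] that unfolding \<tau>_def Q_def by blast
  obtain \<delta>1 where \<delta>1: "\<delta>1 < \<beta>" "cr \<delta>1 (A \<inter> {..<p0})"
    using bound[OF p0(1)] unfolding crl_def by blast
  define \<delta> where "\<delta> = max \<delta>1 \<tau>"
  have \<delta>: "\<tau> \<le> \<delta>" "\<delta>1 \<le> \<delta>" "\<delta> < \<beta>"
    unfolding \<delta>_def using \<delta>1(1) \<open>\<tau> < \<beta>\<close> by auto
  obtain F where F: "finite F" "F \<subseteq> A \<inter> {..<p0}"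
      "\<forall>u\<in>A \<inter> {..<p0}. \<exists>f\<in>F. u = f \<or> crl \<delta>1 (A \<inter> {..<p0} \<inter> btw u f)"
    using \<delta>1(2) unfolding cr_iff by blast
  have "\<exists>f\<in>insert p0 F. u = f \<or> crl \<delta> (A \<inter> btw u f)" if u: "u \<in> A" for u
  proof -
    consider "u < p0" | "u = p0" | "p0 < u"
      by linarith
    then show ?thesis
    proof cases
      case 1
      then obtain f where f: "f \<in> F" "u = f \<or> crl \<delta>1 (A \<inter> {..<p0} \<inter> btw u f)"
        using F(3) u by auto
      moreover have "f < p0"
        using f(1) F(2) by auto
      then have "A \<inter> {..<p0} \<inter> btw u f = A \<inter> btw u f"
        using 1 by auto
      ultimately show ?thesis
        using crl_mono[OF _ \<delta>(2)] by auto
    next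
      case 2
      then show ?thesis
        by blast
    next
      case 3
      then show ?thesis
        using crl_mono[OF p0(2)[OF u 3] \<delta>(1)] by (intro bexI[of _ p0]) auto
    qed
  qed
  then have "cr \<delta> A"
    unfolding cr_iff using F(1,2) p0(1) by (intro exI[of _ "insert p0 F"]) auto
  then obtain S where S: "indep \<delta> A S" "at_most_classes \<delta> (card S) A"
    using ex_max_indep by blast
  \<comment> \<open>Moving from \<open>p0\<close> up to \<open>p\<close> preserves the properties of
    the tail and places the whole independent set at or below \<open>p\<close>.\<close>
  define p where "p = Max (insert p0 S)"
  have fin: "finite S" "S \<subseteq> A"
    using S(1) unfolding indep_def by auto
  have "p \<in> insert p0 S"
    unfolding p_def using fin(1) by (intro Max_in) auto
  then have p: "p \<in> A"
    using p0(1) fin(2) by blast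
  have ge: "p0 \<le> p" "S \<subseteq> {..p}"
    unfolding p_def using fin(1) by auto
  have "crl \<tau> (A \<inter> {p<..<a})" if "a \<in> A" "p < a" for a
    by (rule crl_subset[OF p0(2)[OF that(1)]]) (use that(2) ge(1) in auto)
  then show ?thesis
    using p \<delta>(1,3) min S ge(2)
    by (intro exI[of _ p] exI[of _ \<tau>] exI[of _ \<delta>] exI[of _ S]) blast
qed

section \<open>Scott sentences\<close>

lemma double_pos_cord: "0 < b \<Longrightarrow> 0 < 2 * (b :: cord)"
proof -
  assume "0 < b"
  then have "2 * 0 + 1 + 1 \<le> 2 * b"
    using double_add_two_le_cord[of 0 b] by (simp add: add_two_cord)
  then have "2 * 0 + 1 < 2 * b"
    by (simp add: add_one_cord)
  then show ?thesis
    using zero_le_cord order.strict_trans1 by blast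
qed

lemma double_add_one_less_cord: "d < b \<Longrightarrow> 2 * d + 1 < 2 * (b :: cord)"
  using double_add_two_le_cord[of d b] by (simp add: add_two_cord add_one_cord)

lemma add_one_pos_cord: "0 < a + (1 :: cord)"
  using order.strict_trans1[OF zero_le_cord less_add_one_cord] .

text \<open>This puts an isomorphism type into the form to which \<open>dS_cut\<close>
  applies.\<close>

lemma oiso_cut_iff:
  assumes "b \<in> U"
  shows "oiso Y U \<longleftrightarrow>
    (\<exists>z\<in>Y. oiso (Y \<inter> {..<z}) (U \<inter> {..<b}) \<and> oiso (Y \<inter> {z<..}) (U \<inter> {b<..}))"
proof
  assume "oiso Y U"
  then obtain f where f: "strict_mono_on Y f" "f ` Y = U"
    unfolding oiso_def by blast
  then obtain z where z: "z \<in> Y" "f z = b"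
    using assms by blast
  have "f ` (Y \<inter> {z<..}) = U \<inter> {b<..}"
    unfolding f(2)[symmetric] using strict_mono_on_less_iff[OF f(1) z(1)] z(2) by auto
  moreover have "f ` (Y \<inter> {..<z}) = U \<inter> {..<b}"
    using image_Int_lessThan[OF f z(1)] z(2) by simp
  ultimately have "oiso (Y \<inter> {..<z}) (U \<inter> {..<b})" "oiso (Y \<inter> {z<..}) (U \<inter> {b<..})"
    using oiso_image[OF f(1), of "Y \<inter> {..<z}"] oiso_image[OF f(1), of "Y \<inter> {z<..}"] by auto
  then show "\<exists>z\<in>Y. oiso (Y \<inter> {..<z}) (U \<inter> {..<b}) \<and> oiso (Y \<inter> {z<..}) (U \<inter> {b<..})"
    using z(1) by blast
next
  assume "\<exists>z\<in>Y. oiso (Y \<inter> {..<z}) (U \<inter> {..<b}) \<and> oiso (Y \<inter> {z<..}) (U \<inter> {b<..})"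
  then obtain z where z: "z \<in> Y" "oiso (Y \<inter> {..<z}) (U \<inter> {..<b})" "oiso (Y \<inter> {z<..}) (U \<inter> {b<..})"
    by blast
  have cut: "V \<inter> {..<x} \<union> ({x} \<union> V \<inter> {x<..}) = V" if "x \<in> V" for V and x :: real
    using that by auto
  show "oiso Y U"
    using oiso_extend[OF z(2,3)] unfolding cut[OF z(1)] cut[OF assms] by auto
qed

text \<open>Every interval mentioned is \<open>crl \<delta>\<close> or \<open>crl \<tau>\<close>
  with \<tau> \<le> \<delta>, so the existence of a matching point is \<Sigma> of level
  \<open>2 * \<delta>\<close>. Both such a statement and its negation fit under a conjunction of
  level \<open>2 * \<delta> + 1\<close>.\<close>

lemma dP_tail_cond:
  assumes "countable A" "\<tau> \<le> \<delta>"
    and bound: "\<And>a. a \<in> A \<Longrightarrow> p < a \<Longrightarrow> crl \<tau> (A \<inter> {p<..<a})"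
    and IH: "\<And>\<gamma> Z. \<gamma> \<le> \<delta> \<Longrightarrow> Z \<subseteq> A \<Longrightarrow> crl \<gamma> Z \<Longrightarrow> dS (2 * \<gamma>) (\<lambda>Y. oiso Y Z)"
  shows "dP (2 * \<delta> + 1) (tail_cond \<tau> \<delta> p A)"
proof -
  have ex: "dS (2 * \<delta>) (\<lambda>Y. \<exists>y\<in>Y. oiso (Y \<inter> {..<y}) Z)" if Z: "Z \<subseteq> A" "crl \<gamma> Z" "\<gamma> \<le> \<delta>" for \<gamma> Z
  proof -
    have "0 < 2 * \<delta>"
      using crl_pos[OF Z(2)] Z(3) by (auto intro: double_pos_cord)
    then show ?thesis
      using dS_cut[OF dS_mono[OF IH[OF Z(3,1,2)] double_mono_cord[OF Z(3)]] dS_const[of _ True]] by simp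
  qed
  have 1: "dP (2 * \<delta> + 1) (\<lambda>Z. \<forall>a\<in>A \<inter> {p<..}. \<exists>y\<in>Z. oiso (Z \<inter> {..<y}) (A \<inter> {p<..<a}))"
  proof (rule dP_conj)
    show "countable (A \<inter> {p<..})"
      using assms(1) by simp
    show "dP (2 * \<delta> + 1) (\<lambda>Z. \<exists>y\<in>Z. oiso (Z \<inter> {..<y}) (A \<inter> {p<..<a}))" if a: "a \<in> A \<inter> {p<..}" for a
    proof -
      have "crl \<tau> (A \<inter> {p<..<a})"
        using bound a by simp
      then have "dS (2 * \<delta>) (\<lambda>Z. \<exists>y\<in>Z. oiso (Z \<inter> {..<y}) (A \<inter> {p<..<a}))"
        using ex[of "A \<inter> {p<..<a}" \<tau>] assms(2) by simp
      then show ?thesis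
        by (rule dS_imp_dP) (rule less_add_one_cord)
    qed
  qed (rule add_one_pos_cord)
  have 2: "dP (2 * \<delta> + 1) (\<lambda>Z. \<forall>c\<in>{(c, c'). c \<in> A \<and> c' \<in> A \<and> crl \<delta> (A \<inter> {c<..<c'}) \<and> \<not> crl \<tau> (A \<inter> {c<..<c'})}.
        \<not> (\<exists>y\<in>Z. oiso (Z \<inter> {..<y}) (A \<inter> {fst c<..<snd c})))"
  proof (rule dP_conj)
    have "{(c, c'). c \<in> A \<and> c' \<in> A \<and> crl \<delta> (A \<inter> {c<..<c'}) \<and> \<not> crl \<tau> (A \<inter> {c<..<c'})} \<subseteq> A \<times> A"
      by auto
    from countable_subset[OF this] show "countable {(c, c'). c \<in> A \<and> c' \<in> A \<and> crl \<delta> (A \<inter> {c<..<c'}) \<and> \<not> crl \<tau> (A \<inter> {c<..<c'})}"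
      using assms(1) by simp
    show "dP (2 * \<delta> + 1) (\<lambda>Z. \<not> (\<exists>y\<in>Z. oiso (Z \<inter> {..<y}) (A \<inter> {fst c<..<snd c})))"
      if "c \<in> {(c, c'). c \<in> A \<and> c' \<in> A \<and> crl \<delta> (A \<inter> {c<..<c'}) \<and> \<not> crl \<tau> (A \<inter> {c<..<c'})}" for c
    proof -
      have "dS (2 * \<delta>) (\<lambda>Z. \<exists>y\<in>Z. oiso (Z \<inter> {..<y}) (A \<inter> {fst c<..<snd c}))"
        using ex[of "A \<inter> {fst c<..<snd c}" \<delta>] that by auto
      then show ?thesis
        unfolding dP_not by (rule dS_mono) (rule less_imp_le[OF less_add_one_cord])
    qed
  qed (rule add_one_pos_cord)
  show ?thesis
    unfolding tail_cond_def[abs_def] by (rule dP_and[OF 1 2 add_one_pos_cord])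
qed

text \<open>\<open>Q\<close> need not describe \<open>A\<close> completely: it has to hold in the
  intended order \<open>U\<close> and to force the left part of each model to be a copy of
  \<open>A\<close>. In the unbounded case it lists the initial segments of \<open>A\<close>.
  Otherwise it asserts a point \<open>e\<close> in the role of \<open>p\<close>; since
  \<open>2 * \<delta> + 1 < 2 * \<beta>\<close>, this is even \<Sigma> of level
  \<open>2 * \<beta>\<close>.\<close>

lemma left_sentence:
  assumes A: "countable A" "\<And>a. a \<in> A \<Longrightarrow> crl \<beta> (A \<inter> {..<a})"
    and IH: "\<And>\<gamma> Z. \<gamma> \<le> \<beta> \<Longrightarrow> Z \<subseteq> A \<Longrightarrow> crl \<gamma> Z \<Longrightarrow> dS (2 * \<gamma>) (\<lambda>Y. oiso Y Z)"
  shows "\<exists>Q. dP (2 * \<beta> + 1) Q \<and> (\<forall>Y. Q Y \<longrightarrow> oiso (lft Y A) A) \<and>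
    (\<forall>U. A \<subseteq> U \<longrightarrow> (\<forall>a\<in>A. \<forall>u\<in>U. u < a \<longrightarrow> u \<in> A) \<longrightarrow> (\<forall>u\<in>U - A. crl \<beta> (U \<inter> {u<..})) \<longrightarrow>
      \<not> crl \<beta> U \<longrightarrow> Q U)"
proof -
  have initial: "U \<inter> {..<a} = A \<inter> {..<a}" if "A \<subseteq> U" "\<forall>a\<in>A. \<forall>u\<in>U. u < a \<longrightarrow> u \<in> A" "a \<in> A" for U a
    using that by auto
  have pos: "0 < 2 * \<beta>" if "a \<in> A" for a
    using crl_pos[OF A(2)[OF that]] by (rule double_pos_cord)
  have dS: "dS (2 * \<beta>) (\<lambda>Y. oiso Y (A \<inter> {..<a}))" if "a \<in> A" for a
    using IH[OF order_refl _ A(2)[OF that]] by blast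
  show ?thesis
  proof (cases "unb \<beta> A")
    case True
    define Q where "Q Y \<longleftrightarrow> (\<forall>a\<in>A. \<exists>y\<in>Y. oiso (Y \<inter> {..<y}) (A \<inter> {..<a}))" for Y
    have "dS (2 * \<beta>) (\<lambda>Y. \<exists>y\<in>Y. oiso (Y \<inter> {..<y}) (A \<inter> {..<a}))" if "a \<in> A" for a
      using dS_cut[OF dS[OF that] dS_const[of _ True] pos[OF that]] by simp
    then have "dP (2 * \<beta> + 1) (\<lambda>Y. \<exists>y\<in>Y. oiso (Y \<inter> {..<y}) (A \<inter> {..<a}))" if "a \<in> A" for a
      using dS_imp_dP[OF _ less_add_one_cord] that by simp
    then have "dP (2 * \<beta> + 1) Q"
      unfolding Q_def[abs_def] using A(1) by (intro dP_conj add_one_pos_cord)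
    moreover have "oiso (lft Y A) A" if "Q Y" for Y
      using oiso_lft_unb[OF A(2) True] that unfolding Q_def by blast
    moreover have "Q U" if "A \<subseteq> U" "\<forall>a\<in>A. \<forall>u\<in>U. u < a \<longrightarrow> u \<in> A" for U
      unfolding Q_def
    proof
      fix a assume "a \<in> A"
      then show "\<exists>y\<in>U. oiso (U \<inter> {..<y}) (A \<inter> {..<a})"
        using initial[OF that \<open>a \<in> A\<close>] that(1) oiso_refl by (intro bexI[of _ a]) auto
    qed
    ultimately show ?thesis
      by (intro exI[of _ Q]) simp
  next
    case False
    obtain p \<tau> \<delta> S where p: "p \<in> A" "\<tau> \<le> \<delta>" "\<delta> < \<beta>"
        "\<forall>a\<in>A. p < a \<longrightarrow> crl \<tau> (A \<inter> {p<..<a})"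
        "\<forall>q\<in>A. \<forall>\<gamma><\<tau>. p \<le> q \<longrightarrow> (\<exists>a\<in>A. q < a \<and> \<not> crl \<gamma> (A \<inter> {q<..<a}))"
        "indep \<delta> A S" "S \<subseteq> {..p}" "at_most_classes \<delta> (card S) A"
      using ex_tail[OF A(2) False] by metis
    define Q where "Q Y \<longleftrightarrow> (\<exists>e\<in>Y. oiso (Y \<inter> {..<e}) (A \<inter> {..<p}) \<and> tail_cond \<tau> \<delta> p A (Y \<inter> {e<..}))" for Y
    have "dP (2 * \<delta> + 1) (tail_cond \<tau> \<delta> p A)"
    proof (rule dP_tail_cond[OF A(1) p(2)])
      show "crl \<tau> (A \<inter> {p<..<a})" if "a \<in> A" "p < a" for a
        using p(4) that by blast
      show "dS (2 * \<gamma>) (\<lambda>Y. oiso Y Z)" if "\<gamma> \<le> \<delta>" "Z \<subseteq> A" "crl \<gamma> Z" for \<gamma> Z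
        using IH[of \<gamma> Z] that p(3) by auto
    qed
    then have "dS (2 * \<beta>) (tail_cond \<tau> \<delta> p A)"
      by (rule dP_imp_dS) (rule double_add_one_less_cord[OF p(3)])
    then have "dS (2 * \<beta>) Q"
      unfolding Q_def[abs_def] by (rule dS_cut[OF dS[OF p(1)] _ pos[OF p(1)]])
    then have "dP (2 * \<beta> + 1) Q"
      by (rule dS_imp_dP) (rule less_add_one_cord)
    moreover have "oiso (lft Y A) A" if Q: "Q Y" for Y
    proof -
      obtain e where e: "e \<in> Y" "oiso (Y \<inter> {..<e}) (A \<inter> {..<p})" "tail_cond \<tau> \<delta> p A (Y \<inter> {e<..})"
        using Q unfolding Q_def by blast
      show ?thesis
        by (rule oiso_lft_tail[OF p(1) _ _ p(6-8) e]) (use p(4,5) in blast)+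
    qed
    moreover have "Q U" if U: "A \<subseteq> U" "\<forall>a\<in>A. \<forall>u\<in>U. u < a \<longrightarrow> u \<in> A" "\<forall>u\<in>U - A. crl \<beta> (U \<inter> {u<..})" "\<not> crl \<beta> U" for U
    proof -
      have cut: "U \<inter> {..<a} = A \<inter> {..<a}" if "a \<in> A" for a
        using initial[OF U(1,2) that] .
      have btw: "U \<inter> {p<..} \<inter> {..<a} = A \<inter> {p<..<a}" if "a \<in> A" for a
      proof -
        have "U \<inter> {p<..} \<inter> {..<a} = U \<inter> {..<a} \<inter> {p<..}"
          by blast
        also have "\<dots> = A \<inter> {p<..<a}"
          unfolding cut[OF that] by auto
        finally show ?thesis .
      qed
      have "tail_cond \<tau> \<delta> p A (U \<inter> {p<..})"
        unfolding tail_cond_def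
      proof (intro conjI ballI notI)
        fix a assume "a \<in> A \<inter> {p<..}"
        then show "\<exists>y\<in>U \<inter> {p<..}. oiso (U \<inter> {p<..} \<inter> {..<y}) (A \<inter> {p<..<a})"
          using U(1) oiso_refl by (intro bexI[of _ a]) (auto simp: btw)
      next
        fix c assume "c \<in> {(c, c'). c \<in> A \<and> c' \<in> A \<and> crl \<delta> (A \<inter> {c<..<c'}) \<and> \<not> crl \<tau> (A \<inter> {c<..<c'})}"
          and "\<exists>y\<in>U \<inter> {p<..}. oiso (U \<inter> {p<..} \<inter> {..<y}) (A \<inter> {fst c<..<snd c})"
        then obtain y where c: "crl \<delta> (A \<inter> {fst c<..<snd c})" "\<not> crl \<tau> (A \<inter> {fst c<..<snd c})"
          and y: "y \<in> U" "p < y" "oiso (U \<inter> {p<..} \<inter> {..<y}) (A \<inter> {fst c<..<snd c})"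
          by auto
        \<comment> \<open>Inside \<open>A\<close> the interval from \<open>p\<close> to
          \<open>y\<close> would be \<open>crl \<tau>\<close>. Outside \<open>A\<close> the part
          above \<open>y\<close> is small, and the part below \<open>y\<close> is glued at
          \<open>p\<close> from two small pieces, so \<open>U\<close> itself would be small.\<close>
        have "y \<notin> A"
        proof
          assume "y \<in> A"
          then have "crl \<tau> (U \<inter> {p<..} \<inter> {..<y})"
            using p(4) y(2) by (simp add: btw)
          then show False
            using crl_oiso[OF y(3)] c(2) by blast
        qed
        then have "crl \<beta> (U \<inter> {y<..})"
          using U(3) y(1) by blast
        moreover have "crl \<beta> (U \<inter> {..<y})"
        proof (rule crl_cut[of _ _ p])
          have "U \<inter> {..<y} \<inter> {..<p} = A \<inter> {..<p}"
            unfolding cut[OF p(1), symmetric] using y(2) by auto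
          then show "crl \<beta> (U \<inter> {..<y} \<inter> {..<p})"
            using A(2)[OF p(1)] by simp
          have "crl \<beta> (U \<inter> {p<..} \<inter> {..<y})"
            using crl_mono[OF crl_oiso[OF oiso_sym[OF y(3)] c(1)]] p(3) by simp
          then show "crl \<beta> (U \<inter> {..<y} \<inter> {p<..})"
            by (rule crl_subset) auto
        qed
        ultimately show False
          using crl_cut U(4) by blast
      qed
      then show ?thesis
        unfolding Q_def using p(1) U(1) cut[OF p(1)] oiso_refl by (intro bexI[of _ p]) auto
    qed
    ultimately show ?thesis
      by (intro exI[of _ Q]) simp
  qed
qed

text \<open>Cutting at the finitely many representatives leaves pieces in which every point has a
  small part on one side, and these have \<Pi> descriptions by hypothesis. The existential
  quantifiers for the cuts raise the level to \<open>2 * \<delta> + 2\<close>.\<close>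

lemma dS_of_cr:
  assumes simple: "\<And>U. countable U \<Longrightarrow> (\<forall>u\<in>U. crl \<delta> (U \<inter> {..<u}) \<or> crl \<delta> (U \<inter> {u<..})) \<Longrightarrow>
      dP (2 * \<delta> + 1) (\<lambda>Y. oiso Y U)"
    and "countable U" "cr \<delta> U"
  shows "dS (2 * \<delta> + 2) (\<lambda>Y. oiso Y U)"
proof -
  have base: "dS (2 * \<delta> + 2) (\<lambda>Y. oiso Y U)"
    if "countable U" "\<forall>u\<in>U. crl \<delta> (U \<inter> {..<u}) \<or> crl \<delta> (U \<inter> {u<..})" for U
    unfolding add_two_cord by (rule dP_imp_dS[OF simple[OF that] less_add_one_cord])
  \<comment> \<open>The induction removes the largest representative \<open>b\<close>. The
    alternative of a small side is included because points related to \<open>b\<close> lose their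
    representative.\<close>
  have "dS (2 * \<delta> + 2) (\<lambda>Y. oiso Y U)"
    if "finite F" "countable U" "F \<subseteq> U"
      "\<forall>u\<in>U. (\<exists>f\<in>F. u = f \<or> crl \<delta> (U \<inter> btw u f)) \<or> crl \<delta> (U \<inter> {..<u}) \<or> crl \<delta> (U \<inter> {u<..})" for F U
    using that
  proof (induction F arbitrary: U rule: finite_linorder_max_induct)
    case empty
    then show ?case
      using base by simp
  next
    case (insert b F)
    then have b: "b \<in> U" and F: "F \<subseteq> {..<b}"
      by auto
    have "dS (2 * \<delta> + 2) (\<lambda>Y. oiso Y (U \<inter> {..<b}))"
    proof (rule insert.IH)
      show "\<forall>u\<in>U \<inter> {..<b}. (\<exists>f\<in>F. u = f \<or> crl \<delta> (U \<inter> {..<b} \<inter> btw u f)) \<or>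
          crl \<delta> (U \<inter> {..<b} \<inter> {..<u}) \<or> crl \<delta> (U \<inter> {..<b} \<inter> {u<..})"
      proof
        fix u assume u: "u \<in> U \<inter> {..<b}"
        then have "(\<exists>f\<in>insert b F. u = f \<or> crl \<delta> (U \<inter> btw u f)) \<or> crl \<delta> (U \<inter> {..<u}) \<or> crl \<delta> (U \<inter> {u<..})"
          using insert.prems(3) by blast
        then consider "crl \<delta> (U \<inter> btw u b)" | f where "f \<in> F" "u = f \<or> crl \<delta> (U \<inter> btw u f)"
          | "crl \<delta> (U \<inter> {..<u})" | "crl \<delta> (U \<inter> {u<..})"
          using u by auto
        then show "(\<exists>f\<in>F. u = f \<or> crl \<delta> (U \<inter> {..<b} \<inter> btw u f)) \<or>
            crl \<delta> (U \<inter> {..<b} \<inter> {..<u}) \<or> crl \<delta> (U \<inter> {..<b} \<inter> {u<..})"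
        proof cases
          case 1
          \<comment> \<open>In the part below \<open>b\<close>, the interval from \<open>u\<close>
            to \<open>b\<close> is everything to the right of \<open>u\<close>.\<close>
          then have "crl \<delta> (U \<inter> {..<b} \<inter> {u<..})"
            by (rule crl_subset) (use u in auto)
          then show ?thesis
            by blast
        next
          case 2
          then have "u = f \<or> crl \<delta> (U \<inter> {..<b} \<inter> btw u f)"
            using crl_subset[of \<delta> "U \<inter> btw u f" "U \<inter> {..<b} \<inter> btw u f"] by blast
          then show ?thesis
            using 2(1) by blast
        next
          case 3
          then have "crl \<delta> (U \<inter> {..<b} \<inter> {..<u})"
            by (rule crl_subset) auto
          then show ?thesis
            by blast
        next
          case 4
          then have "crl \<delta> (U \<inter> {..<b} \<inter> {u<..})"
            by (rule crl_subset) auto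
          then show ?thesis
            by blast
        qed
      qed
    qed (use insert.prems F in auto)
    moreover have "dS (2 * \<delta> + 2) (\<lambda>Y. oiso Y (U \<inter> {b<..}))"
    proof (rule base)
      show "\<forall>u\<in>U \<inter> {b<..}. crl \<delta> (U \<inter> {b<..} \<inter> {..<u}) \<or> crl \<delta> (U \<inter> {b<..} \<inter> {u<..})"
      proof
        fix u assume u: "u \<in> U \<inter> {b<..}"
        then have or: "(\<exists>f\<in>insert b F. u = f \<or> crl \<delta> (U \<inter> btw u f)) \<or> crl \<delta> (U \<inter> {..<u}) \<or> crl \<delta> (U \<inter> {u<..})"
          using insert.prems(3) by blast
        consider f where "f \<le> b" "crl \<delta> (U \<inter> btw u f)" | "crl \<delta> (U \<inter> {..<u})" | "crl \<delta> (U \<inter> {u<..})"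
        proof -
          have "f \<le> b" if "f \<in> insert b F" for f
            using that F by auto
          moreover have "u \<noteq> f" if "f \<le> b" for f
            using that u by auto
          moreover assume "\<And>f. f \<le> b \<Longrightarrow> crl \<delta> (U \<inter> btw u f) \<Longrightarrow> thesis"
            "crl \<delta> (U \<inter> {..<u}) \<Longrightarrow> thesis" "crl \<delta> (U \<inter> {u<..}) \<Longrightarrow> thesis"
          ultimately show thesis
            using or by blast
        qed
        then show "crl \<delta> (U \<inter> {b<..} \<inter> {..<u}) \<or> crl \<delta> (U \<inter> {b<..} \<inter> {u<..})"
        proof cases
          case 1
          \<comment> \<open>As \<open>f\<close> is at most \<open>b\<close>, the small interval
            between \<open>f\<close> and \<open>u\<close> contains all points between
            \<open>b\<close> and \<open>u\<close>.\<close>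
          then have "crl \<delta> (U \<inter> {b<..} \<inter> {..<u})"
            using u by (intro crl_subset[OF 1(2)]) auto
          then show ?thesis
            by blast
        next
          case 2
          then have "crl \<delta> (U \<inter> {b<..} \<inter> {..<u})"
            by (rule crl_subset) auto
          then show ?thesis
            by blast
        next
          case 3
          then have "crl \<delta> (U \<inter> {b<..} \<inter> {u<..})"
            by (rule crl_subset) auto
          then show ?thesis
            by blast
        qed
      qed
    qed (use insert.prems in auto)
    ultimately show ?case
      unfolding oiso_cut_iff[OF b] add_two_cord by (rule dS_cut[OF _ _ add_one_pos_cord])
  qed
  then show ?thesis
    using assms(2,3) unfolding cr_iff by blast
qed

lemma dP_of_simple:
  assumes "countable U" "\<forall>u\<in>U. crl \<beta> (U \<inter> {..<u}) \<or> crl \<beta> (U \<inter> {u<..})"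
  shows "dP (2 * \<beta> + 1) (\<lambda>Y. oiso Y U)"
  using assms
proof (induction \<beta> arbitrary: U rule: less_induct)
  case (less \<beta>)
  \<comment> \<open>Level \<open>2 * \<delta> + 2\<close> is at most \<open>2 * \<gamma>\<close>.
    Keeping \<open>2 * \<gamma>\<close> instead of weakening it to \<open>2 * \<beta>\<close> is
    what makes the tail condition cheap enough.\<close>
  have IH: "dS (2 * \<gamma>) (\<lambda>Y. oiso Y Z)" if Z: "\<gamma> \<le> \<beta>" "countable Z" "crl \<gamma> Z" for \<gamma> Z
  proof -
    obtain \<delta> where \<delta>: "\<delta> < \<gamma>" "cr \<delta> Z"
      using Z(3) unfolding crl_def by blast
    then have "\<delta> < \<beta>"
      using Z(1) by simp
    then have "dS (2 * \<delta> + 2) (\<lambda>Y. oiso Y Z)"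
      using dS_of_cr[OF less.IH Z(2) \<delta>(2)] by blast
    then show ?thesis
      by (rule dS_mono) (rule double_add_two_le_cord[OF \<delta>(1)])
  qed
  show ?case
  proof (cases "crl \<beta> U")
    case True
    show ?thesis
      by (rule dS_imp_dP[OF IH[OF order_refl less.prems(1) True] less_add_one_cord])
  next
    case False
    \<comment> \<open>As \<open>U\<close> is not small, no point is small on both sides, so
      \<open>A\<close> and \<open>B\<close> split \<open>U\<close> into an initial and a final
      part.\<close>
    define A where "A = {u \<in> U. crl \<beta> (U \<inter> {..<u})}"
    define B where "B = {u \<in> U. crl \<beta> (U \<inter> {u<..})}"
    have AB: "A \<subseteq> U" "B \<subseteq> U" "U = A \<union> B"
      using less.prems(2) unfolding A_def B_def by auto
    have ctbl: "countable A" "countable B"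
      using AB(1,2) countable_subset[OF _ less.prems(1)] by auto
    have disj: "u \<notin> B" if "u \<in> A" for u
      using that crl_cut False unfolding A_def B_def by blast
    have initA: "u \<in> A" if "a \<in> A" "u \<in> U" "u < a" for a u
    proof -
      have "crl \<beta> (U \<inter> {..<u})"
        by (rule crl_subset[of \<beta> "U \<inter> {..<a}"]) (use that(1,3) in \<open>auto simp: A_def\<close>)
      then show ?thesis
        using that(2) unfolding A_def by blast
    qed
    have finalB: "u \<in> B" if "b \<in> B" "u \<in> U" "b < u" for b u
    proof -
      have "crl \<beta> (U \<inter> {u<..})"
        by (rule crl_subset[of \<beta> "U \<inter> {b<..}"]) (use that(1,3) in \<open>auto simp: B_def\<close>)
      then show ?thesis
        using that(2) unfolding B_def by blast
    qed
    have A_less: "A \<inter> {..<a} = U \<inter> {..<a}" if "a \<in> A" for a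
      using initA[OF that] AB(1) by auto
    have B_greater: "B \<inter> {b<..} = U \<inter> {b<..}" if "b \<in> B" for b
      using finalB[OF that] AB(2) by auto
    have mirror: "uminus ` X \<inter> {..<- b} = uminus ` (X \<inter> {b<..})" for X and b :: real
      by auto
    have mirror': "uminus ` X \<inter> {- b<..} = uminus ` (X \<inter> {..<b})" for X and b :: real
      by auto
    have crlA: "crl \<beta> (A \<inter> {..<a})" if "a \<in> A" for a
      using that unfolding A_less[OF that] by (simp add: A_def)
    have crlB: "crl \<beta> (B \<inter> {b<..})" if "b \<in> B" for b
      using that unfolding B_greater[OF that] by (simp add: B_def)
    obtain Q where Q: "dP (2 * \<beta> + 1) Q" "\<forall>Y. Q Y \<longrightarrow> oiso (lft Y A) A"
        "\<forall>V. A \<subseteq> V \<longrightarrow> (\<forall>a\<in>A. \<forall>u\<in>V. u < a \<longrightarrow> u \<in> A) \<longrightarrow> (\<forall>u\<in>V - A. crl \<beta> (V \<inter> {u<..})) \<longrightarrow>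
          \<not> crl \<beta> V \<longrightarrow> Q V"
    proof (atomize_elim, rule left_sentence[OF ctbl(1) crlA])
      show "dS (2 * \<gamma>) (\<lambda>Y. oiso Y Z)" if "\<gamma> \<le> \<beta>" "Z \<subseteq> A" "crl \<gamma> Z" for \<gamma> Z
        using IH[OF that(1) countable_subset[OF that(2) ctbl(1)] that(3)] .
    qed
    obtain Q' where Q': "dP (2 * \<beta> + 1) Q'" "\<forall>Y. Q' Y \<longrightarrow> oiso (lft Y (uminus ` B)) (uminus ` B)"
        "\<forall>V. uminus ` B \<subseteq> V \<longrightarrow> (\<forall>a\<in>uminus ` B. \<forall>u\<in>V. u < a \<longrightarrow> u \<in> uminus ` B) \<longrightarrow>
          (\<forall>u\<in>V - uminus ` B. crl \<beta> (V \<inter> {u<..})) \<longrightarrow> \<not> crl \<beta> V \<longrightarrow> Q' V"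
    proof (atomize_elim, rule left_sentence)
      show cB: "countable (uminus ` B)"
        using ctbl(2) by simp
      show "crl \<beta> (uminus ` B \<inter> {..<a})" if "a \<in> uminus ` B" for a
        using that crlB by (auto simp: mirror crl_uminus_iff)
      show "dS (2 * \<gamma>) (\<lambda>Y. oiso Y Z)" if "\<gamma> \<le> \<beta>" "Z \<subseteq> uminus ` B" "crl \<gamma> Z" for \<gamma> Z
        using IH[OF that(1) countable_subset[OF that(2) cB] that(3)] .
    qed
    define L where "L Z \<longleftrightarrow> (\<exists>a\<in>A. oiso Z (A \<inter> {..<a}))" for Z
    define R where "R Z \<longleftrightarrow> (\<exists>b\<in>B. oiso Z (B \<inter> {b<..}))" for Z
    define \<Phi> where "\<Phi> Y \<longleftrightarrow> (Q Y \<and> Q' (uminus ` Y)) \<and> (\<forall>z\<in>Y. L (Y \<inter> {..<z}) \<or> R (Y \<inter> {z<..}))" for Y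
    have "dS (2 * \<beta>) L"
      unfolding L_def[abs_def]
    proof (rule dS_disj[OF ctbl(1)])
      show "dS (2 * \<beta>) (\<lambda>Y. oiso Y (A \<inter> {..<a}))" if "a \<in> A" for a
        using IH[OF order_refl _ crlA[OF that]] ctbl(1) by simp
      show "0 < 2 * \<beta>" if "A \<noteq> {}"
        using that crlA crl_pos double_pos_cord by blast
    qed
    then have dL: "dP (2 * \<beta> + 1) L"
      by (rule dS_imp_dP) (rule less_add_one_cord)
    have "dS (2 * \<beta>) R"
      unfolding R_def[abs_def]
    proof (rule dS_disj[OF ctbl(2)])
      show "dS (2 * \<beta>) (\<lambda>Y. oiso Y (B \<inter> {b<..}))" if "b \<in> B" for b
        using IH[OF order_refl _ crlB[OF that]] ctbl(2) by simp
      show "0 < 2 * \<beta>" if "B \<noteq> {}"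
        using that crlB crl_pos double_pos_cord by blast
    qed
    then have dR: "dP (2 * \<beta> + 1) R"
      by (rule dS_imp_dP) (rule less_add_one_cord)
    have d\<Phi>: "dP (2 * \<beta> + 1) \<Phi>"
      unfolding \<Phi>_def[abs_def]
      by (rule dP_and[OF dP_and[OF Q(1) dP_mirror[OF Q'(1)] add_one_pos_cord] dP_cut[OF dL dR add_one_pos_cord]
            add_one_pos_cord])
    have "\<Phi> U"
    proof -
      have "Q U"
        using Q(3)[rule_format, OF AB(1)] initA False AB(3) unfolding B_def by blast
      moreover have "Q' (uminus ` U)"
      proof (rule Q'(3)[rule_format])
        show "uminus ` B \<subseteq> uminus ` U"
          using AB(2) by blast
        show "u \<in> uminus ` B" if "a \<in> uminus ` B" "u \<in> uminus ` U" "u < a" for a u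
          using that finalB by auto
        show "crl \<beta> (uminus ` U \<inter> {u<..})" if u: "u \<in> uminus ` U - uminus ` B" for u
        proof -
          obtain w where w: "w \<in> U" "w \<notin> B" "u = - w"
            using u by auto
          then have "crl \<beta> (U \<inter> {..<w})"
            using AB(3) unfolding A_def by blast
          then show ?thesis
            unfolding w(3) mirror' crl_uminus_iff .
        qed
        show "\<not> crl \<beta> (uminus ` U)"
          using False unfolding crl_uminus_iff .
      qed
      moreover have "L (U \<inter> {..<z}) \<or> R (U \<inter> {z<..})" if "z \<in> U" for z
      proof (cases "z \<in> A")
        case True
        then show ?thesis
          unfolding L_def A_less[OF True, symmetric] using oiso_refl by blast
      next
        case False
        then have "z \<in> B"
          using that AB(3) by blast
        then show ?thesis
          unfolding R_def B_greater[OF \<open>z \<in> B\<close>, symmetric] using oiso_refl by blast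
      qed
      ultimately show ?thesis
        unfolding \<Phi>_def by blast
    qed
    have "oiso Y U" if Y: "\<Phi> Y" for Y
    proof -
      define Y1 where "Y1 = lft Y A"
      define Y2 where "Y2 = uminus ` lft (uminus ` Y) (uminus ` B)"
      have iso1: "oiso Y1 A"
        unfolding Y1_def using Y Q(2) unfolding \<Phi>_def by blast
      have "oiso (lft (uminus ` Y) (uminus ` B)) (uminus ` B)"
        using Y Q'(2) unfolding \<Phi>_def by blast
      from oiso_uminus[OF this] have iso2: "oiso Y2 B"
        unfolding Y2_def uminus_image_uminus .
      have Y2_iff: "z \<in> Y2 \<longleftrightarrow> z \<in> Y \<and> (\<exists>b\<in>B. oiso (Y \<inter> {z<..}) (B \<inter> {b<..}))" for z
      proof -
        have "z \<in> Y2 \<longleftrightarrow> - z \<in> lft (uminus ` Y) (uminus ` B)"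
          unfolding Y2_def by (metis image_iff minus_minus)
        also have "\<dots> \<longleftrightarrow> z \<in> Y \<and> (\<exists>b\<in>B. oiso (uminus ` Y \<inter> {..<- z}) (uminus ` B \<inter> {..<- b}))"
          unfolding lft_def by auto
        finally show ?thesis
          unfolding mirror oiso_uminus_iff .
      qed
      have sub: "Y1 \<subseteq> Y" "Y2 \<subseteq> Y"
        using lft_subset Y2_iff unfolding Y1_def by auto
      have Y12: "Y = Y1 \<union> Y2"
      proof
        show "Y \<subseteq> Y1 \<union> Y2"
          using Y unfolding \<Phi>_def L_def R_def Y1_def lft_def by (auto simp: Y2_iff)
      qed (use sub in blast)
      have crlAB: "crl \<beta> A \<Longrightarrow> crl \<beta> B \<Longrightarrow> False"
      proof -
        assume "crl \<beta> A" "crl \<beta> B"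
        moreover have "a < b" if "a \<in> A" "b \<in> B" for a b
          using that initA[of a b] disj AB(2) by (metis linorder_neqE subsetD)
        ultimately have "crl \<beta> (A \<union> B)"
          by (rule crl_Un)
        then show False
          using False AB(3) by simp
      qed
      \<comment> \<open>If \<open>y\<close> were not above \<open>x\<close>, it would belong to both
        parts and have small parts of \<open>Y\<close> on both sides. Then \<open>Y\<close> would be
        small, hence also \<open>Y1\<close> and \<open>Y2\<close> and their copies \<open>A\<close>
        and \<open>B\<close>, and finally \<open>U\<close>.\<close>
      have less: "x < y" if x: "x \<in> Y1" and y: "y \<in> Y2" for x y
      proof (rule ccontr)
        assume "\<not> x < y"
        then have "y \<in> Y1"
          using x y lft_initial[of x Y A y] sub(2) unfolding Y1_def by (metis linorder_neqE subsetD)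
        then obtain a where "a \<in> A" "oiso (Y \<inter> {..<y}) (A \<inter> {..<a})"
          unfolding Y1_def lft_def by blast
        then have 1: "crl \<beta> (Y \<inter> {..<y})"
          using crl_oiso[OF oiso_sym] crlA by blast
        obtain b where "b \<in> B" "oiso (Y \<inter> {y<..}) (B \<inter> {b<..})"
          using y unfolding Y2_iff by blast
        then have "crl \<beta> (Y \<inter> {y<..})"
          using crl_oiso[OF oiso_sym] crlB by blast
        then have "crl \<beta> Y"
          by (rule crl_cut[OF 1])
        then show False
          using crlAB crl_oiso[OF iso1] crl_oiso[OF iso2] crl_subset sub by blast
      qed
      have "a < b" if "a \<in> A" "b \<in> B" for a b
        using that initA[of a b] disj AB(2) by (metis linorder_neqE subsetD)
      then have "oiso (Y1 \<union> Y2) (A \<union> B)"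
        using oiso_Un[OF iso1 iso2] less by blast
      then show ?thesis
        using Y12 AB(3) by simp
    qed
    \<comment> \<open>The converse needs no direct check: \<Phi> is definable, hence invariant, and
      holds in \<open>U\<close>.\<close>
    moreover have "\<Phi> Y" if "oiso Y U" for Y
      using dP_oiso_cong[OF d\<Phi> that] \<open>\<Phi> U\<close> by blast
    ultimately have "\<Phi> = (\<lambda>Y. oiso Y U)"
      by blast
    then show ?thesis
      using d\<Phi> by simp
  qed
qed

section \<open>Hausdorff rank and embedding into the reals\<close>

definition strict_embedding :: "('a \<Rightarrow> real) \<Rightarrow> 'a rel \<Rightarrow> bool" where
  "strict_embedding f R \<longleftrightarrow> (\<forall>x y. (x, y) \<in> R \<longrightarrow> x \<noteq> y \<longrightarrow> f x < f y)"

lemma strict_embeddingD: "strict_embedding f R \<Longrightarrow> (x, y) \<in> R \<Longrightarrow> x \<noteq> y \<Longrightarrow> f x < f y"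
  unfolding strict_embedding_def by blast

lemma strict_embedding_mono: "strict_embedding f R \<Longrightarrow> S \<subseteq> R \<Longrightarrow> strict_embedding f S"
  unfolding strict_embedding_def by blast

text \<open>A point is sent to the sum of \<open>(1/2) ^ i\<close> over the numbers \<open>i\<close>
  of its strict predecessors. Passing from \<open>x\<close> to a larger point keeps these terms and
  gains the term of \<open>x\<close> itself.\<close>

lemma linear_order_embeds_real:
  fixes R :: "'a rel"
  assumes "Linear_order R" "countable (Field R)"
    shows "\<exists>f. strict_embedding f R"
proof -
  have trans: "trans R" and antisym: "antisym R"
    using assms(1) by (auto simp: linear_order_on_def partial_order_on_def preorder_on_def)
  define h where "h = to_nat_on (Field R)"
  have h: "inj_on h (Field R)"
    unfolding h_def using assms(2) by (rule inj_on_to_nat_on)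
  define t :: "'a \<Rightarrow> nat \<Rightarrow> real"
    where "t x i = (if \<exists>z\<in>Field R. h z = i \<and> (z, x) \<in> R \<and> z \<noteq> x then (1/2) ^ i else 0)" for x i
  have summable: "summable (t x)" for x
    by (rule summable_comparison_test'[of "\<lambda>i. (1/2) ^ i" 0]) (auto simp: t_def intro: summable_geometric)
  have "suminf (t x) < suminf (t y)" if xy: "(x, y) \<in> R" "x \<noteq> y" for x y
  proof -
    have x: "x \<in> Field R"
      using xy(1) by (auto simp: Field_def)
    have le: "t x i \<le> t y i" for i
    proof (cases "\<exists>z\<in>Field R. h z = i \<and> (z, x) \<in> R \<and> z \<noteq> x")
      case True
      then obtain z where z: "z \<in> Field R" "h z = i" "(z, x) \<in> R" "z \<noteq> x"
        by blast
      then have "(z, y) \<in> R" "z \<noteq> y"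
        using transD[OF trans z(3) xy(1)] antisymD[OF antisym xy(1)] by auto
      then show ?thesis
        using z by (auto simp: t_def)
    next
      case False
      then have "t x i = 0"
        unfolding t_def by (rule if_not_P)
      then show ?thesis
        by (simp add: t_def)
    qed
    have "t x (h x) = 0"
      using inj_onD[OF h] x by (auto simp: t_def)
    moreover have "t y (h x) = (1/2) ^ h x"
      using x xy by (auto simp: t_def)
    ultimately have "0 < t y (h x) - t x (h x)"
      by simp
    then have "0 < (\<Sum>i. t y i - t x i)"
      using suminf_pos2[OF summable_diff[OF summable summable], of y x "h x"] le by simp
    then show ?thesis
      using suminf_diff[OF summable summable, of y x] by simp
  qed
  then show ?thesis
    unfolding strict_embedding_def by (intro exI[of _ "\<lambda>x. suminf (t x)"]) blast
qed

lemma structure_iso_embedding: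
  assumes R: "Linear_order R" and "strict_embedding f R"
  shows "structure_iso f (Field R) R (f ` Field R) LE"
proof -
  note f = strict_embeddingD[OF assms(2)]
  have total: "(x, y) \<in> R \<or> (y, x) \<in> R" if "x \<in> Field R" "y \<in> Field R" for x y
    using R that
    by (cases "x = y") (auto simp: linear_order_on_def partial_order_on_def preorder_on_def total_on_def refl_on_def)
  have "inj_on f (Field R)"
    by (rule inj_onI) (metis f less_irrefl total)
  moreover have "(x, y) \<in> R \<longleftrightarrow> f x \<le> f y" if "x \<in> Field R" "y \<in> Field R" for x y
    using total[OF that] total[OF that(1,1)] f by (metis less_imp_le linorder_not_le order_refl)
  ultimately show ?thesis
    by (simp add: structure_iso_def bij_betw_def LE_def)
qed

section \<open>From Hausdorff rank to condensation rank\<close>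

lemma cr_UN_separated:
  assumes "finite I" "\<And>i. i \<in> I \<Longrightarrow> cr \<delta> (M i)"
    and sep: "\<And>i j. i \<in> I \<Longrightarrow> j \<in> I \<Longrightarrow> i \<noteq> j \<Longrightarrow> (\<forall>x\<in>M i. \<forall>y\<in>M j. x < y) \<or> (\<forall>x\<in>M i. \<forall>y\<in>M j. y < x)"
  shows "cr \<delta> (\<Union>i\<in>I. M i)"
proof (rule cr_UN[OF assms(1,2)])
  fix i x y assume i: "i \<in> I" "x \<in> M i" "y \<in> M i"
  show "(\<Union>i\<in>I. M i) \<inter> btw x y \<subseteq> M i"
  proof
    fix z assume "z \<in> (\<Union>i\<in>I. M i) \<inter> btw x y"
    then obtain j where j: "j \<in> I" "z \<in> M j" "min x y < z" "z < max x y"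
      by auto
    show "z \<in> M i"
    proof (cases "i = j")
      case False
      then have "x < z \<and> y < z \<or> z < x \<and> z < y"
        using sep[OF i(1) j(1)] i(2,3) j(2) by blast
      then show ?thesis
        using j(3,4) by auto
    qed (use j in simp)
  qed
qed

lemma crl_UN_separated:
  assumes "finite I" "\<And>i. i \<in> I \<Longrightarrow> crl \<delta> (M i)" "0 < \<delta>"
    and sep: "\<And>i j. i \<in> I \<Longrightarrow> j \<in> I \<Longrightarrow> i \<noteq> j \<Longrightarrow> (\<forall>x\<in>M i. \<forall>y\<in>M j. x < y) \<or> (\<forall>x\<in>M i. \<forall>y\<in>M j. y < x)"
  shows "crl \<delta> (\<Union>i\<in>I. M i)"
proof -
  have "\<forall>i\<in>I. \<exists>d. d < \<delta> \<and> cr d (M i)"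
    using assms(2) unfolding crl_def by blast
  from bchoice[OF this] obtain d where d: "\<forall>i\<in>I. d i < \<delta> \<and> cr (d i) (M i)"
    by blast
  \<comment> \<open>Inserting \<open>0\<close> gives the maximum a meaning for empty
    \<open>I\<close>; it remains below \<delta> because \<delta> is positive.\<close>
  define D where "D = Max (insert 0 (d ` I))"
  have "D < \<delta>"
    unfolding D_def using assms(1,3) d by (subst Max_less_iff) auto
  moreover have "cr D (M i)" if "i \<in> I" for i
  proof -
    have "d i \<le> D"
      unfolding D_def using assms(1) that by (intro Max_ge) auto
    then show ?thesis
      using d that cr_mono by blast
  qed
  then have "cr D (\<Union>i\<in>I. M i)"
    by (rule cr_UN_separated[OF assms(1) _ sep])
  ultimately show ?thesis
    by (rule cr_imp_crl[rotated])
qed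

lemma is_sum_less:
  assumes "is_sum I M K" "strict_embedding f K" "(i, j) \<in> I" "i \<noteq> j"
  shows "\<forall>u\<in>f ` Field (M i). \<forall>v\<in>f ` Field (M j). u < v"
proof -
  have ij: "i \<in> Field I" "j \<in> Field I"
    using assms(3) by (auto simp: Field_def)
  have "f x < f y" if "x \<in> Field (M i)" "y \<in> Field (M j)" for x y
  proof (rule strict_embeddingD[OF assms(2)])
    show "(x, y) \<in> K"
      using assms(1,3,4) that unfolding is_sum_def by blast
    show "x \<noteq> y"
      using assms(1,4) ij that unfolding is_sum_def disjoint_family_on_def by blast
  qed
  then show ?thesis
    by blast
qed

lemma is_sum_summand:
  assumes "is_sum I M K" "strict_embedding f K" "i \<in> Field I"
  shows "strict_embedding f (M i)"
  by (rule strict_embedding_mono[OF assms(2)]) (use assms(1,3) in \<open>auto simp: is_sum_def\<close>)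

text \<open>In a \<zeta>-sum the interval between two points meets only finitely many summands, so
  all points are in one class and a single representative suffices. A finite sum collects the
  representatives of its summands.\<close>

lemma HR_imp_cr:
  assumes "HR \<delta> K" "strict_embedding f K"
  shows "cr \<delta> (f ` Field K)"
  using assms
proof (induction rule: HR.induct)
  case (HR_finite K)
  then show ?case
    by (intro cr_finite) simp
next
  case (HR_zeta_sum \<alpha> M K)
  have fld: "Field zetaLeq = UNIV"
    by (auto simp: zetaLeq_def Field_def)
  define N where "N i = f ` Field (M i)" for i
  have X: "f ` Field K = (\<Union>i. N i)"
    unfolding Field_is_sum[OF HR_zeta_sum.hyps(2)] fld N_def by blast
  have less: "x < y" if "i < j" "x \<in> N i" "y \<in> N j" for i j x y
    using is_sum_less[OF HR_zeta_sum.hyps(2) HR_zeta_sum.prems, of i j] that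
    unfolding N_def zetaLeq_def by auto
  have "crl \<alpha> (N i)" for i
    using HR_zeta_sum.IH is_sum_summand[OF HR_zeta_sum.hyps(2) HR_zeta_sum.prems, of i]
    unfolding N_def fld crl_def by blast
  then have fin: "crl \<alpha> (\<Union>i\<in>{a..b}. N i)" for a b
    using less HR_zeta_sum.hyps(1) by (intro crl_UN_separated) (auto simp: neq_iff)
  show ?case
  proof (cases "f ` Field K = {}")
    case True
    show ?thesis
      unfolding True by (rule cr_finite) simp
  next
    case False
    then obtain c i where c: "c \<in> N i"
      unfolding X by blast
    have "u = c \<or> crl \<alpha> (f ` Field K \<inter> btw u c)" if u: "u \<in> N j" for u j
    proof -
      have "f ` Field K \<inter> btw u c \<subseteq> (\<Union>k\<in>{min i j..max i j}. N k)"
      proof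
        fix x assume "x \<in> f ` Field K \<inter> btw u c"
        then obtain k where k: "x \<in> N k" "min u c < x" "x < max u c"
          unfolding X by auto
        have "min i j \<le> k"
        proof (rule ccontr)
          assume "\<not> min i j \<le> k"
          then have "x < c" "x < u"
            using less[OF _ k(1) c] less[OF _ k(1) u] by auto
          then show False
            using k(2) by auto
        qed
        moreover have "k \<le> max i j"
        proof (rule ccontr)
          assume "\<not> k \<le> max i j"
          then have "c < x" "u < x"
            using less[OF _ c k(1)] less[OF _ u k(1)] by auto
          then show False
            using k(3) by auto
        qed
        ultimately show "x \<in> (\<Union>k\<in>{min i j..max i j}. N k)"
          using k(1) by auto
      qed
      then show ?thesis
        using crl_subset[OF fin] by blast
    qed
    then show ?thesis
      unfolding cr_iff using c by (intro exI[of _ "{c}"]) (auto simp: X)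
  qed
next
  case (HR_finite_sum \<alpha> n M K)
  define N where "N i = f ` Field (M i)" for i
  have fld: "Field (natLeq_on n) = {..<n}"
    by (simp add: Field_natLeq_on lessThan_def)
  have X: "f ` Field K = (\<Union>i\<in>{..<n}. N i)"
    unfolding Field_is_sum[OF HR_finite_sum.hyps(2)] fld N_def by blast
  have less: "\<forall>x\<in>N i. \<forall>y\<in>N j. x < y" if "i < j" "j < n" for i j
    using is_sum_less[OF HR_finite_sum.hyps(2) HR_finite_sum.prems, of i j] that unfolding N_def by auto
  have "cr \<alpha> (N i)" if "i < n" for i
    using HR_finite_sum.IH is_sum_summand[OF HR_finite_sum.hyps(2) HR_finite_sum.prems, of i] that
    unfolding N_def fld by blast
  then show ?case
    unfolding X
  proof (intro cr_UN_separated)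
    fix i j assume "i \<in> {..<n}" "j \<in> {..<n}" "i \<noteq> j"
    then consider "i < j" "j < n" | "j < i" "i < n"
      by fastforce
    then show "(\<forall>x\<in>N i. \<forall>y\<in>N j. x < y) \<or> (\<forall>x\<in>N i. \<forall>y\<in>N j. y < x)"
      by cases (use less in blast)+
  qed auto
qed

lemma has_hausdorff_rank_unique:
  "has_hausdorff_rank K \<alpha> \<Longrightarrow> has_hausdorff_rank K \<beta> \<Longrightarrow> \<alpha> = \<beta>"
  unfolding has_hausdorff_rank_def by (metis linorder_neqE)

text \<open>Below a point of \<open>M i\<close> lie only points of \<open>M 0\<close> to
  \<open>M i\<close>, as all of \<open>Y\<close> is above \<open>X\<close>. Above a point of
  \<open>N j\<close> lie only points of \<open>N 0\<close> to \<open>N j\<close>, as the second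
  sequence runs downwards. In both cases this is a finite sum of small orders.\<close>

lemma simple_order_crl:
  assumes "simple_order L" "has_hausdorff_rank L \<alpha>"
    and f: "strict_embedding f L"
  shows "\<forall>u\<in>f ` Field L. crl \<alpha> (f ` Field L \<inter> {..<u}) \<or> crl \<alpha> (f ` Field L \<inter> {u<..})"
proof -
  obtain \<alpha>' M N X Y \<rho> \<sigma> where \<alpha>': "has_hausdorff_rank L \<alpha>'"
    and X: "is_sum natLeq M X" and Y: "is_sum (natLeq\<inverse>) N Y" and L: "is_sum2 X Y L"
    and M: "\<forall>i. has_hausdorff_rank (M i) (\<rho> i) \<and> \<rho> i < \<alpha>'"
    and N: "\<forall>j. has_hausdorff_rank (N j) (\<sigma> j) \<and> \<sigma> j < \<alpha>'"
    using assms(1) unfolding simple_order_def by blast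
  have "\<alpha>' = \<alpha>"
    using has_hausdorff_rank_unique[OF \<alpha>' assms(2)] .
  have pos: "0 < \<alpha>"
    using M order.strict_trans1[OF zero_le_cord] unfolding \<open>\<alpha>' = \<alpha>\<close> by blast
  have fX: "strict_embedding f X" and fY: "strict_embedding f Y"
    by (rule strict_embedding_mono[OF f]; use L in \<open>auto simp: is_sum2_def\<close>)+
  have fXY: "f x < f y" if "x \<in> Field X" "y \<in> Field Y" for x y
    using strict_embeddingD[OF f, of x y] that L unfolding is_sum2_def by blast
  have fld: "Field natLeq = UNIV" "Field (natLeq\<inverse>) = UNIV"
    by (simp_all add: Field_natLeq)
  have FX: "Field X = (\<Union>i. Field (M i))" and FY: "Field Y = (\<Union>i. Field (N i))"
    using Field_is_sum[OF X] Field_is_sum[OF Y] unfolding fld by auto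
  have FL: "z \<in> Field X \<or> z \<in> Field Y" if "z \<in> Field L" for z
    using that L unfolding is_sum2_def Field_def by auto
  have Mless: "\<forall>u\<in>f ` Field (M i). \<forall>v\<in>f ` Field (M j). u < v" if "i < j" for i j
    by (rule is_sum_less[OF X fX]) (use that in \<open>auto simp: natLeq_def\<close>)
  have Nless: "\<forall>u\<in>f ` Field (N i). \<forall>v\<in>f ` Field (N j). u < v" if "j < i" for i j
    by (rule is_sum_less[OF Y fY]) (use that in \<open>auto simp: natLeq_def\<close>)
  have Mcrl: "crl \<alpha> (f ` Field (M i))" for i
  proof (rule cr_imp_crl)
    show "cr (\<rho> i) (f ` Field (M i))"
      using HR_imp_cr is_sum_summand[OF X fX] M fld unfolding has_hausdorff_rank_def by blast
    show "\<rho> i < \<alpha>"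
      using M unfolding \<open>\<alpha>' = \<alpha>\<close> by blast
  qed
  have Ncrl: "crl \<alpha> (f ` Field (N i))" for i
  proof (rule cr_imp_crl)
    show "cr (\<sigma> i) (f ` Field (N i))"
      using HR_imp_cr is_sum_summand[OF Y fY] N fld unfolding has_hausdorff_rank_def by blast
    show "\<sigma> i < \<alpha>"
      using N unfolding \<open>\<alpha>' = \<alpha>\<close> by blast
  qed
  show ?thesis
  proof
    fix u assume "u \<in> f ` Field L"
    then obtain w where w: "w \<in> Field L" "u = f w"
      by blast
    consider i where "w \<in> Field (M i)" | j where "w \<in> Field (N j)"
      using FL[OF w(1)] FX FY by blast
    then show "crl \<alpha> (f ` Field L \<inter> {..<u}) \<or> crl \<alpha> (f ` Field L \<inter> {u<..})"
    proof cases
      case 1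
      have "crl \<alpha> (\<Union>k\<in>{..i}. f ` Field (M k))"
        using Mcrl pos Mless by (intro crl_UN_separated) (auto simp: neq_iff)
      moreover have "f ` Field L \<inter> {..<u} \<subseteq> (\<Union>k\<in>{..i}. f ` Field (M k))"
      proof
        fix v assume "v \<in> f ` Field L \<inter> {..<u}"
        then obtain z where z: "z \<in> Field L" "v = f z" "f z < f w"
          using w(2) by auto
        have "z \<notin> Field Y"
          using fXY[of w z] 1 FX z(3) by fastforce
        then obtain k where k: "z \<in> Field (M k)"
          using FL[OF z(1)] FX by blast
        have "k \<le> i"
          using Mless[of i k] 1 k z(3) by (meson imageI leI less_asym)
        then show "v \<in> (\<Union>k\<in>{..i}. f ` Field (M k))"
          using k z(2) by blast
      qed
      ultimately show ?thesis
        using crl_subset by blast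
    next
      case 2
      have "crl \<alpha> (\<Union>k\<in>{..j}. f ` Field (N k))"
        using Ncrl pos Nless by (intro crl_UN_separated) (auto simp: neq_iff)
      moreover have "f ` Field L \<inter> {u<..} \<subseteq> (\<Union>k\<in>{..j}. f ` Field (N k))"
      proof
        fix v assume "v \<in> f ` Field L \<inter> {u<..}"
        then obtain z where z: "z \<in> Field L" "v = f z" "f w < f z"
          using w(2) by auto
        have "z \<notin> Field X"
          using fXY[of z w] 2 FY z(3) by fastforce
        then obtain k where k: "z \<in> Field (N k)"
          using FL[OF z(1)] FY by blast
        have "k \<le> j"
          using Nless[of j k] 2 k z(3) by (meson imageI leI less_asym)
        then show "v \<in> (\<Union>k\<in>{..j}. f ` Field (N k))"
          using k z(2) by blast
      qed
      ultimately show ?thesis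
        using crl_subset by blast
    qed
  qed
qed

text \<open>The descriptions found above concern sets of reals with their order; for arbitrary
  binary relations the axioms of linear orders have to be added. They are universal with a finitary
  matrix, so they fit into every positive level and admit the empty order.\<close>

definition linear_order_fm :: fm where
  "linear_order_fm = BigAnd (\<lambda>_. Unis [0, 1, 2]
     (And (Rel 0 0)
     (And (Or (Neg (And (Rel 0 1) (Rel 1 0))) (Eqv 0 1))
     (And (Or (Neg (And (Rel 0 1) (Rel 1 2))) (Rel 0 2))
          (Or (Rel 0 1) (Rel 1 0))))))"

lemma Pi_linear_order_fm: "0 < \<gamma> \<Longrightarrow> Pi_fm \<gamma> linear_order_fm"
  unfolding linear_order_fm_def by (intro Pi_pos) (auto intro!: exI[of _ 0] Sigma_zero finitary_qf.intros)

lemma fv_linear_order_fm: "fv linear_order_fm = {}"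
  by (auto simp: linear_order_fm_def Unis_def)

lemma sat_linear_order_fm:
  "sat A R s linear_order_fm \<longleftrightarrow>
    (\<forall>x\<in>A. \<forall>y\<in>A. \<forall>z\<in>A. (x, x) \<in> R \<and> ((x, y) \<in> R \<and> (y, x) \<in> R \<longrightarrow> x = y) \<and>
      ((x, y) \<in> R \<and> (y, z) \<in> R \<longrightarrow> (x, z) \<in> R) \<and> ((x, y) \<in> R \<or> (y, x) \<in> R))"
  by (auto simp: linear_order_fm_def Unis_def)

lemma models_linear_order_fm:
  assumes "models B S linear_order_fm" "S \<subseteq> B \<times> B"
  shows "Linear_order S" "Field S = B"
proof -
  have ax: "(x, x) \<in> S" "(x, y) \<in> S \<Longrightarrow> (y, x) \<in> S \<Longrightarrow> x = y"
      "(x, y) \<in> S \<Longrightarrow> (y, z) \<in> S \<Longrightarrow> (x, z) \<in> S" "(x, y) \<in> S \<or> (y, x) \<in> S"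
    if "x \<in> B" "y \<in> B" "z \<in> B" for x y z
    using assms(1) that unfolding models_def sat_linear_order_fm by blast+
  show F: "Field S = B"
  proof
    show "B \<subseteq> Field S"
      using ax(1) by (blast intro: FieldI1)
  qed (use assms(2) in \<open>auto simp: Field_def\<close>)
  have "refl_on B S" "trans S" "antisym S" "total_on B S"
  proof -
    show "refl_on B S"
      using ax(1) by (auto simp: refl_on_def)
    show "trans S"
      using ax(3) assms(2) by (intro transI) blast
    show "antisym S"
      using ax(2) assms(2) by (intro antisymI) blast
    show "total_on B S"
      using ax(4) by (auto simp: total_on_def)
  qed
  then show "Linear_order S"
    using assms(2) unfolding linear_order_on_def partial_order_on_def preorder_on_def F by blast
qed

lemma models_conj:
  fixes \<phi> \<psi> :: fm
  assumes "Pi_fm \<gamma> \<phi>" "Pi_fm \<gamma> \<psi>" "fv \<phi> = {}" "fv \<psi> = {}"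
  shows "\<exists>\<chi>. Pi_fm \<gamma> \<chi> \<and> fv \<chi> = {} \<and>
    (\<forall>(B :: 'a set) S. models B S \<chi> \<longleftrightarrow> models B S \<phi> \<and> models B S \<psi>)"
  using Pi_conj[OF assms(1,2), where 'a = 'a] assms(3,4) unfolding models_def by auto

theorem theorem2p4:
  fixes L :: "'a rel" and \<alpha> :: cord
  assumes "Linear_order L" and "countable (Field L)"
    and "simple_order L" and "has_hausdorff_rank L \<alpha>"
  shows "\<exists>\<phi>. Pi_fm (2 * \<alpha> + 1) \<phi> \<and> scott_sentence (Field L) L \<phi>"
proof -
  obtain f where f: "strict_embedding f L"
    using linear_order_embeds_real[OF assms(1,2)] by blast
  define U where "U = f ` Field L"
  have LU: "structure_iso f (Field L) L U LE"
    unfolding U_def by (rule structure_iso_embedding[OF assms(1) f])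
  have "countable U"
    unfolding U_def using assms(2) by simp
  then have "dP (2 * \<alpha> + 1) (\<lambda>Y. oiso Y U)"
    using dP_of_simple simple_order_crl[OF assms(3,4) f] unfolding U_def by blast
  from dP_sentence[OF this] obtain \<phi> where \<phi>: "Pi_fm (2 * \<alpha> + 1) \<phi>" "fv \<phi> = {}"
      "\<forall>X s. sat X LE s \<phi> \<longleftrightarrow> oiso X U"
    by blast
  obtain \<chi> where \<chi>: "Pi_fm (2 * \<alpha> + 1) \<chi>" "fv \<chi> = {}"
      "\<forall>(B :: nat set) S. models B S \<chi> \<longleftrightarrow> models B S linear_order_fm \<and> models B S \<phi>"
    using models_conj[OF Pi_linear_order_fm[OF add_one_pos_cord] \<phi>(1) fv_linear_order_fm \<phi>(2), where 'a = nat]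
    by blast
  have "models B S \<chi> \<longleftrightarrow> isomorphic_structures B S (Field L) L" if S: "S \<subseteq> B \<times> B" for B :: "nat set" and S
  proof
    assume "models B S \<chi>"
    then have lin: "models B S linear_order_fm" and mod: "models B S \<phi>"
      using \<chi>(3) by blast+
    note B = models_linear_order_fm[OF lin S]
    \<comment> \<open>A model of the axioms is moved into the reals, where \<phi> expresses
      isomorphism with \<open>U\<close>.\<close>
    obtain g where g: "strict_embedding g S"
      using linear_order_embeds_real[OF B(1)] by blast
    have BY: "structure_iso g B S (g ` B) LE"
      using structure_iso_embedding[OF B(1) g] unfolding B(2) .
    have "oiso (g ` B) U"
      using mod models_structure_iso[OF BY \<phi>(2)] \<phi>(3) by (simp add: models_def)
    then obtain h where "structure_iso h (g ` B) LE U LE"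
      using oiso_imp_structure_iso by blast
    from structure_iso_comp[OF structure_iso_comp[OF BY this] structure_iso_inv[OF LU]]
    show "isomorphic_structures B S (Field L) L"
      unfolding isomorphic_structures_def by blast
  next
    assume "isomorphic_structures B S (Field L) L"
    then obtain k where "structure_iso k B S (Field L) L"
      unfolding isomorphic_structures_def by blast
    note BU = structure_iso_comp[OF this LU]
    have "models U LE linear_order_fm"
      unfolding models_def sat_linear_order_fm LE_def by auto
    moreover have "models U LE \<phi>"
      unfolding models_def using \<phi>(3) oiso_refl by simp
    ultimately show "models B S \<chi>"
      using \<chi>(3) models_structure_iso[OF BU fv_linear_order_fm] models_structure_iso[OF BU \<phi>(2)] by blast
  qed
  then show ?thesis
    using \<chi>(1,2) unfolding scott_sentence_def by blast
qed

end
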